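(* Let $\tau$ be the maximizer of $W$ on $[0,1]$. There exists a sequence $(E_n)_{n\in\mathbb N}$ of closed (automatically nowhere dense) subsets of $[0,1]$ that is nondecreasing to $[0,1]$ $\mathscr L$-a.e. (i.e. $E_n\subset E_{n+1}$ for all $n$ and $\mathscr L([0,1]\setminus\bigcup_{n}E_n)=0$) and such that $\mathbb Q(\tau=\tau_{E_n})=0$ for all $n\in\mathbb N$.
   Context: $\mathscr L$ is Lebesgue measure on $\mathbb R$. $\Omega_0$ is the set of continuous $\omega:\mathbb R\to\mathbb R$ with $\omega(0)=0$ having countably infinitely many (times of strict) local maxima; $\mathbb W$ is the completed two-sided Wiener measure on $\Omega_0$, $W$ the coordinate process. The maximizer $\tau$ of $W$ on $[0,1]$ is the ($\mathbb W$-a.s. unique) time at which $W$ attains its maximum on $[0,1]$ (with a value $\dagger\notin\mathbb R$ on the null event where this time is not unique or is not a local maximum of $W$). $\mathbb Q$ is a complete extension of $\mathbb W$ (random elements under $\mathbb W$ being regarded as random elements under $\mathbb Q$) supporting an $\Omega_0$-valued two-sided Brownian motion $W'$ independent of $W$. For Lebesgue-measurable $E$, $\mathbf 1_E\cdot W$ is the continuous version, vanishing at $0$, of $t\mapsto\int_0^t\mathbf 1_E(s)\,dW_s$; $W_E=\mathbf 1_E\cdot W+\mathbf 1_{\mathbb R\setminus E}\cdot W'$, taken $\Omega_0$-valued, and $\tau_E=\tau(W_E)$, i.e. $\tau_E$ is the maximizer of $W_E$ on $[0,1]$. *)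

theory Defs
  imports "HOL-Probability.Probability"
begin

definition strict_local_max :: "(real \<Rightarrow> real) \<Rightarrow> real \<Rightarrow> bool" where
  "strict_local_max w t \<longleftrightarrow> (\<forall>\<^sub>F s in at t. w s < w t)"

definition Omega0 :: "(real \<Rightarrow> real) set" where
  "Omega0 = {w. continuous_on UNIV w \<and> w 0 = 0 \<and>
     countable {t. strict_local_max w t} \<and> infinite {t. strict_local_max w t}}"

text \<open>The \<open>\<sigma>\<close>-algebra on \<^term>\<open>Omega0\<close> generated by the coordinate maps (only space and
  \<open>\<sigma>\<close>-algebra of this measure are of interest).\<close>

definition path_algebra :: "(real \<Rightarrow> real) measure" where
  "path_algebra = restrict_space (Pi\<^sub>M UNIV (\<lambda>_. borel)) Omega0"

definition two_sided_BM :: "'w measure \<Rightarrow> ('w \<Rightarrow> real \<Rightarrow> real) \<Rightarrow> bool" where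
  "two_sided_BM M B \<longleftrightarrow>
     prob_space M \<and>
     (\<forall>t. (\<lambda>w. B w t) \<in> borel_measurable M) \<and>
     (\<forall>w\<in>space M. B w 0 = 0 \<and> continuous_on UNIV (B w)) \<and>
     (\<forall>s t. s < t \<longrightarrow>
        distributed M lborel (\<lambda>w. B w t - B w s) (normal_density 0 (sqrt (t - s)))) \<and>
     (\<forall>(t :: nat \<Rightarrow> real) n. mono t \<longrightarrow>
        prob_space.indep_vars M (\<lambda>_. borel) (\<lambda>i w. B w (t (Suc i)) - B w (t i)) {..<n})"

text \<open>The coordinate process being a Brownian motion determines the measure \<open>P\<close> on the coordinate
  \<open>\<sigma>\<close>-algebra uniquely, so there is at most one \<open>WW\<close> with this property.\<close>

definition completed_wiener_measure :: "(real \<Rightarrow> real) measure \<Rightarrow> bool" where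
  "completed_wiener_measure WW \<longleftrightarrow>
     (\<exists>P. sets P = sets path_algebra \<and> two_sided_BM P (\<lambda>w. w) \<and> WW = completion P)"

text \<open>\<open>Q\<close> extends \<open>WW\<close> through the measure-preserving map \<open>W\<close>; a random element \<open>X\<close> under \<open>WW\<close>
  becomes the random element \<open>X \<circ> W\<close> under \<open>Q\<close>, and in particular the coordinate process
  becomes \<open>W\<close> itself.\<close>

definition wiener_extension ::
    "(real \<Rightarrow> real) measure \<Rightarrow> 'w measure \<Rightarrow> ('w \<Rightarrow> real \<Rightarrow> real) \<Rightarrow> ('w \<Rightarrow> real \<Rightarrow> real) \<Rightarrow> bool" where
  "wiener_extension WW Q W W' \<longleftrightarrow>
     prob_space Q \<and> complete_measure Q \<and>
     W \<in> measurable Q WW \<and> distr Q WW W = WW \<and>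
     two_sided_BM Q W' \<and> (\<forall>w\<in>space Q. W' w \<in> Omega0) \<and>
     prob_space.indep_var Q path_algebra W path_algebra W'"

text \<open>Step functions \<open>\<Sum> c 1\<^bsub>(a,b]\<^esub>\<close>, represented by lists of triples \<open>(c, a, b)\<close> with \<open>a \<le> b\<close>,
  and their elementary integrals \<open>\<Sum> c (B b - B a)\<close>.\<close>

definition step_list :: "(real \<times> real \<times> real) list \<Rightarrow> bool" where
  "step_list p \<longleftrightarrow> (\<forall>(c, a, b) \<in> set p. a \<le> b)"

definition step_fun :: "(real \<times> real \<times> real) list \<Rightarrow> real \<Rightarrow> real" where
  "step_fun p x = (\<Sum>(c, a, b)\<leftarrow>p. c * indicator {a<..b} x)"

definition step_integral :: "(real \<times> real \<times> real) list \<Rightarrow> (real \<Rightarrow> real) \<Rightarrow> real" where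
  "step_integral p v = (\<Sum>(c, a, b)\<leftarrow>p. c * (v b - v a))"

text \<open>\<open>X\<close> is a version of the Wiener integral \<open>\<integral> f dB\<close>, i.e. of the value at \<open>f\<close> of the isometric
  extension to \<open>L\<^sup>2\<close> of the elementary integral.\<close>

definition has_wiener_integral ::
    "'w measure \<Rightarrow> ('w \<Rightarrow> real \<Rightarrow> real) \<Rightarrow> (real \<Rightarrow> real) \<Rightarrow> ('w \<Rightarrow> real) \<Rightarrow> bool" where
  "has_wiener_integral M B f X \<longleftrightarrow>
     f \<in> borel_measurable lebesgue \<and> X \<in> borel_measurable M \<and>
     (\<exists>p :: nat \<Rightarrow> (real \<times> real \<times> real) list.
        (\<forall>n. step_list (p n)) \<and>
        (\<lambda>n. \<integral>\<^sup>+ x. ennreal ((f x - step_fun (p n) x)\<^sup>2) \<partial>lebesgue) \<longlonglongrightarrow> 0 \<and>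
        (\<lambda>n. \<integral>\<^sup>+ w. ennreal ((X w - step_integral (p n) (B w))\<^sup>2) \<partial>M) \<longlonglongrightarrow> 0)"

text \<open>The function whose integral over the line is \<open>\<integral>\<^bsub>0\<^esub>\<^bsup>t\<^esup> 1\<^bsub>E\<^esub>\<close>, where
  \<open>\<integral>\<^bsub>0\<^esub>\<^bsup>t\<^esup> = - \<integral>\<^bsub>t\<^esub>\<^bsup>0\<^esup>\<close> for \<open>t < 0\<close>.\<close>

definition integrand :: "real set \<Rightarrow> real \<Rightarrow> real \<Rightarrow> real" where
  "integrand E t s =
     (if 0 \<le> t then indicator (E \<inter> {0<..t}) s else - indicator (E \<inter> {t<..0}) s)"

text \<open>\<open>Y\<close> is the process \<open>1\<^bsub>E\<^esub> \<cdot> B\<close> (unique up to indistinguishability).\<close>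

definition indicator_integral ::
    "'w measure \<Rightarrow> ('w \<Rightarrow> real \<Rightarrow> real) \<Rightarrow> real set \<Rightarrow> ('w \<Rightarrow> real \<Rightarrow> real) \<Rightarrow> bool" where
  "indicator_integral M B E Y \<longleftrightarrow>
     (\<forall>w\<in>space M. Y w 0 = 0 \<and> continuous_on UNIV (Y w)) \<and>
     (\<forall>t. has_wiener_integral M B (integrand E t) (\<lambda>w. Y w t))"

text \<open>\<open>V\<close> is the process \<open>W\<^bsub>E\<^esub>\<close>; the sum of the two integrals has almost all its paths in
  \<^term>\<open>Omega0\<close> and is modified on a null set to take all its values there.\<close>

definition mixed_process ::
    "'w measure \<Rightarrow> ('w \<Rightarrow> real \<Rightarrow> real) \<Rightarrow> ('w \<Rightarrow> real \<Rightarrow> real) \<Rightarrow> real set \<Rightarrow>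
     ('w \<Rightarrow> real \<Rightarrow> real) \<Rightarrow> bool" where
  "mixed_process Q W W' E V \<longleftrightarrow>
     (\<forall>w\<in>space Q. V w \<in> Omega0) \<and>
     (\<exists>Y Y'. indicator_integral Q W E Y \<and> indicator_integral Q W' (- E) Y' \<and>
        (AE w in Q. \<forall>t. V w t = Y w t + Y' w t))"

definition max_time01 :: "(real \<Rightarrow> real) \<Rightarrow> real \<Rightarrow> bool" where
  "max_time01 w t \<longleftrightarrow> t \<in> {0..1} \<and> (\<forall>s\<in>{0..1}. w s \<le> w t)"

text \<open>\<^term>\<open>None\<close> plays the role of the cemetery value.  Being a local maximum refers to the path on
  the whole line.\<close>

definition maximizer :: "(real \<Rightarrow> real) \<Rightarrow> real option" where
  "maximizer w =
     (if (\<exists>!t. max_time01 w t) \<and> strict_local_max w (THE t. max_time01 w t)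
      then Some (THE t. max_time01 w t) else None)"

end

theory Submission
  imports Defs
begin

text \<open>
  The process \<open>W\<^sub>E\<close> is \<open>W\<close> with its increments outside \<open>E\<close> replaced by independent ones.  Suppose that the
  complement of \<open>E\<close> fills at least a fraction \<open>\<eta>\<close> of every dyadic cell of some level \<open>e\<close>.  Then the
  increments of \<open>W\<close> and \<open>W\<^sub>E\<close> over these cells are independent pairs of normal variables with
  correlations at most \<open>1 - \<eta>\<close>.  For an event \<open>A\<close> about the \<open>2 ^ e\<close> increments, the probability that both
  processes satisfy \<open>A\<close> is the noise stability of \<open>A\<close>, and by hypercontractivity it is at most
  \<open>P(A)\<close> to the power \<open>1 + 1/K\<close>, where \<open>K\<close> depends on \<open>\<eta>\<close> but not on the dimension
  (\<open>stability_small_sets\<close>).  Divide the unit interval into blocks and let \<open>A\<^sub>i\<close> be the event that the grid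
  maximum lies in the \<open>i\<close>-th block.  A discrete arcsine law (\<open>argmax_in_block_bound\<close>) makes all
  \<open>P(A\<^sub>i)\<close> small when there are many blocks.  The events are disjoint, so summing over \<open>i\<close> shows that both
  grid maxima lie in the same block with small probability (\<open>same_block_probability\<close>).  On a fine
  grid the block of the grid maximum is that of the true maximizer, except with small probability, because
  the maximum of Brownian motion on \<open>[0, 1]\<close> is attained at one point only, which is not dyadic
  (\<open>BM_unique_max\<close>).  Hence for every \<open>\<eta>\<close> there is a level \<open>e\<close> such that all these sets \<open>E\<close> have a
  probability of at most \<open>3\<eta>\<close> for a common maximizer (\<open>decorrelating_level_exists\<close>).

  This is applied with \<open>\<eta> = 2\<^sup>-\<^sup>j\<close> for every \<open>j\<close> at once.  With \<open>e\<^sub>j\<close> the level that belongs to \<open>j\<close>, let \<open>U\<^sub>j\<close>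
  consist of the initial piece of relative length \<open>2\<^sup>-\<^sup>j\<close> of each cell of level \<open>e\<^sub>j\<close>, and let \<open>E\<^sub>n\<close> be
  \<open>[0, 1]\<close> without \<open>U\<^sub>j\<close> for all \<open>j \<ge> n\<close>.  The measures of the \<open>U\<^sub>j\<close> are summable, so the \<open>E\<^sub>n\<close>
  exhaust \<open>[0, 1]\<close> up to a null set.  They are nowhere dense because \<open>e\<^sub>j \<ge> j\<close> makes the gaps between the
  pieces of \<open>U\<^sub>j\<close> shrink.  For \<open>E\<^sub>n\<close> the maximizers agree with probability at
  most \<open>3 \<cdot> 2\<^sup>-\<^sup>j\<close> for all \<open>j \<ge> n\<close>, hence with probability zero.

  As \<open>E\<^sub>n\<close> is not a union of cells, \<open>W\<^sub>E\<close> is approximated by paths patched together from \<open>W\<close> and \<open>W'\<close>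
  cell by cell on finer and finer grids.  The isometry of the Wiener integral bounds the error in
  \<open>L\<^sup>2\<close> by the measure of the set where \<open>E\<^sub>n\<close> differs from the union of the kept cells
  (\<open>mixed_process_error\<close>), which is summable along the approximation, so the values at dyadic points
  converge almost surely.  All events above are open conditions on finitely many such values,
  and their probability bounds therefore pass to the limit.
\<close>

section \<open>Mehler's kernel on the line\<close>

definition gauss :: "real measure" where
  "gauss = density lborel (\<lambda>x. ennreal (std_normal_density x))"

lemma sets_gauss[measurable_cong, simp]: "sets gauss = sets borel"
  and space_gauss[simp]: "space gauss = UNIV"
  by (auto simp: gauss_def)

lemma prob_space_gauss: "prob_space gauss"
  unfolding gauss_def by (rule prob_space_normal_density) simp

interpretation gauss: prob_space gauss by (rule prob_space_gauss)

lemma nn_integral_gauss: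
  assumes [measurable]: "f \<in> borel_measurable borel"
  shows "(\<integral>\<^sup>+x. f x \<partial>gauss) = (\<integral>\<^sup>+x. f x * ennreal (std_normal_density x) \<partial>lborel)"
  unfolding gauss_def by (subst nn_integral_density) (auto simp: mult.commute)

lemma nn_integral_normal_density:
  "0 < \<sigma> \<Longrightarrow> (\<integral>\<^sup>+x. ennreal (normal_density \<mu> \<sigma> x) \<partial>lborel) = 1"
  by (subst nn_integral_eq_integral) auto

text \<open>Products of normal densities are compared by completing the square: the exponents and the
  products of the variances have to agree.\<close>

lemma normal_density_mult_eqI:
  assumes "0 < u" "0 < v" "0 < p" "0 < q" "u * v = p * q"
    and "(x - a)\<^sup>2 / u + (y - b)\<^sup>2 / v = (z - c)\<^sup>2 / p + (w - d)\<^sup>2 / q"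
  shows "normal_density a (sqrt u) x * normal_density b (sqrt v) y
       = normal_density c (sqrt p) z * normal_density d (sqrt q) w"
proof -
  have "sqrt (2 * pi * u) * sqrt (2 * pi * v) = sqrt (2 * pi * p) * sqrt (2 * pi * q)"
    using assms(5) by (simp add: real_sqrt_mult[symmetric] algebra_simps)
  moreover have "- (x - a)\<^sup>2 / (2 * u) + - (y - b)\<^sup>2 / (2 * v)
      = - (z - c)\<^sup>2 / (2 * p) + - (w - d)\<^sup>2 / (2 * q)"
    using assms(6) by (simp add: field_simps)
  ultimately show ?thesis
    using assms(1-4) by (simp add: normal_density_def mult_exp_exp)
qed

text \<open>The transition density of the Ornstein--Uhlenbeck noise: the conditional law of one of two
  standard normal variables with correlation \<open>r\<close>, given the other one.\<close>

definition mehler :: "real \<Rightarrow> real \<Rightarrow> real \<Rightarrow> real" where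
  "mehler r x y = normal_density (r * x) (sqrt (1 - r\<^sup>2)) y"

lemma mehler_measurable[measurable]:
  "(\<lambda>p. mehler r (fst p) (snd p)) \<in> borel_measurable (borel \<Otimes>\<^sub>M borel)"
  "mehler r x \<in> borel_measurable borel"
  unfolding mehler_def normal_density_def by measurable

lemma mehler_measurable'[measurable (raw)]:
  assumes [measurable]: "f \<in> borel_measurable M" "g \<in> borel_measurable M"
  shows "(\<lambda>w. mehler r (f w) (g w)) \<in> borel_measurable M"
  unfolding mehler_def normal_density_def by measurable

lemma mehler_nonneg[simp]: "0 \<le> mehler r x y"
  by (simp add: mehler_def)

lemma mehler_0: "mehler 0 x y = std_normal_density y"
  by (simp add: mehler_def)

lemma one_minus_sq_pos: "\<bar>r\<bar> < 1 \<Longrightarrow> 0 < 1 - (r::real)\<^sup>2"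
  using abs_square_less_1[of r] by linarith

lemma nn_integral_mehler: "\<bar>r\<bar> < 1 \<Longrightarrow> (\<integral>\<^sup>+y. ennreal (mehler r x y) \<partial>lborel) = 1"
  unfolding mehler_def by (rule nn_integral_normal_density) (use one_minus_sq_pos[of r] in simp)

lemma mehler_symmetric:
  assumes "\<bar>r\<bar> < 1"
  shows "std_normal_density x * mehler r x y = std_normal_density y * mehler r y x"
proof -
  have p: "0 < 1 - r\<^sup>2" by (rule one_minus_sq_pos) fact
  have "normal_density 0 (sqrt 1) x * normal_density (r * x) (sqrt (1 - r\<^sup>2)) y
      = normal_density 0 (sqrt 1) y * normal_density (r * y) (sqrt (1 - r\<^sup>2)) x"
    using p by (intro normal_density_mult_eqI) (auto simp: field_simps power2_eq_square)
  then show ?thesis by (simp add: mehler_def)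
qed

lemma mehler_semigroup:
  assumes "\<bar>r\<bar> < 1" "\<bar>s\<bar> < 1"
  shows "(\<integral>\<^sup>+y. ennreal (mehler r x y) * ennreal (mehler s y z) \<partial>lborel) = ennreal (mehler (r * s) x z)"
proof -
  have p: "0 < 1 - r\<^sup>2" "0 < 1 - s\<^sup>2" by (rule one_minus_sq_pos; fact)+
  have rs: "0 < 1 - (r * s)\<^sup>2"
    using abs_mult_less[of r 1 s 1] assms by (intro one_minus_sq_pos) (simp add: abs_mult)
  let ?v = "(1 - r\<^sup>2) * (1 - s\<^sup>2) / (1 - (r * s)\<^sup>2)"
  let ?m = "(r * x * (1 - s\<^sup>2) + s * z * (1 - r\<^sup>2)) / (1 - (r * s)\<^sup>2)"
  have *: "mehler r x y * mehler s y z = mehler (r * s) x z * normal_density ?m (sqrt ?v) y" for y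
    unfolding mehler_def
  proof (rule normal_density_mult_eqI)
    have ne: "1 - r\<^sup>2 \<noteq> 0" "1 - s\<^sup>2 \<noteq> 0" "1 - (r * s)\<^sup>2 \<noteq> 0" using p rs by auto
    define a b c where "a = 1 - r\<^sup>2" and "b = 1 - s\<^sup>2" and "c = 1 - (r * s)\<^sup>2"
    have abc: "a \<noteq> 0" "b \<noteq> 0" "c \<noteq> 0" using ne by (auto simp: a_def b_def c_def)
    have c: "c = b + s\<^sup>2 * a" by (simp add: a_def b_def c_def power_mult_distrib algebra_simps)
    have "(y - r * x)\<^sup>2 / a + (z - s * y)\<^sup>2 / b
      = (z - r * s * x)\<^sup>2 / c + (y - (r * x * b + s * z * a) / c)\<^sup>2 / (a * b / c)"
    proof -
      have "c * ((y - r * x)\<^sup>2 * b + (z - s * y)\<^sup>2 * a)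
        = (z - r * s * x)\<^sup>2 * a * b + (c * y - (r * x * b + s * z * a))\<^sup>2"
        unfolding c by (simp add: power2_eq_square algebra_simps)
      moreover have "(y - (r * x * b + s * z * a) / c)\<^sup>2 / (a * b / c) = (c * y - (r * x * b + s * z * a))\<^sup>2 / (a * b * c)"
        using abc by (simp add: field_simps power2_eq_square)
      moreover have "(z - r * s * x)\<^sup>2 / c = (z - r * s * x)\<^sup>2 * a * b / (a * b * c)"
        using abc by (simp add: field_simps)
      moreover have "(y - r * x)\<^sup>2 / a + (z - s * y)\<^sup>2 / b = c * ((y - r * x)\<^sup>2 * b + (z - s * y)\<^sup>2 * a) / (a * b * c)"
        using abc by (simp add: field_simps)
      ultimately show ?thesis by (simp add: add_divide_distrib)
    qed
    then show "(y - r * x)\<^sup>2 / (1 - r\<^sup>2) + (z - s * y)\<^sup>2 / (1 - s\<^sup>2) =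
      (z - r * s * x)\<^sup>2 / (1 - (r * s)\<^sup>2) + (y - ?m)\<^sup>2 / ?v"
      by (simp add: a_def b_def c_def)
  qed (use p rs in auto)
  have "(\<integral>\<^sup>+y. ennreal (mehler r x y) * ennreal (mehler s y z) \<partial>lborel)
      = (\<integral>\<^sup>+y. ennreal (mehler (r * s) x z) * ennreal (normal_density ?m (sqrt ?v) y) \<partial>lborel)"
    by (intro nn_integral_cong) (simp add: ennreal_mult[symmetric] *)
  also have "\<dots> = ennreal (mehler (r * s) x z)"
    using p rs by (subst nn_integral_cmult) (auto simp: nn_integral_normal_density)
  finally show ?thesis .
qed

text \<open>If \<open>A\<close>, \<open>B\<close>, \<open>B'\<close> are independent with variances \<open>s\<close>, \<open>1 - s\<close>, \<open>1 - s\<close>, then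
  \<open>A + B\<close> and \<open>A + B'\<close> are standard normal with correlation \<open>s\<close>.  This is how correlation arises
  between \<open>W\<close> and \<open>W\<^sub>E\<close>: \<open>A\<close> collects the increments on \<open>E\<close>.\<close>

lemma mehler_common_part:
  assumes "0 < s" "s < 1"
  shows "(\<integral>\<^sup>+a. ennreal (normal_density 0 (sqrt s) a) *
      (ennreal (normal_density 0 (sqrt (1 - s)) (x - a)) * ennreal (normal_density 0 (sqrt (1 - s)) (y - a))) \<partial>lborel)
    = ennreal (std_normal_density x) * ennreal (mehler s x y)"
proof -
  let ?w = "s * (1 - s) / (1 + s)"
  have 1: "normal_density 0 (sqrt s) a * normal_density 0 (sqrt (1 - s)) (x - a)
      = normal_density 0 (sqrt 1) x * normal_density (s * x) (sqrt (s * (1 - s))) a" for a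
    using assms by (intro normal_density_mult_eqI) (auto simp: field_simps power2_eq_square)
  have 2: "normal_density (s * x) (sqrt (s * (1 - s))) a * normal_density 0 (sqrt (1 - s)) (y - a)
      = normal_density (s * x) (sqrt (1 - s\<^sup>2)) y * normal_density (s * (x + y) / (1 + s)) (sqrt ?w) a" for a
  proof (rule normal_density_mult_eqI)
    have f: "1 - s\<^sup>2 = (1 - s) * (1 + s)" by (simp add: power2_eq_square algebra_simps)
    show "0 < 1 - s\<^sup>2" using assms unfolding f by simp
    define t where "t = 1 - s"
    have t: "t > 0" "1 + s > 0" using assms by (auto simp: t_def)
    have "(a - s * x)\<^sup>2 * (1 + s) + (y - a - 0)\<^sup>2 * s * (1 + s) =
        (y - s * x)\<^sup>2 * s + ((1 + s) * a - s * (x + y))\<^sup>2 "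
      by (simp add: power2_eq_square algebra_simps)
    then have "((a - s * x)\<^sup>2 * (1 + s) + (y - a - 0)\<^sup>2 * s * (1 + s)) / (s * t * (1 + s)) =
        ((y - s * x)\<^sup>2 * s + ((1 + s) * a - s * (x + y))\<^sup>2) / (s * t * (1 + s))" by simp
    moreover have "(a - s * (x + y) / (1 + s))\<^sup>2 / (s * t / (1 + s)) = ((1 + s) * a - s * (x + y))\<^sup>2 / (s * t * (1 + s))"
    proof -
      have "a - s * (x + y) / (1 + s) = ((1 + s) * a - s * (x + y)) / (1 + s)"
        using t by (simp add: diff_divide_distrib)
      then show ?thesis by (simp add: power_divide power2_eq_square)
    qed
    ultimately have "(a - s * x)\<^sup>2 / (s * t) + (y - a - 0)\<^sup>2 / t =
       (y - s * x)\<^sup>2 / (t * (1 + s)) + (a - s * (x + y) / (1 + s))\<^sup>2 / (s * t / (1 + s))"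
      using assms t by (simp add: add_divide_distrib)
    then show "(a - s * x)\<^sup>2 / (s * (1 - s)) + (y - a - 0)\<^sup>2 / (1 - s) =
       (y - s * x)\<^sup>2 / (1 - s\<^sup>2) + (a - s * (x + y) / (1 + s))\<^sup>2 / (s * (1 - s) / (1 + s))"
      unfolding f t_def .
    show "s * (1 - s) * (1 - s) = (1 - s\<^sup>2) * (s * (1 - s) / (1 + s))"
      unfolding f using assms by (simp add: field_simps)
  qed (use assms in auto)
  have "(\<integral>\<^sup>+a. ennreal (normal_density 0 (sqrt s) a) *
      (ennreal (normal_density 0 (sqrt (1 - s)) (x - a)) * ennreal (normal_density 0 (sqrt (1 - s)) (y - a))) \<partial>lborel)
    = (\<integral>\<^sup>+a. (ennreal (std_normal_density x) * ennreal (mehler s x y)) *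
        ennreal (normal_density (s * (x + y) / (1 + s)) (sqrt ?w) a) \<partial>lborel)"
  proof (rule nn_integral_cong)
    fix a
    have "normal_density 0 (sqrt s) a * (normal_density 0 (sqrt (1 - s)) (x - a) * normal_density 0 (sqrt (1 - s)) (y - a))
      = std_normal_density x * mehler s x y * normal_density (s * (x + y) / (1 + s)) (sqrt ?w) a"
      unfolding mult.assoc[symmetric] 1[of a] using 2[of a] by (simp add: mehler_def mult.assoc)
    then show "ennreal (normal_density 0 (sqrt s) a) *
      (ennreal (normal_density 0 (sqrt (1 - s)) (x - a)) * ennreal (normal_density 0 (sqrt (1 - s)) (y - a)))
      = (ennreal (std_normal_density x) * ennreal (mehler s x y)) *
        ennreal (normal_density (s * (x + y) / (1 + s)) (sqrt ?w) a)"
      by (simp add: ennreal_mult[symmetric])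
  qed
  also have "\<dots> = ennreal (std_normal_density x) * ennreal (mehler s x y)"
    using assms by (subst nn_integral_cmult) (auto simp: nn_integral_normal_density)
  finally show ?thesis .
qed

text \<open>With \<open>K\<close> the kernel of the noise operator relative to the Gaussian measure, this is
  \<open>\<integral> K(x, y)\<^sup>2\<close> in the variable \<open>y\<close>.\<close>

definition mehler_sq :: "real \<Rightarrow> real \<Rightarrow> real" where
  "mehler_sq r x = exp (r\<^sup>2 * x\<^sup>2 / (1 + r\<^sup>2)) / sqrt (1 - r ^ 4)"

lemma mehler_sq_eq:
  assumes "\<bar>r\<bar> < 1"
  shows "(mehler r x y)\<^sup>2 = mehler_sq r x * std_normal_density y * 
    normal_density (2 * r * x / (1 + r\<^sup>2)) (sqrt ((1 - r\<^sup>2) / (1 + r\<^sup>2))) y"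
proof -
  define b where "b = r\<^sup>2"
  have b: "0 \<le> b" "b < 1" using one_minus_sq_pos[OF assms] by (auto simp: b_def)
  have r4: "1 - r ^ 4 = (1 - b) * (1 + b)"
    by (simp add: b_def power2_eq_square algebra_simps eval_nat_numeral)
  have bp: "(1 - b) * (1 + b) > 0" using b by simp
  have E: "- (y - r * x)\<^sup>2 / (2 * (1 - b)) * 2 
     = b * x\<^sup>2 / (1 + b) + - y\<^sup>2 / 2 + - (y - 2 * r * x / (1 + b))\<^sup>2 / (2 * ((1 - b) / (1 + b)))"
  proof -
    have "- (y - r * x)\<^sup>2 * 2 * (1 + b) = 2 * b * x\<^sup>2 * (1 - b) - y\<^sup>2 * (1 - b) * (1 + b) - ((1 + b) * y - 2 * r * x)\<^sup>2"
      unfolding b_def by (simp add: power2_eq_square algebra_simps)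
    then have "- (y - r * x)\<^sup>2 * 2 * (1 + b) / (2 * (1 - b) * (1 + b)) 
      = (2 * b * x\<^sup>2 * (1 - b) - y\<^sup>2 * (1 - b) * (1 + b) - ((1 + b) * y - 2 * r * x)\<^sup>2) / (2 * (1 - b) * (1 + b))"
      by simp
    moreover have "- (y - r * x)\<^sup>2 * 2 * (1 + b) / (2 * (1 - b) * (1 + b)) = - (y - r * x)\<^sup>2 / (2 * (1 - b)) * 2"
      using b by simp
    moreover have "(y - 2 * r * x / (1 + b))\<^sup>2 / (2 * ((1 - b) / (1 + b))) = ((1 + b) * y - 2 * r * x)\<^sup>2 / (2 * (1 - b) * (1 + b))"
    proof -
      have "y - 2 * r * x / (1 + b) = ((1 + b) * y - 2 * r * x) / (1 + b)"
        using b by (simp add: diff_divide_distrib)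
      then show ?thesis by (simp add: power_divide power2_eq_square)
    qed
    moreover have "(2 * b * x\<^sup>2 * (1 - b)) / (2 * (1 - b) * (1 + b)) = b * x\<^sup>2 / (1 + b)"
      using b by (simp add: divide_simps)
    moreover have "(y\<^sup>2 * (1 - b) * (1 + b)) / (2 * (1 - b) * (1 + b)) = y\<^sup>2 / 2"
      using b by (simp add: divide_simps)
    ultimately show ?thesis by (simp add: diff_divide_distrib)
  qed
  have S: "(sqrt (2 * pi * (1 - b)))\<^sup>2 = sqrt ((1 - b) * (1 + b)) * sqrt (2 * pi) * sqrt (2 * pi * ((1 - b) / (1 + b)))"
  proof -
    have "sqrt ((1 - b) * (1 + b)) * sqrt (2 * pi) * sqrt (2 * pi * ((1 - b) / (1 + b)))
       = sqrt ((2 * pi * (1 - b))\<^sup>2)"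
      unfolding real_sqrt_mult[symmetric] using b by (intro arg_cong[where f = sqrt]) (simp add: field_simps power2_eq_square)
    then show ?thesis using b by simp
  qed
  have "(mehler r x y)\<^sup>2 = (1 / (sqrt (2 * pi * (1 - b)))\<^sup>2) * exp (- (y - r * x)\<^sup>2 / (2 * (1 - b)) * 2)"
    unfolding mehler_def normal_density_def using b
    by (simp add: b_def[symmetric] power_mult_distrib power_divide exp_double[symmetric] mult.commute)
  also have "\<dots> = mehler_sq r x * std_normal_density y * 
    normal_density (2 * r * x / (1 + b)) (sqrt ((1 - b) / (1 + b))) y"
    unfolding E S mehler_sq_def normal_density_def r4 using b
    by (simp add: b_def[symmetric] mult_exp_exp)
  finally show ?thesis by (simp add: b_def)
qed

lemma mehler_sq_integral:
  assumes "r\<^sup>2 \<le> 1 / 64"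
  shows "(\<integral>\<^sup>+x. ennreal ((mehler_sq r x)\<^sup>2) \<partial>gauss) \<le> ennreal (26 / 25)"
proof -
  define b where "b = r\<^sup>2"
  have b: "0 \<le> b" "b \<le> 1 / 64" using assms by (auto simp: b_def)
  have r4: "1 - r ^ 4 = (1 - b) * (1 + b)"
    by (simp add: b_def power2_eq_square algebra_simps eval_nat_numeral)
  let ?w = "(1 + b) / (1 - 3 * b)" 
  have w: "0 < ?w" using b by simp
  have e: "(mehler_sq r x)\<^sup>2 * std_normal_density x = (sqrt ?w / (1 - r ^ 4)) * normal_density 0 (sqrt ?w) x" for x
  proof -
    have "(mehler_sq r x)\<^sup>2 * std_normal_density x
      = (1 / (1 - r ^ 4)) * (1 / sqrt (2 * pi)) * exp (b * x\<^sup>2 / (1 + b) * 2 + - x\<^sup>2 / 2)"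
      unfolding mehler_sq_def normal_density_def using b
      by (simp add: r4 b_def[symmetric] power_divide exp_double[symmetric] mult_exp_exp mult.commute)
    also have "b * x\<^sup>2 / (1 + b) * 2 + - x\<^sup>2 / 2 = - x\<^sup>2 / (2 * ?w)"
    proof -
      have "- x\<^sup>2 / (2 * ?w) = - x\<^sup>2 * (1 - 3 * b) / (2 * (1 + b))"
        by simp
      also have "\<dots> = (4 * b * x\<^sup>2 - x\<^sup>2 * (1 + b)) / (2 * (1 + b))"
        by (simp add: algebra_simps)
      also have "\<dots> = b * x\<^sup>2 / (1 + b) * 2 + - x\<^sup>2 / 2"
      proof -
        have "(x\<^sup>2 * (1 + b)) / (2 * (1 + b)) = x\<^sup>2 / 2" "(4 * b * x\<^sup>2) / (2 * (1 + b)) = b * x\<^sup>2 / (1 + b) * 2"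
          using b by (auto simp: divide_simps)
        then show ?thesis by (simp add: diff_divide_distrib)
      qed
      finally show ?thesis by simp
    qed
    also have "(1 / (1 - r ^ 4)) * (1 / sqrt (2 * pi)) * exp (- x\<^sup>2 / (2 * ?w)) =
       (sqrt ?w / (1 - r ^ 4)) * normal_density 0 (sqrt ?w) x"
    proof -
      have "sqrt (2 * pi * ?w) = sqrt (2 * pi) * sqrt ?w" "sqrt ?w > 0" "(sqrt ?w)\<^sup>2 = ?w"
        using w by (auto simp only: real_sqrt_mult real_sqrt_gt_zero real_sqrt_pow2)
      then show ?thesis unfolding normal_density_def using b by simp
    qed
    finally show ?thesis .
  qed
  have "(\<integral>\<^sup>+x. ennreal ((mehler_sq r x)\<^sup>2) \<partial>gauss) = (\<integral>\<^sup>+x. ennreal (sqrt ?w / (1 - r ^ 4)) * ennreal (normal_density 0 (sqrt ?w) x) \<partial>lborel)"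
  proof -
    have [measurable]: "mehler_sq r \<in> borel_measurable borel" unfolding mehler_sq_def by measurable
    have "ennreal ((mehler_sq r x)\<^sup>2) * ennreal (std_normal_density x)
      = ennreal (sqrt ?w / (1 - r ^ 4)) * ennreal (normal_density 0 (sqrt ?w) x)" for x
    proof -
      have "0 \<le> sqrt ?w / (1 - r ^ 4)" using b w unfolding r4 by simp
      then show ?thesis by (simp only: ennreal_mult[symmetric] zero_le_power2 normal_density_nonneg e)
    qed
    then show ?thesis by (subst nn_integral_gauss) auto
  qed
  also have "\<dots> = ennreal (sqrt ?w / (1 - r ^ 4))"
    using w by (subst nn_integral_cmult) (auto simp: nn_integral_normal_density)
  also have "\<dots> \<le> ennreal (26 / 25)"
  proof (rule ennreal_leI)
    have "?w \<le> (65 / 64) / (61 / 64)" using b by (intro frac_le) auto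
    also have "\<dots> \<le> (1033 / 1000)\<^sup>2" by (simp add: power2_eq_square)
    finally have 1: "sqrt ?w \<le> 1033 / 1000" by (intro real_le_lsqrt) auto
    have "b * b \<le> (1/64) * (1/64)" using b by (intro mult_mono) auto
    then have 2: "1 - r ^ 4 \<ge> 4095 / 4096" unfolding r4 by (simp add: algebra_simps)
    have "sqrt ?w / (1 - r ^ 4) \<le> (1033 / 1000) / (4095 / 4096)"
      using 1 2 w by (intro frac_le) auto
    also have "\<dots> \<le> 26 / 25" by simp
    finally show "sqrt ?w / (1 - r ^ 4) \<le> 26 / 25" .
  qed
  finally show ?thesis .
qed

definition mehler_op :: "real \<Rightarrow> (real \<Rightarrow> ennreal) \<Rightarrow> real \<Rightarrow> ennreal" where
  "mehler_op r f x = (\<integral>\<^sup>+y. f y * ennreal (mehler r x y) \<partial>lborel)"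

lemma mehler_op_measurable[measurable]:
  assumes [measurable]: "f \<in> borel_measurable borel"
  shows "mehler_op r f \<in> borel_measurable borel"
  unfolding mehler_op_def by measurable

lemma mehler_op_symmetric:
  assumes r: "\<bar>r\<bar> < 1" and [measurable]: "f \<in> borel_measurable borel" "g \<in> borel_measurable borel"
  shows "(\<integral>\<^sup>+x. f x * mehler_op r g x \<partial>gauss) = (\<integral>\<^sup>+x. mehler_op r f x * g x \<partial>gauss)"
proof -
  have "(\<integral>\<^sup>+x. f x * mehler_op r g x \<partial>gauss)
      = (\<integral>\<^sup>+x. \<integral>\<^sup>+y. f x * g y * (ennreal (std_normal_density x) * ennreal (mehler r x y)) \<partial>lborel \<partial>lborel)"
    unfolding mehler_op_def
    by (subst nn_integral_gauss) (auto intro!: nn_integral_cong simp: nn_integral_cmult[symmetric] nn_integral_multc[symmetric] mult_ac)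
  also have "\<dots> = (\<integral>\<^sup>+y. \<integral>\<^sup>+x. f x * g y * (ennreal (std_normal_density x) * ennreal (mehler r x y)) \<partial>lborel \<partial>lborel)"
    by (rule lborel_pair.Fubini') measurable
  also have "\<dots> = (\<integral>\<^sup>+y. \<integral>\<^sup>+x. f x * g y * (ennreal (std_normal_density y) * ennreal (mehler r y x)) \<partial>lborel \<partial>lborel)"
    by (simp add: ennreal_mult[symmetric] mehler_symmetric[OF r])
  also have "\<dots> = (\<integral>\<^sup>+x. mehler_op r f x * g x \<partial>gauss)"
    unfolding mehler_op_def
    by (subst nn_integral_gauss) (auto intro!: nn_integral_cong simp: nn_integral_cmult[symmetric] nn_integral_multc[symmetric] mult_ac)
  finally show ?thesis .
qed

lemma mehler_op_semigroup:
  assumes r: "\<bar>r\<bar> < 1" "\<bar>s\<bar> < 1" and [measurable]: "f \<in> borel_measurable borel"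
  shows "mehler_op r (mehler_op s f) x = mehler_op (r * s) f x"
proof -
  have "mehler_op r (mehler_op s f) x
      = (\<integral>\<^sup>+y. \<integral>\<^sup>+z. f z * (ennreal (mehler r x y) * ennreal (mehler s y z)) \<partial>lborel \<partial>lborel)"
    unfolding mehler_op_def
    by (auto intro!: nn_integral_cong simp: nn_integral_cmult[symmetric] mult_ac)
  also have "\<dots> = (\<integral>\<^sup>+z. \<integral>\<^sup>+y. f z * (ennreal (mehler r x y) * ennreal (mehler s y z)) \<partial>lborel \<partial>lborel)"
    by (rule lborel_pair.Fubini') measurable
  also have "\<dots> = mehler_op (r * s) f x"
    unfolding mehler_op_def mehler_semigroup[OF r, symmetric]
    by (auto intro!: nn_integral_cong simp: nn_integral_cmult)
  finally show ?thesis .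
qed

lemma mehler_op_1: "\<bar>r\<bar> < 1 \<Longrightarrow> mehler_op r (\<lambda>_. 1) x = 1"
  by (simp add: mehler_op_def nn_integral_mehler)

lemma mehler_op_cong_AE:
  "AE x in lborel. f x = g x \<Longrightarrow> mehler_op r f = mehler_op r g"
  unfolding mehler_op_def by (rule ext, rule nn_integral_cong_AE) auto

lemma AE_gauss_iff: "{x. P x} \<in> sets borel \<Longrightarrow> (AE x in gauss. P x) \<longleftrightarrow> (AE x in lborel. P x)"
  unfolding gauss_def by (subst AE_density) (auto simp: normal_density_pos)

lemma cauchy_schwarz_integral:
  fixes u v :: "'a \<Rightarrow> real"
  assumes [measurable]: "u \<in> borel_measurable M" "v \<in> borel_measurable M"
    and u: "integrable M (\<lambda>x. (u x)\<^sup>2)" and v: "integrable M (\<lambda>x. (v x)\<^sup>2)"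
  shows "integrable M (\<lambda>x. u x * v x)" (is ?int)
    and "(\<integral>x. u x * v x \<partial>M)\<^sup>2 \<le> (\<integral>x. (u x)\<^sup>2 \<partial>M) * (\<integral>x. (v x)\<^sup>2 \<partial>M)"
proof -
  have bd: "\<bar>u x * v x\<bar> \<le> (u x)\<^sup>2 + (v x)\<^sup>2" for x
  proof -
    have "2 * (\<bar>u x\<bar> * \<bar>v x\<bar>) \<le> (u x)\<^sup>2 + (v x)\<^sup>2" using sum_squares_bound[of "\<bar>u x\<bar>" "\<bar>v x\<bar>"] by simp
    moreover have "0 \<le> \<bar>u x\<bar> * \<bar>v x\<bar>" by simp
    ultimately show ?thesis unfolding abs_mult by linarith
  qed
  show i: ?int
    by (rule Bochner_Integration.integrable_bound[OF Bochner_Integration.integrable_add[OF u v]])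
       (use bd in \<open>auto intro!: AE_I2 simp: abs_of_nonneg\<close>)
  have "ennreal (\<integral>x. \<bar>u x * v x\<bar> \<partial>M) = (\<integral>\<^sup>+x. ennreal \<bar>u x * v x\<bar> \<partial>M)"
    using i by (subst nn_integral_eq_integral) auto
  also have "\<dots> = (\<integral>\<^sup>+x. ennreal \<bar>u x\<bar> * ennreal \<bar>v x\<bar> \<partial>M)"
    by (simp add: abs_mult ennreal_mult)
  finally have "ennreal ((\<integral>x. \<bar>u x * v x\<bar> \<partial>M)\<^sup>2) = (\<integral>\<^sup>+x. ennreal \<bar>u x\<bar> * ennreal \<bar>v x\<bar> \<partial>M)\<^sup>2"
    by (subst ennreal_power[symmetric]) auto
  also have "\<dots> \<le> (\<integral>\<^sup>+x. (ennreal \<bar>u x\<bar>)\<^sup>2 \<partial>M) * (\<integral>\<^sup>+x. (ennreal \<bar>v x\<bar>)\<^sup>2 \<partial>M)"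
    by (rule Cauchy_Schwarz_nn_integral) measurable
  also have "\<dots> = ennreal ((\<integral>x. (u x)\<^sup>2 \<partial>M) * (\<integral>x. (v x)\<^sup>2 \<partial>M))"
    using u v by (simp add: ennreal_power nn_integral_eq_integral ennreal_mult)
  finally have "(\<integral>x. \<bar>u x * v x\<bar> \<partial>M)\<^sup>2 \<le> (\<integral>x. (u x)\<^sup>2 \<partial>M) * (\<integral>x. (v x)\<^sup>2 \<partial>M)"
    by (subst (asm) ennreal_le_iff) auto
  moreover have "(\<integral>x. u x * v x \<partial>M)\<^sup>2 \<le> (\<integral>x. \<bar>u x * v x\<bar> \<partial>M)\<^sup>2"
    using integral_abs_bound[of M "\<lambda>x. u x * v x"] by (intro abs_le_square_iff[THEN iffD1]) simp
  ultimately show "(\<integral>x. u x * v x \<partial>M)\<^sup>2 \<le> (\<integral>x. (u x)\<^sup>2 \<partial>M) * (\<integral>x. (v x)\<^sup>2 \<partial>M)"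
    by linarith
qed

text \<open>A weak form of Nelson's inequality, with the correlation \<open>1/8\<close> in place of the optimal
  \<open>1/\<surd>3\<close> but with the constant \<open>1\<close>, which is what survives tensorization.  The function is split into its
  mean \<open>a\<close> and a centred part of variance \<open>V\<close>.  The operator keeps the mean.  Its kernel minus \<open>1\<close> has
  an \<open>L\<^sup>2\<close> norm in the second variable whose fourth moment in the first one is small, so by
  Cauchy--Schwarz the image \<open>D\<close> of the centred part is small in \<open>L\<^sup>4\<close>.  The term linear in \<open>D\<close>
  of \<open>(a + D)\<^sup>4\<close> integrates to zero, and the remaining terms are absorbed by \<open>(a\<^sup>2 + V)\<^sup>2\<close>.\<close>

lemma mehler_op_hypercontractive_real:
  fixes g :: "real \<Rightarrow> real"
  assumes r: "\<bar>r\<bar> \<le> 1 / 8" and [measurable]: "g \<in> borel_measurable borel"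
    and g0: "\<And>x. 0 \<le> g x" and g2: "integrable gauss (\<lambda>x. (g x)\<^sup>2)"
  shows "(\<integral>\<^sup>+x. (mehler_op r (\<lambda>y. ennreal (g y)) x) ^ 4 \<partial>gauss) \<le> ennreal ((\<integral>x. (g x)\<^sup>2 \<partial>gauss)\<^sup>2)"
proof -
  have r1: "\<bar>r\<bar> < 1" using r by simp
  have r2: "r\<^sup>2 \<le> 1 / 64"
    using power_mono[of "\<bar>r\<bar>" "1/8" 2] r by (simp add: power_divide)
  define K where "K x y = mehler r x y / std_normal_density y" for x y
  have K0: "0 \<le> K x y" for x y by (simp add: K_def)
  have [measurable]: "K x \<in> borel_measurable borel" for x unfolding K_def by measurable
  have Kstd: "K x y * std_normal_density y = mehler r x y" for x y
    using normal_density_pos[of 1 0 y] by (simp add: K_def)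
  have [measurable]: "mehler_sq r \<in> borel_measurable borel" unfolding mehler_sq_def by measurable
  have c1: "1 \<le> mehler_sq r x" for x
  proof -
    have "(r\<^sup>2)\<^sup>2 \<le> (1 / 64)\<^sup>2" using r2 by (intro power_mono) auto
    then have "r ^ 4 < 1" by (simp add: power_divide)
    then have "0 < sqrt (1 - r ^ 4)" "sqrt (1 - r ^ 4) \<le> 1" by (auto simp: real_sqrt_le_1_iff)
    moreover have "1 \<le> exp (r\<^sup>2 * x\<^sup>2 / (1 + r\<^sup>2))" by simp
    ultimately have "0 < sqrt (1 - r ^ 4)" "sqrt (1 - r ^ 4) \<le> exp (r\<^sup>2 * x\<^sup>2 / (1 + r\<^sup>2))" by linarith+
    then show ?thesis unfolding mehler_sq_def by (metis le_divide_eq_1_pos)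
  qed
  have Kint: "(\<integral>\<^sup>+y. ennreal (K x y) \<partial>gauss) = 1" for x
    using nn_integral_mehler[OF r1, of x]
    by (subst nn_integral_gauss) (auto simp: ennreal_mult[symmetric] Kstd K0)
  have K2int: "(\<integral>\<^sup>+y. ennreal ((K x y)\<^sup>2) \<partial>gauss) = ennreal (mehler_sq r x)" for x
  proof -
    let ?m = "2 * r * x / (1 + r\<^sup>2)" and ?v = "(1 - r\<^sup>2) / (1 + r\<^sup>2)"
    have v: "0 < ?v" using one_minus_sq_pos[OF r1] by (intro divide_pos_pos) (auto simp: add_pos_nonneg)
    have "(K x y)\<^sup>2 * std_normal_density y = mehler_sq r x * normal_density ?m (sqrt ?v) y" for y
    proof -
      have "std_normal_density y > 0" by (simp add: normal_density_pos)
      then show ?thesis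
        using mehler_sq_eq[OF r1, of x y] by (simp add: K_def power_divide power2_eq_square field_simps)
    qed
    then have "(\<integral>\<^sup>+y. ennreal ((K x y)\<^sup>2) \<partial>gauss) = (\<integral>\<^sup>+y. ennreal (mehler_sq r x) * ennreal (normal_density ?m (sqrt ?v) y) \<partial>lborel)"
      using c1[of x] by (subst nn_integral_gauss) (auto simp: ennreal_mult[symmetric])
    also have "\<dots> = ennreal (mehler_sq r x)"
      using v by (subst nn_integral_cmult) (auto simp: nn_integral_normal_density)
    finally show ?thesis .
  qed
  have Ki: "integrable gauss (K x)" "(\<integral>y. K x y \<partial>gauss) = 1" for x
    using Kint[of x] by (auto intro!: integrableI_nn_integral_finite[where x=1] simp: K0 integral_eq_nn_integral)
  have K2i: "integrable gauss (\<lambda>y. (K x y)\<^sup>2)" "(\<integral>y. (K x y)\<^sup>2 \<partial>gauss) = mehler_sq r x" for x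
    using K2int[of x] c1[of x] by (auto intro!: integrableI_nn_integral_finite[where x="mehler_sq r x"] simp: integral_eq_nn_integral)
  have gi: "integrable gauss g"
    using gauss.square_integrable_imp_integrable[OF _ g2] by simp
  define a where "a = (\<integral>x. g x \<partial>gauss)"
  define V where "V = (\<integral>x. (g x - a)\<^sup>2 \<partial>gauss)"
  have a0: "0 \<le> a" unfolding a_def by (rule Bochner_Integration.integral_nonneg) (simp add: g0)
  have V0: "0 \<le> V" unfolding V_def by simp
  have gai: "integrable gauss (\<lambda>x. (g x - a)\<^sup>2)" and Veq: "V = (\<integral>x. (g x)\<^sup>2 \<partial>gauss) - a\<^sup>2"
    unfolding V_def power2_diff using gi g2
    by (auto simp: gauss.prob_space[simplified] a_def[symmetric] power2_eq_square algebra_simps)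
  have gK: "integrable gauss (\<lambda>y. g y * K x y)" for x
    by (rule cauchy_schwarz_integral) (use g2 K2i in auto)
  define t where "t x = (\<integral>y. g y * K x y \<partial>gauss)" for x
  have t0: "0 \<le> t x" for x unfolding t_def by (rule Bochner_Integration.integral_nonneg) (simp add: g0 K0)
  have T: "mehler_op r (\<lambda>y. ennreal (g y)) x = ennreal (t x)" for x
  proof -
    have "mehler_op r (\<lambda>y. ennreal (g y)) x = (\<integral>\<^sup>+y. ennreal (g y * K x y) \<partial>gauss)"
      unfolding mehler_op_def
      by (subst nn_integral_gauss) (auto intro!: nn_integral_cong simp: ennreal_mult[symmetric] Kstd[symmetric] g0 K0 mult_ac)
    also have "\<dots> = ennreal (t x)" unfolding t_def
      by (rule nn_integral_eq_integral) (use gK g0 K0 in auto)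
    finally show ?thesis .
  qed
  have [measurable]: "t \<in> borel_measurable borel"
  proof -
    have "t = (\<lambda>x. enn2real (mehler_op r (\<lambda>y. ennreal (g y)) x))" using T t0 by auto
    then show ?thesis by simp
  qed
  have "(\<integral>\<^sup>+x. ennreal (t x) \<partial>gauss) = ennreal a"
    using mehler_op_symmetric[OF r1, of "\<lambda>_. 1" "\<lambda>y. ennreal (g y)"] gi
    by (simp add: mehler_op_1[OF r1] T nn_integral_eq_integral g0 a_def)
  then have ti: "integrable gauss t" "(\<integral>x. t x \<partial>gauss) = a"
    using a0 t0 by (auto intro!: integrableI_nn_integral_finite[where x=a] simp: integral_eq_nn_integral)
  define D where "D x = t x - a" for x
  have [measurable]: "D \<in> borel_measurable borel" unfolding D_def by measurable
  have Di: "integrable gauss D" "(\<integral>x. D x \<partial>gauss) = 0"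
    using ti by (auto simp: D_def[abs_def] gauss.prob_space[simplified])
  have D2: "(D x)\<^sup>2 \<le> (mehler_sq r x - 1) * V" for x
  proof -
    have k: "integrable gauss (\<lambda>y. (K x y - 1)\<^sup>2)" "(\<integral>y. (K x y - 1)\<^sup>2 \<partial>gauss) = mehler_sq r x - 1"
      unfolding power2_diff using Ki[of x] K2i[of x] by (auto simp: gauss.prob_space[simplified])
    have "(\<integral>y. (K x y - 1) * (g y - a) \<partial>gauss) = (\<integral>y. g y * K x y - a * K x y - g y + a \<partial>gauss)"
      by (intro Bochner_Integration.integral_cong) (auto simp: algebra_simps)
    also have "\<dots> = D x"
      using Ki[of x] gK[of x] gi by (simp add: gauss.prob_space[simplified] D_def t_def a_def[symmetric])
    finally show ?thesis
      using cauchy_schwarz_integral(2)[of "\<lambda>y. K x y - 1" gauss "\<lambda>y. g y - a"] k gai by (simp add: V_def)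
  qed
  have s2i: "integrable gauss (\<lambda>x. (mehler_sq r x)\<^sup>2)"
    using mehler_sq_integral[OF r2] by (intro integrableI_bounded) (auto intro: le_less_trans)
  have s2: "(\<integral>x. (mehler_sq r x)\<^sup>2 \<partial>gauss) \<le> 26 / 25"
    using mehler_sq_integral[OF r2] s2i by (subst (asm) nn_integral_eq_integral) auto
  have D4: "(D x) ^ 4 \<le> V\<^sup>2 * ((mehler_sq r x)\<^sup>2 - 1)" for x
  proof -
    have "(D x) ^ 4 = ((D x)\<^sup>2)\<^sup>2" by simp
    also have "\<dots> \<le> ((mehler_sq r x - 1) * V)\<^sup>2"
      using D2[of x] by (intro power_mono) auto
    also have "\<dots> \<le> V\<^sup>2 * ((mehler_sq r x)\<^sup>2 - 1)"
    proof -
      have "(mehler_sq r x - 1)\<^sup>2 \<le> (mehler_sq r x)\<^sup>2 - 1"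
        using c1[of x] by (simp add: power2_eq_square algebra_simps)
      then show ?thesis by (simp add: power_mult_distrib mult.commute mult_left_mono)
    qed
    finally show ?thesis .
  qed
  have bi: "integrable gauss (\<lambda>x. V\<^sup>2 * ((mehler_sq r x)\<^sup>2 - 1))" using s2i by auto
  have D4i: "integrable gauss (\<lambda>x. (D x) ^ 4)"
    by (rule Bochner_Integration.integrable_bound[OF bi]) (simp, rule AE_I2, unfold real_norm_def, rule order_trans[OF _ abs_ge_self], use D4 in simp)
  have D4b: "(\<integral>x. (D x) ^ 4 \<partial>gauss) \<le> V\<^sup>2 / 25"
  proof -
    have "(\<integral>x. (D x) ^ 4 \<partial>gauss) \<le> (\<integral>x. V\<^sup>2 * ((mehler_sq r x)\<^sup>2 - 1) \<partial>gauss)"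
      by (rule integral_mono[OF D4i bi D4])
    also have "\<dots> = V\<^sup>2 * ((\<integral>x. (mehler_sq r x)\<^sup>2 \<partial>gauss) - 1)"
      using s2i by (simp add: gauss.prob_space[simplified])
    also have "\<dots> \<le> V\<^sup>2 * (1 / 25)" using s2 by (intro mult_left_mono) auto
    finally show ?thesis by simp
  qed
  have D2i: "integrable gauss (\<lambda>x. (D x)\<^sup>2)"
    using gauss.square_integrable_imp_integrable[of "\<lambda>x. (D x)\<^sup>2"] D4i by simp
  have D2b: "(\<integral>x. (D x)\<^sup>2 \<partial>gauss) \<le> V / 5"
  proof -
    have "(\<integral>x. (D x)\<^sup>2 * 1 \<partial>gauss)\<^sup>2 \<le> (\<integral>x. ((D x)\<^sup>2)\<^sup>2 \<partial>gauss) * (\<integral>x. 1\<^sup>2 \<partial>gauss)"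
      by (rule cauchy_schwarz_integral) (use D4i in auto)
    then have "(\<integral>x. (D x)\<^sup>2 \<partial>gauss)\<^sup>2 \<le> (V / 5)\<^sup>2"
      using D4b by (simp add: gauss.prob_space[simplified] power_divide)
    then show ?thesis by (rule power2_le_imp_le) (use V0 in simp)
  qed
  \<comment> \<open>Young's inequality removes the cubic term: \<open>4 a D\<^sup>3 \<le> 4 a\<^sup>2 D\<^sup>2 + D\<^sup>4\<close>.\<close>
  have tD: "(t x) ^ 4 \<le> a ^ 4 + 4 * a ^ 3 * D x + 10 * a\<^sup>2 * (D x)\<^sup>2 + 2 * (D x) ^ 4" for x
  proof -
    have "0 \<le> (2 * a * D x - (D x)\<^sup>2)\<^sup>2" by simp
    moreover have "t x = a + D x" by (simp add: D_def)
    ultimately show ?thesis by (simp add: power2_eq_square eval_nat_numeral algebra_simps)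
  qed
  have ri: "integrable gauss (\<lambda>x. a ^ 4 + 4 * a ^ 3 * D x + 10 * a\<^sup>2 * (D x)\<^sup>2 + 2 * (D x) ^ 4)"
    using Di D2i D4i by auto
  have t4i: "integrable gauss (\<lambda>x. (t x) ^ 4)"
    by (rule Bochner_Integration.integrable_bound[OF ri]) (simp, rule AE_I2, unfold real_norm_def, rule order_trans[OF _ abs_ge_self], use tD in simp)
  have "(\<integral>x. (t x) ^ 4 \<partial>gauss) \<le> (\<integral>x. a ^ 4 + 4 * a ^ 3 * D x + 10 * a\<^sup>2 * (D x)\<^sup>2 + 2 * (D x) ^ 4 \<partial>gauss)"
    by (rule integral_mono[OF t4i ri tD])
  also have "\<dots> = a ^ 4 + 10 * a\<^sup>2 * (\<integral>x. (D x)\<^sup>2 \<partial>gauss) + 2 * (\<integral>x. (D x) ^ 4 \<partial>gauss)"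
    using Di D2i D4i by (simp add: gauss.prob_space[simplified])
  also have "\<dots> \<le> a ^ 4 + 10 * a\<^sup>2 * (V / 5) + 2 * (V\<^sup>2 / 25)"
    using D2b D4b by (intro add_mono mult_left_mono) auto
  also have "\<dots> \<le> (a\<^sup>2 + V)\<^sup>2"
    by (simp add: power2_eq_square eval_nat_numeral algebra_simps)
  also have "a\<^sup>2 + V = (\<integral>x. (g x)\<^sup>2 \<partial>gauss)" by (simp add: Veq)
  finally have "(\<integral>x. (t x) ^ 4 \<partial>gauss) \<le> (\<integral>x. (g x)\<^sup>2 \<partial>gauss)\<^sup>2" .
  then show ?thesis
    using t4i by (simp add: T ennreal_power t0 nn_integral_eq_integral)
qed

lemma mehler_op_hypercontractive:
  assumes r: "\<bar>r\<bar> \<le> 1 / 8" and [measurable]: "f \<in> borel_measurable borel"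
  shows "(\<integral>\<^sup>+x. (mehler_op r f x) ^ 4 \<partial>gauss) \<le> (\<integral>\<^sup>+x. (f x)\<^sup>2 \<partial>gauss)\<^sup>2"
proof (cases "(\<integral>\<^sup>+x. (f x)\<^sup>2 \<partial>gauss) = \<infinity>")
  case False
  have "AE x in gauss. (f x)\<^sup>2 \<noteq> \<infinity>"
    using False by (intro nn_integral_PInf_AE) auto
  then have 1: "AE x in gauss. f x = ennreal (enn2real (f x))"
    by eventually_elim (auto simp: power2_eq_square ennreal_mult_eq_top_iff less_top[symmetric])
  then have 2: "AE x in lborel. f x = ennreal (enn2real (f x))"
    by (subst (asm) AE_gauss_iff) auto
  have eq: "(\<integral>\<^sup>+x. (f x)\<^sup>2 \<partial>gauss) = (\<integral>\<^sup>+x. ennreal ((enn2real (f x))\<^sup>2) \<partial>gauss)"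
    using 1 by (intro nn_integral_cong_AE) (auto simp: ennreal_power[symmetric])
  have i: "integrable gauss (\<lambda>x. (enn2real (f x))\<^sup>2)"
    using False unfolding eq by (intro integrableI_bounded) (auto simp: less_top)
  show ?thesis
    unfolding mehler_op_cong_AE[OF 2] eq
    using mehler_op_hypercontractive_real[OF r _ _ i] i
    by (simp add: nn_integral_eq_integral ennreal_power)
qed (simp add: power2_eq_square)

section \<open>Noise stability of small sets in Gauss space\<close>

abbreviation seqs :: "(nat \<Rightarrow> real) measure" where
  "seqs \<equiv> PiM UNIV (\<lambda>_. borel)"

lemma space_seqs[simp]: "space seqs = UNIV"
  by (simp add: space_PiM)

lemma measurable_upd_seqs[measurable (raw)]:
  assumes "f \<in> measurable N seqs" "h \<in> borel_measurable N"
  shows "(\<lambda>x. (f x) (i := h x)) \<in> measurable N seqs"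
  using assms by (intro measurable_fun_upd[where J = UNIV]) auto

lemma measurable_PiM_seqs:
  assumes "\<And>i. i \<in> I \<Longrightarrow> sets (M i) = sets borel"
  shows "(\<lambda>x. x) \<in> measurable (PiM I M) seqs"
proof -
  have "(\<lambda>x. x) \<in> measurable (PiM I (\<lambda>_. borel)) seqs"
  proof (rule measurable_PiM_single')
    fix i
    show "(\<lambda>x. x i) \<in> borel_measurable (PiM I (\<lambda>_. borel :: real measure))"
    proof (cases "i \<in> I")
      case False
      have "(\<lambda>x. undefined) \<in> borel_measurable (PiM I (\<lambda>_. borel :: real measure))" by simp
      then show ?thesis
        by (subst measurable_cong[where g = "\<lambda>x. undefined"]) (use False in \<open>auto simp: space_PiM PiE_def extensional_def\<close>)
    qed simp
  qed auto
  moreover have "sets (PiM I M) = sets (PiM I (\<lambda>_. borel))"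
    by (rule sets_PiM_cong) (use assms in auto)
  ultimately show ?thesis
    by (simp add: measurable_cong_sets[of "PiM I M" "PiM I (\<lambda>_. borel)" seqs seqs])
qed

lemma measurable_section:
  "f \<in> borel_measurable seqs \<Longrightarrow> (\<lambda>u. f (x(j := u))) \<in> borel_measurable borel"
  by (rule measurable_compose[of _ _ seqs]) (rule measurable_upd_seqs, auto)

text \<open>Standard Gaussian measure in dimension \<open>n\<close>, carried by the space of all real sequences (with a
  default value in the coordinates from \<open>n\<close> on) so that all dimensions share one \<open>\<sigma>\<close>-algebra.\<close>

definition gausses :: "nat \<Rightarrow> (nat \<Rightarrow> real) measure" where
  "gausses n = distr (PiM {..<n} (\<lambda>_. gauss)) seqs (\<lambda>x. x)"

interpretation gauss_prod: product_sigma_finite "\<lambda>_::nat. gauss" by standard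

lemma sets_gausses[measurable_cong, simp]: "sets (gausses n) = sets seqs"
  by (simp add: gausses_def)

lemma space_gausses[simp]: "space (gausses n) = UNIV"
  by (simp add: gausses_def)

lemma prob_space_gausses: "prob_space (gausses n)"
  unfolding gausses_def
  by (intro prob_space.prob_space_distr prob_space_PiM prob_space_gauss measurable_PiM_seqs) simp

interpretation gausses: prob_space "gausses n" for n by (rule prob_space_gausses)

lemma nn_integral_gausses:
  "f \<in> borel_measurable seqs \<Longrightarrow> (\<integral>\<^sup>+x. f x \<partial>gausses n) = (\<integral>\<^sup>+x. f x \<partial>PiM {..<n} (\<lambda>_. gauss))"
  unfolding gausses_def by (rule nn_integral_distr) (auto intro: measurable_PiM_seqs)

lemma nn_integral_PiM_gauss_insert:
  assumes "finite I" "i \<notin> I" "f \<in> borel_measurable seqs"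
  shows "(\<integral>\<^sup>+x. f x \<partial>PiM (insert i I) (\<lambda>_. gauss)) = (\<integral>\<^sup>+x. \<integral>\<^sup>+u. f (x(i := u)) \<partial>gauss \<partial>PiM I (\<lambda>_. gauss))"
    and "(\<integral>\<^sup>+x. f x \<partial>PiM (insert i I) (\<lambda>_. gauss)) = (\<integral>\<^sup>+u. \<integral>\<^sup>+x. f (x(i := u)) \<partial>PiM I (\<lambda>_. gauss) \<partial>gauss)"
proof -
  have m: "f \<in> borel_measurable (PiM (insert i I) (\<lambda>_. gauss))"
    using measurable_compose[OF measurable_PiM_seqs assms(3)] by simp
  show "(\<integral>\<^sup>+x. f x \<partial>PiM (insert i I) (\<lambda>_. gauss)) = (\<integral>\<^sup>+x. \<integral>\<^sup>+u. f (x(i := u)) \<partial>gauss \<partial>PiM I (\<lambda>_. gauss))"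
    by (rule gauss_prod.product_nn_integral_insert[OF assms(1,2) m])
  show "(\<integral>\<^sup>+x. f x \<partial>PiM (insert i I) (\<lambda>_. gauss)) = (\<integral>\<^sup>+u. \<integral>\<^sup>+x. f (x(i := u)) \<partial>PiM I (\<lambda>_. gauss) \<partial>gauss)"
    by (rule gauss_prod.product_nn_integral_insert_rev[OF assms(1,2) m])
qed

lemma nn_integral_gausses_Suc:
  assumes [measurable]: "f \<in> borel_measurable seqs"
  shows "(\<integral>\<^sup>+x. f x \<partial>gausses (Suc n)) = (\<integral>\<^sup>+u. \<integral>\<^sup>+x. f (x(n := u)) \<partial>gausses n \<partial>gauss)"
  using nn_integral_PiM_gauss_insert(2)[of "{..<n}" n f] assms
  by (simp add: nn_integral_gausses lessThan_Suc)

lemma nn_integral_gausses_resample: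
  assumes [measurable]: "f \<in> borel_measurable seqs" and j: "j < n"
  shows "(\<integral>\<^sup>+x. f x \<partial>gausses n) = (\<integral>\<^sup>+x. \<integral>\<^sup>+u. f (x(j := u)) \<partial>gauss \<partial>gausses n)"
proof -
  let ?I = "{..<n} - {j}"
  have i: "{..<n} = insert j ?I" using j by auto
  let ?P = "PiM ?I (\<lambda>_. gauss)"
  have ins: "(\<integral>\<^sup>+x. g x \<partial>gausses n) = (\<integral>\<^sup>+x. \<integral>\<^sup>+u. g (x(j := u)) \<partial>gauss \<partial>?P)" if "g \<in> borel_measurable seqs" for g
    unfolding nn_integral_gausses[OF that]
    by (subst i, rule nn_integral_PiM_gauss_insert(1)) (use that in auto)
  have "(\<integral>\<^sup>+x. \<integral>\<^sup>+u. f (x(j := u)) \<partial>gauss \<partial>gausses n) = (\<integral>\<^sup>+x. \<integral>\<^sup>+v. \<integral>\<^sup>+u. f (x(j := v, j := u)) \<partial>gauss \<partial>gauss \<partial>?P)"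
    by (rule ins) measurable
  also have "\<dots> = (\<integral>\<^sup>+x. \<integral>\<^sup>+u. f (x(j := u)) \<partial>gauss \<partial>?P)"
    by (simp add: gauss.emeasure_space_1[simplified])
  also have "\<dots> = (\<integral>\<^sup>+x. f x \<partial>gausses n)"
    by (rule ins[symmetric]) measurable
  finally show ?thesis ..
qed

definition coord_op :: "nat \<Rightarrow> real \<Rightarrow> ((nat \<Rightarrow> real) \<Rightarrow> ennreal) \<Rightarrow> (nat \<Rightarrow> real) \<Rightarrow> ennreal" where
  "coord_op j r f x = mehler_op r (\<lambda>y. f (x(j := y))) (x j)"

lemma coord_op_measurable[measurable]:
  assumes [measurable]: "f \<in> borel_measurable seqs"
  shows "coord_op j r f \<in> borel_measurable seqs"
  unfolding coord_op_def mehler_op_def by measurable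

lemma coord_op_upd_same: "coord_op i r f (x(i := u)) = mehler_op r (\<lambda>y. f (x(i := y))) u"
  by (simp add: coord_op_def)

lemma coord_op_semigroup:
  assumes "\<bar>r\<bar> < 1" "\<bar>s\<bar> < 1" and f: "f \<in> borel_measurable seqs"
  shows "coord_op j r (coord_op j s f) = coord_op j (r * s) f"
proof
  fix x
  have [measurable]: "(\<lambda>y. f (x(j := y))) \<in> borel_measurable borel"
    by (rule measurable_section) fact
  show "coord_op j r (coord_op j s f) x = coord_op j (r * s) f x"
    using assms by (simp add: coord_op_def mehler_op_semigroup[symmetric])
qed

lemma coord_op_commute:
  assumes "i \<noteq> j" and f[measurable]: "f \<in> borel_measurable seqs"
  shows "coord_op i r (coord_op j s f) = coord_op j s (coord_op i r f)"
proof
  fix x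
  have "coord_op i r (coord_op j s f) x
    = (\<integral>\<^sup>+y. \<integral>\<^sup>+z. f (x(i := y, j := z)) * ennreal (mehler s (x j) z) * ennreal (mehler r (x i) y) \<partial>lborel \<partial>lborel)"
    unfolding coord_op_def mehler_op_def using assms(1)
    by (auto intro!: nn_integral_cong simp: nn_integral_multc[symmetric])
  also have "\<dots> = (\<integral>\<^sup>+z. \<integral>\<^sup>+y. f (x(i := y, j := z)) * ennreal (mehler s (x j) z) * ennreal (mehler r (x i) y) \<partial>lborel \<partial>lborel)"
    by (rule lborel_pair.Fubini') measurable
  also have "\<dots> = coord_op j s (coord_op i r f) x"
  proof -
    have "(\<integral>\<^sup>+y. f (x(i := y, j := z)) * ennreal (mehler s (x j) z) * ennreal (mehler r (x i) y) \<partial>lborel)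
      = (\<integral>\<^sup>+y. f (x(j := z, i := y)) * ennreal (mehler r (x i) y) \<partial>lborel) * ennreal (mehler s (x j) z)" for z
      using assms(1) by (subst nn_integral_multc[symmetric]) (auto intro!: nn_integral_cong simp: fun_upd_twist mult_ac)
    then show ?thesis
      unfolding coord_op_def mehler_op_def using assms(1) by simp
  qed
  finally show "coord_op i r (coord_op j s f) x = coord_op j s (coord_op i r f) x" .
qed

lemma coord_op_symmetric:
  assumes r: "\<bar>r\<bar> < 1" and j: "j < n" and [measurable]: "f \<in> borel_measurable seqs" "g \<in> borel_measurable seqs"
  shows "(\<integral>\<^sup>+x. f x * coord_op j r g x \<partial>gausses n) = (\<integral>\<^sup>+x. coord_op j r f x * g x \<partial>gausses n)"
proof -
  have [measurable]: "(\<lambda>y. f (x(j := y))) \<in> borel_measurable borel" "(\<lambda>y. g (x(j := y))) \<in> borel_measurable borel" for x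
    by (auto intro!: measurable_section)
  show ?thesis
    by (subst (1 2) nn_integral_gausses_resample[OF _ j])
       (simp_all add: coord_op_upd_same mehler_op_symmetric[OF r])
qed

text \<open>Each coordinate is given noise with a correlation of its own, because the fraction of a cell
  that belongs to \<open>E\<close> varies with the cell.\<close>

fun noise_op :: "nat \<Rightarrow> (nat \<Rightarrow> real) \<Rightarrow> ((nat \<Rightarrow> real) \<Rightarrow> ennreal) \<Rightarrow> (nat \<Rightarrow> real) \<Rightarrow> ennreal" where
  "noise_op 0 r f = f"
| "noise_op (Suc m) r f = coord_op m (r m) (noise_op m r f)"

lemma noise_op_measurable[measurable]:
  "f \<in> borel_measurable seqs \<Longrightarrow> noise_op m r f \<in> borel_measurable seqs"
  by (induction m) auto

lemma noise_op_upd: "m \<le> j \<Longrightarrow> noise_op m r f (x(j := u)) = noise_op m r (\<lambda>x. f (x(j := u))) x"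
  by (induction m arbitrary: x) (auto simp: coord_op_def fun_upd_twist)

lemma coord_noise_commute:
  "m \<le> j \<Longrightarrow> f \<in> borel_measurable seqs \<Longrightarrow> coord_op j s (noise_op m r f) = noise_op m r (coord_op j s f)"
  by (induction m) (auto simp: coord_op_commute)

lemma noise_op_semigroup:
  assumes "\<And>i. i < m \<Longrightarrow> \<bar>r i\<bar> < 1" "\<And>i. i < m \<Longrightarrow> \<bar>s i\<bar> < 1" "f \<in> borel_measurable seqs"
  shows "noise_op m r (noise_op m s f) = noise_op m (\<lambda>i. r i * s i) f"
  using assms by (induction m) (auto simp: coord_noise_commute[symmetric] coord_op_semigroup)

lemma noise_op_symmetric:
  assumes "\<And>i. i < m \<Longrightarrow> \<bar>r i\<bar> < 1" "m \<le> n" "f \<in> borel_measurable seqs" "g \<in> borel_measurable seqs"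
  shows "(\<integral>\<^sup>+x. f x * noise_op m r g x \<partial>gausses n) = (\<integral>\<^sup>+x. noise_op m r f x * g x \<partial>gausses n)"
  using assms
proof (induction m arbitrary: f g)
  case (Suc m)
  have "(\<integral>\<^sup>+x. f x * noise_op (Suc m) r g x \<partial>gausses n) = (\<integral>\<^sup>+x. coord_op m (r m) f x * noise_op m r g x \<partial>gausses n)"
    using Suc.prems by (simp add: coord_op_symmetric)
  also have "\<dots> = (\<integral>\<^sup>+x. noise_op m r (coord_op m (r m) f) x * g x \<partial>gausses n)"
    using Suc.prems by (intro Suc.IH) auto
  also have "\<dots> = (\<integral>\<^sup>+x. noise_op (Suc m) r f x * g x \<partial>gausses n)"
    using Suc.prems by (simp add: coord_noise_commute)
  finally show ?case .
qed simp

text \<open>The mean over the first \<open>m\<close> coordinates.  It is what the noise operator has been compared to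
  after \<open>m\<close> steps of the tensorization.\<close>

fun avg_op :: "nat \<Rightarrow> ((nat \<Rightarrow> real) \<Rightarrow> ennreal) \<Rightarrow> (nat \<Rightarrow> real) \<Rightarrow> ennreal" where
  "avg_op 0 f = f"
| "avg_op (Suc m) f = (\<lambda>x. \<integral>\<^sup>+u. avg_op m f (x(m := u)) \<partial>gauss)"

lemma avg_op_measurable[measurable]:
  "f \<in> borel_measurable seqs \<Longrightarrow> avg_op m f \<in> borel_measurable seqs"
proof (induction m)
  case (Suc m)
  then have [measurable]: "avg_op m f \<in> borel_measurable seqs" by simp
  show ?case by simp
qed simp

lemma avg_op_upd: "m \<le> j \<Longrightarrow> avg_op m f (x(j := u)) = avg_op m (\<lambda>x. f (x(j := u))) x"
  by (induction m arbitrary: x) (auto simp: fun_upd_twist)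

lemma avg_op_eq:
  "f \<in> borel_measurable seqs \<Longrightarrow> avg_op m f x = (\<integral>\<^sup>+y. f (\<lambda>k. if k < m then y k else x k) \<partial>gausses m)"
proof (induction m arbitrary: x)
  case 0
  have "(\<integral>\<^sup>+y. f (\<lambda>k. if k < 0 then y k else x k) \<partial>gausses 0) = f x * emeasure (gausses 0) (space (gausses 0))"
    by (simp del: space_gausses)
  then show ?case by (simp only: gausses.emeasure_space_1) simp
next
  case (Suc m)
  note [measurable] = Suc.prems
  have "(\<integral>\<^sup>+y. f (\<lambda>k. if k < Suc m then y k else x k) \<partial>gausses (Suc m))
     = (\<integral>\<^sup>+u. \<integral>\<^sup>+y. f (\<lambda>k. if k < Suc m then (y(m := u)) k else x k) \<partial>gausses m \<partial>gauss)"
    by (rule nn_integral_gausses_Suc[of "\<lambda>y. f (\<lambda>k. if k < Suc m then y k else x k)"])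
       (rule measurable_compose[of _ _ seqs], rule measurable_PiM_single', auto)
  also have "(\<lambda>y u k. if k < Suc m then (y(m := u)) k else x k) = (\<lambda>y u k. if k < m then y k else (x(m := u)) k)"
    by (auto simp: fun_eq_iff)
  then have "(\<integral>\<^sup>+u. \<integral>\<^sup>+y. f (\<lambda>k. if k < Suc m then (y(m := u)) k else x k) \<partial>gausses m \<partial>gauss)
    = (\<integral>\<^sup>+u. \<integral>\<^sup>+y. f (\<lambda>k. if k < m then y k else (x(m := u)) k) \<partial>gausses m \<partial>gauss)"
    by (simp only: fun_eq_iff)
  also have "\<dots> = avg_op (Suc m) f x"
    using Suc by simp
  finally show ?case ..
qed

lemma nn_integral_avg_op_square:
  assumes f: "f \<in> borel_measurable seqs"
  shows "(\<integral>\<^sup>+x. avg_op n f x * avg_op n f x \<partial>gausses n) = (\<integral>\<^sup>+y. f y \<partial>gausses n)\<^sup>2"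
proof -
  have c: "avg_op n f x = (\<integral>\<^sup>+y. f y \<partial>gausses n)" if x: "x \<in> space (PiM {..<n} (\<lambda>_. gauss))" for x
  proof -
    have [measurable]: "(\<lambda>y. f (\<lambda>k. if k < n then y k else x k)) \<in> borel_measurable seqs"
      by (rule measurable_compose[OF _ f]) (rule measurable_PiM_single', auto)
    show ?thesis
      unfolding avg_op_eq[OF f] using f
    proof (simp add: nn_integral_gausses, intro nn_integral_cong)
      fix y assume "y \<in> space (PiM {..<n} (\<lambda>_. gauss))"
      with x have "(\<lambda>k. if k < n then y k else x k) = y"
        by (auto simp: space_PiM PiE_def extensional_def fun_eq_iff)
      then show "f (\<lambda>k. if k < n then y k else x k) = f y" by simp
    qed
  qed
  interpret P: prob_space "PiM {..<n} (\<lambda>_. gauss)" by (intro prob_space_PiM prob_space_gauss)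
  have "(\<integral>\<^sup>+x. avg_op n f x * avg_op n f x \<partial>gausses n) = (\<integral>\<^sup>+x. (\<integral>\<^sup>+y. f y \<partial>gausses n)\<^sup>2 \<partial>PiM {..<n} (\<lambda>_. gauss))"
    using f by (subst nn_integral_gausses) (auto intro!: nn_integral_cong simp: c power2_eq_square simp del: nn_integral_const)
  then show ?thesis by (simp add: P.emeasure_space_1)
qed

lemma ennreal_power2_le_imp_le:
  fixes x y :: ennreal
  assumes "x\<^sup>2 \<le> y\<^sup>2"
  shows "x \<le> y"
proof (rule ccontr)
  assume "\<not> x \<le> y"
  then have "y < x" by simp
  then have "y\<^sup>2 < x\<^sup>2"
    by (cases x; cases y) (auto simp: ennreal_power power2_eq_square ennreal_mult_less_top ennreal_mult[symmetric] ennreal_less_iff intro!: mult_strict_mono)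
  with assms show False by simp
qed

text \<open>The bilinear form of hypercontractivity is the one that tensorizes: in the inductive step the
  two factors are sections at different points of the coordinate that is integrated out.\<close>

lemma mehler_op_hypercontractive2:
  assumes r: "\<bar>r\<bar> \<le> 1 / 8" and [measurable]: "f \<in> borel_measurable borel" "g \<in> borel_measurable borel"
  shows "(\<integral>\<^sup>+x. (mehler_op r f x)\<^sup>2 * (mehler_op r g x)\<^sup>2 \<partial>gauss) \<le> (\<integral>\<^sup>+x. (f x)\<^sup>2 \<partial>gauss) * (\<integral>\<^sup>+x. (g x)\<^sup>2 \<partial>gauss)"
proof (rule ennreal_power2_le_imp_le)
  have "(\<integral>\<^sup>+x. (mehler_op r f x)\<^sup>2 * (mehler_op r g x)\<^sup>2 \<partial>gauss)\<^sup>2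
      \<le> (\<integral>\<^sup>+x. ((mehler_op r f x)\<^sup>2)\<^sup>2 \<partial>gauss) * (\<integral>\<^sup>+x. ((mehler_op r g x)\<^sup>2)\<^sup>2 \<partial>gauss)"
    by (rule Cauchy_Schwarz_nn_integral) measurable
  also have "\<dots> \<le> (\<integral>\<^sup>+x. (f x)\<^sup>2 \<partial>gauss)\<^sup>2 * (\<integral>\<^sup>+x. (g x)\<^sup>2 \<partial>gauss)\<^sup>2"
    using mehler_op_hypercontractive[OF r, of f] mehler_op_hypercontractive[OF r, of g]
    by (intro mult_mono) auto
  finally show "(\<integral>\<^sup>+x. (mehler_op r f x)\<^sup>2 * (mehler_op r g x)\<^sup>2 \<partial>gauss)\<^sup>2
    \<le> ((\<integral>\<^sup>+x. (f x)\<^sup>2 \<partial>gauss) * (\<integral>\<^sup>+x. (g x)\<^sup>2 \<partial>gauss))\<^sup>2"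
    by (simp add: power_mult_distrib)
qed

lemma nn_integral_gausses_two:
  assumes f[measurable]: "f \<in> borel_measurable seqs" and g[measurable]: "g \<in> borel_measurable seqs"
  shows "(\<integral>\<^sup>+x. (\<integral>\<^sup>+u. f (x(m := u)) \<partial>gauss) * (\<integral>\<^sup>+v. g (x(m := v)) \<partial>gauss) \<partial>gausses n)
    = (\<integral>\<^sup>+u. \<integral>\<^sup>+v. \<integral>\<^sup>+x. f (x(m := u)) * g (x(m := v)) \<partial>gausses n \<partial>gauss \<partial>gauss)"
proof -
  interpret P: pair_sigma_finite "gausses n" gauss ..
  have [measurable]: "(\<lambda>y. f (x(m := y))) \<in> borel_measurable borel" "(\<lambda>y. g (x(m := y))) \<in> borel_measurable borel" for x
    by (auto intro!: measurable_section)
  have "(\<integral>\<^sup>+x. (\<integral>\<^sup>+u. f (x(m := u)) \<partial>gauss) * (\<integral>\<^sup>+v. g (x(m := v)) \<partial>gauss) \<partial>gausses n)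
     = (\<integral>\<^sup>+x. \<integral>\<^sup>+u. \<integral>\<^sup>+v. f (x(m := u)) * g (x(m := v)) \<partial>gauss \<partial>gauss \<partial>gausses n)"
    by (simp add: nn_integral_cmult nn_integral_multc)
  also have "\<dots> = (\<integral>\<^sup>+u. \<integral>\<^sup>+x. \<integral>\<^sup>+v. f (x(m := u)) * g (x(m := v)) \<partial>gauss \<partial>gausses n \<partial>gauss)"
    by (rule P.Fubini'[symmetric]) measurable
  also have "\<dots> = (\<integral>\<^sup>+u. \<integral>\<^sup>+v. \<integral>\<^sup>+x. f (x(m := u)) * g (x(m := v)) \<partial>gausses n \<partial>gauss \<partial>gauss)"
    by (intro nn_integral_cong P.Fubini'[symmetric]) measurable
  finally show ?thesis .
qed

lemma noise_op_hypercontractive2: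
  assumes "\<And>i. i < m \<Longrightarrow> \<bar>r i\<bar> \<le> 1 / 8" "m \<le> n" "f \<in> borel_measurable seqs" "g \<in> borel_measurable seqs"
  shows "(\<integral>\<^sup>+x. (noise_op m r f x)\<^sup>2 * (noise_op m r g x)\<^sup>2 \<partial>gausses n)
    \<le> (\<integral>\<^sup>+x. avg_op m (\<lambda>x. (f x)\<^sup>2) x * avg_op m (\<lambda>x. (g x)\<^sup>2) x \<partial>gausses n)"
  using assms
proof (induction m arbitrary: f g)
  case (Suc m)
  note [measurable] = Suc.prems(3,4)
  let ?F = "noise_op m r f" and ?G = "noise_op m r g"
  have [measurable]: "(\<lambda>y. h (x(m := y))) \<in> borel_measurable borel" if "h \<in> borel_measurable seqs" for h :: "_ \<Rightarrow> ennreal" and x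
    using that by (rule measurable_section)
  have "(\<integral>\<^sup>+x. (noise_op (Suc m) r f x)\<^sup>2 * (noise_op (Suc m) r g x)\<^sup>2 \<partial>gausses n)
      = (\<integral>\<^sup>+x. \<integral>\<^sup>+u. (mehler_op (r m) (\<lambda>y. ?F (x(m := y))) u)\<^sup>2 * (mehler_op (r m) (\<lambda>y. ?G (x(m := y))) u)\<^sup>2 \<partial>gauss \<partial>gausses n)"
    using Suc.prems(2) by (subst nn_integral_gausses_resample[of _ m]) (simp_all add: coord_op_upd_same)
  also have "\<dots> \<le> (\<integral>\<^sup>+x. (\<integral>\<^sup>+u. (?F (x(m := u)))\<^sup>2 \<partial>gauss) * (\<integral>\<^sup>+v. (?G (x(m := v)))\<^sup>2 \<partial>gauss) \<partial>gausses n)"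
    using Suc.prems(1) by (intro nn_integral_mono mehler_op_hypercontractive2) auto
  also have "\<dots> = (\<integral>\<^sup>+u. \<integral>\<^sup>+v. \<integral>\<^sup>+x. (?F (x(m := u)))\<^sup>2 * (?G (x(m := v)))\<^sup>2 \<partial>gausses n \<partial>gauss \<partial>gauss)"
    by (rule nn_integral_gausses_two) measurable
  also have "\<dots> \<le> (\<integral>\<^sup>+u. \<integral>\<^sup>+v. \<integral>\<^sup>+x. avg_op m (\<lambda>x. (f x)\<^sup>2) (x(m := u)) * avg_op m (\<lambda>x. (g x)\<^sup>2) (x(m := v)) \<partial>gausses n \<partial>gauss \<partial>gauss)"
  proof -
    have "(\<integral>\<^sup>+x. (?F (x(m := u)))\<^sup>2 * (?G (x(m := v)))\<^sup>2 \<partial>gausses n)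
      \<le> (\<integral>\<^sup>+x. avg_op m (\<lambda>x. (f x)\<^sup>2) (x(m := u)) * avg_op m (\<lambda>x. (g x)\<^sup>2) (x(m := v)) \<partial>gausses n)" for u v
      unfolding noise_op_upd[OF order_refl] avg_op_upd[OF order_refl]
    proof (rule Suc.IH)
      show "(\<lambda>x. f (x(m := u))) \<in> borel_measurable seqs" "(\<lambda>x. g (x(m := v))) \<in> borel_measurable seqs" by measurable
    qed (use Suc.prems in auto)
    then show ?thesis by - (rule nn_integral_mono, rule nn_integral_mono, blast)
  qed
  also have "\<dots> = (\<integral>\<^sup>+x. (\<integral>\<^sup>+u. avg_op m (\<lambda>x. (f x)\<^sup>2) (x(m := u)) \<partial>gauss) * (\<integral>\<^sup>+v. avg_op m (\<lambda>x. (g x)\<^sup>2) (x(m := v)) \<partial>gauss) \<partial>gausses n)"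
    by (rule nn_integral_gausses_two[symmetric]) measurable
  finally show ?case by simp
qed simp

lemma noise_op_hypercontractive:
  assumes "\<And>i. i < n \<Longrightarrow> \<bar>r i\<bar> \<le> 1 / 8" and [measurable]: "f \<in> borel_measurable seqs"
  shows "(\<integral>\<^sup>+x. (noise_op n r f x) ^ 4 \<partial>gausses n) \<le> (\<integral>\<^sup>+x. (f x)\<^sup>2 \<partial>gausses n)\<^sup>2"
proof -
  have "(\<integral>\<^sup>+x. (noise_op n r f x) ^ 4 \<partial>gausses n) = (\<integral>\<^sup>+x. (noise_op n r f x)\<^sup>2 * (noise_op n r f x)\<^sup>2 \<partial>gausses n)"
    by (simp add: power_add[symmetric])
  also have "\<dots> \<le> (\<integral>\<^sup>+x. avg_op n (\<lambda>x. (f x)\<^sup>2) x * avg_op n (\<lambda>x. (f x)\<^sup>2) x \<partial>gausses n)"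
    using assms by (intro noise_op_hypercontractive2) auto
  also have "\<dots> = (\<integral>\<^sup>+x. (f x)\<^sup>2 \<partial>gausses n)\<^sup>2"
    by (rule nn_integral_avg_op_square) measurable
  finally show ?thesis .
qed

text \<open>For the indicator of \<open>A\<close> this is the probability that both members of a pair of correlated Gaussian
  vectors lie in \<open>A\<close>.\<close>

definition stability :: "nat \<Rightarrow> (nat \<Rightarrow> real) \<Rightarrow> ((nat \<Rightarrow> real) \<Rightarrow> ennreal) \<Rightarrow> ennreal" where
  "stability n r f = (\<integral>\<^sup>+x. f x * noise_op n r f x \<partial>gausses n)"

text \<open>By symmetry and the semigroup law \<open>\<parallel>T f\<parallel>\<^sup>2 = \<langle>f, T\<^sup>2 f\<rangle>\<close>, so that Cauchy--Schwarz trades a square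
  for squared correlations.  Iterated, it brings correlations below \<open>1\<close> into the range of the
  hypercontractive estimate.\<close>

lemma stability_doubling:
  assumes "\<And>i. i < n \<Longrightarrow> \<bar>r i\<bar> < 1" and [measurable]: "f \<in> borel_measurable seqs"
  shows "(stability n r f)\<^sup>2 \<le> (\<integral>\<^sup>+x. (f x)\<^sup>2 \<partial>gausses n) * stability n (\<lambda>i. (r i)\<^sup>2) f"
proof -
  have "(stability n r f)\<^sup>2 \<le> (\<integral>\<^sup>+x. (f x)\<^sup>2 \<partial>gausses n) * (\<integral>\<^sup>+x. (noise_op n r f x)\<^sup>2 \<partial>gausses n)"
    unfolding stability_def by (rule Cauchy_Schwarz_nn_integral) measurable
  also have "(\<integral>\<^sup>+x. (noise_op n r f x)\<^sup>2 \<partial>gausses n) = (\<integral>\<^sup>+x. noise_op n r f x * noise_op n r f x \<partial>gausses n)"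
    by (simp add: power2_eq_square)
  also have "\<dots> = (\<integral>\<^sup>+x. f x * noise_op n r (noise_op n r f) x \<partial>gausses n)"
    using assms by (intro noise_op_symmetric[symmetric]) auto
  also have "\<dots> = stability n (\<lambda>i. (r i)\<^sup>2) f"
    using assms by (simp add: noise_op_semigroup stability_def power2_eq_square)
  finally show ?thesis .
qed

text \<open>Cauchy--Schwarz twice, keeping the indicator as a factor, then hypercontractivity.\<close>

lemma stability_small_correlation:
  assumes "\<And>i. i < n \<Longrightarrow> \<bar>r i\<bar> \<le> 1 / 8" and [measurable]: "A \<in> sets seqs"
  shows "(stability n r (indicator A)) ^ 4 \<le> (\<integral>\<^sup>+x. indicator A x \<partial>gausses n) ^ 5"
proof -
  let ?f = "indicator A :: (nat \<Rightarrow> real) \<Rightarrow> ennreal" and ?p = "\<integral>\<^sup>+x. indicator A x \<partial>gausses n"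
  have f2: "(?f x)\<^sup>2 = ?f x" "?f x * (?f x * z) = ?f x * z" for x z by (auto split: split_indicator)
  let ?g = "noise_op n r ?f"
  have "(\<integral>\<^sup>+x. ?f x * (?f x * ?g x) \<partial>gausses n)\<^sup>2 \<le> (\<integral>\<^sup>+x. (?f x)\<^sup>2 \<partial>gausses n) * (\<integral>\<^sup>+x. (?f x * ?g x)\<^sup>2 \<partial>gausses n)"
    by (rule Cauchy_Schwarz_nn_integral) measurable
  then have 1: "(stability n r ?f)\<^sup>2 \<le> ?p * (\<integral>\<^sup>+x. ?f x * (?g x)\<^sup>2 \<partial>gausses n)"
    by (simp add: f2 stability_def power_mult_distrib)
  have "(\<integral>\<^sup>+x. ?f x * (?g x)\<^sup>2 \<partial>gausses n)\<^sup>2 \<le> (\<integral>\<^sup>+x. (?f x)\<^sup>2 \<partial>gausses n) * (\<integral>\<^sup>+x. ((?g x)\<^sup>2)\<^sup>2 \<partial>gausses n)"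
    by (rule Cauchy_Schwarz_nn_integral) measurable
  also have "\<dots> \<le> ?p * ?p\<^sup>2"
    using noise_op_hypercontractive[of n r ?f] assms by (auto simp: f2 intro!: mult_left_mono)
  finally have 2: "(\<integral>\<^sup>+x. ?f x * (?g x)\<^sup>2 \<partial>gausses n)\<^sup>2 \<le> ?p * ?p\<^sup>2" .
  have "(stability n r ?f) ^ 4 = ((stability n r ?f)\<^sup>2)\<^sup>2" by simp
  also have "\<dots> \<le> (?p * (\<integral>\<^sup>+x. ?f x * (?g x)\<^sup>2 \<partial>gausses n))\<^sup>2"
    by (rule power_mono[OF 1]) simp
  also have "\<dots> \<le> ?p\<^sup>2 * (?p * ?p\<^sup>2)"
    unfolding power_mult_distrib by (rule mult_left_mono[OF 2]) simp
  also have "\<dots> = ?p ^ 5" by (simp add: power_add[symmetric] power2_eq_square eval_nat_numeral mult_ac)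
  finally show ?thesis .
qed

lemma stability_iterated_doubling:
  assumes "\<And>i. i < n \<Longrightarrow> \<bar>r i\<bar> < 1" and [measurable]: "A \<in> sets seqs"
  shows "(stability n r (indicator A)) ^ (2 ^ k)
    \<le> (\<integral>\<^sup>+x. indicator A x \<partial>gausses n) ^ (2 ^ k - 1) * stability n (\<lambda>i. r i ^ (2 ^ k)) (indicator A)"
proof (induction k)
  case (Suc k)
  let ?D = "\<lambda>k. stability n (\<lambda>i. r i ^ (2 ^ k)) (indicator A)" and ?p = "\<integral>\<^sup>+x. indicator A x \<partial>gausses n"
  have f2: "(indicator A x :: ennreal)\<^sup>2 = indicator A x" for x by (auto split: split_indicator)
  have "(stability n r (indicator A)) ^ (2 ^ Suc k) = ((stability n r (indicator A)) ^ (2 ^ k))\<^sup>2"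
    by (simp add: power_mult[symmetric] mult.commute)
  also have "\<dots> \<le> (?p ^ (2 ^ k - 1) * ?D k)\<^sup>2"
    by (rule power_mono[OF Suc.IH]) simp
  also have "\<dots> = ?p ^ (2 * (2 ^ k - 1)) * (?D k)\<^sup>2"
    by (simp add: power_mult_distrib power_mult[symmetric] mult.commute)
  also have "(?D k)\<^sup>2 \<le> ?p * stability n (\<lambda>i. (r i ^ (2 ^ k))\<^sup>2) (indicator A)"
    using stability_doubling[of n "\<lambda>i. r i ^ (2 ^ k)" "indicator A"] assms
    by (simp add: f2 power_abs power_less_one_iff)
  also have "(\<lambda>i. (r i ^ (2 ^ k))\<^sup>2) = (\<lambda>i. r i ^ (2 ^ Suc k))"
    by (simp add: power_mult[symmetric] mult.commute)
  also have "?p ^ (2 * (2 ^ k - 1)) * (?p * ?D (Suc k)) = ?p ^ (2 ^ Suc k - 1) * ?D (Suc k)"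
  proof -
    have "2 ^ Suc k - 1 = Suc (2 * (2 ^ k - 1 :: nat))"
      using one_le_power[of "2::nat" k] unfolding power_Suc by linarith
    then show ?thesis by (simp only: power_Suc mult_ac)
  qed
  finally show ?case by (simp add: mult_left_mono)
qed simp

text \<open>Small sets are not noise stable, uniformly in the dimension: the pair lies in \<open>A\<close> with
  probability at most \<open>P(A)\<close> to a power larger than \<open>1\<close>.\<close>

theorem stability_small_sets:
  assumes "0 \<le> \<rho>" "\<rho> < (1::real)"
  obtains K where "K > 0" and
    "\<And>(n::nat) r A. (\<And>i. i < n \<Longrightarrow> 0 \<le> r i \<and> r i \<le> \<rho>) \<Longrightarrow> A \<in> sets seqs \<Longrightarrow>
      (stability n r (indicator A)) ^ K \<le> (\<integral>\<^sup>+x. indicator A x \<partial>gausses n) ^ Suc K"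
proof -
  have "(\<lambda>k. \<rho> ^ k) \<longlonglongrightarrow> 0" using assms by (intro LIMSEQ_realpow_zero) auto
  then have "eventually (\<lambda>k. \<rho> ^ k < 1 / 8) sequentially" by (rule order_tendstoD) simp
  then obtain k0 where k0: "\<And>k. k \<ge> k0 \<Longrightarrow> \<rho> ^ k < 1 / 8" by (auto simp: eventually_sequentially)
  define k where "k = k0"
  have k: "\<rho> ^ (2 ^ k) < 1 / 8" by (rule k0) (use less_exp[of k0] in \<open>simp add: k_def\<close>)
  show ?thesis
  proof (rule that[of "2 ^ k * 4"])
    fix n :: nat and r and A :: "(nat \<Rightarrow> real) set"
    assume r: "\<And>i. i < n \<Longrightarrow> 0 \<le> r i \<and> r i \<le> \<rho>" and [measurable]: "A \<in> sets seqs"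
    let ?p = "\<integral>\<^sup>+x. indicator A x \<partial>gausses n"
    have r1: "\<bar>r i\<bar> < 1" if "i < n" for i
      using r[OF that] assms by linarith
    have "\<bar>r i ^ (2 ^ k)\<bar> \<le> 1 / 8" if "i < n" for i
    proof -
      have "r i ^ (2 ^ k) \<le> \<rho> ^ (2 ^ k)" "0 \<le> r i ^ (2 ^ k)"
        using r[OF that] by (auto intro: power_mono)
      then show ?thesis using k by linarith
    qed
    then have 1: "(stability n (\<lambda>i. r i ^ (2 ^ k)) (indicator A)) ^ 4 \<le> ?p ^ 5"
      by (intro stability_small_correlation) auto
    have "(stability n r (indicator A)) ^ (2 ^ k * 4) \<le> (?p ^ (2 ^ k - 1) * stability n (\<lambda>i. r i ^ (2 ^ k)) (indicator A)) ^ 4"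
      unfolding power_mult using r1 by (intro power_mono stability_iterated_doubling) auto
    also have "\<dots> \<le> ?p ^ ((2 ^ k - 1) * 4) * ?p ^ 5"
      unfolding power_mult_distrib power_mult[symmetric] by (rule mult_left_mono[OF 1]) simp
    also have "\<dots> = ?p ^ Suc (2 ^ k * 4)"
    proof -
      have "(2 ^ k - 1) * 4 + 5 = Suc (2 ^ k * 4 :: nat)"
        using one_le_power[of "2::nat" k] by (simp add: algebra_simps)
      then show ?thesis by (simp only: power_add[symmetric])
    qed
    finally show "(stability n r (indicator A)) ^ (2 ^ k * 4) \<le> ?p ^ Suc (2 ^ k * 4)" .
  qed simp
qed

section \<open>The arcsine bound for Gaussian walks\<close>

lemma (in prob_space) distr_std_normal:
  assumes "distributed M lborel X std_normal_density"
  shows "distr M borel X = gauss"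
proof -
  have "distr M borel X = distr M lborel X" by (rule distr_cong) auto
  also have "\<dots> = gauss" using distributed_distr_eq_density[OF assms] by (simp add: gauss_def)
  finally show ?thesis .
qed

lemma (in prob_space) indep_vars_reindex:
  assumes s: "inj_on s I" and X: "indep_vars M' X (s ` I)"
  shows "indep_vars (\<lambda>i. M' (s i)) (\<lambda>i. X (s i)) I"
  unfolding indep_vars_def2
proof safe
  show "random_variable (M' (s i)) (X (s i))" if "i \<in> I" for i
    using X that unfolding indep_vars_def2 by auto
  have ind: "indep_sets (\<lambda>i. {X i -` A \<inter> space M |A. A \<in> sets (M' i)}) (s ` I)"
    using X unfolding indep_vars_def2 by auto
  show "indep_sets (\<lambda>i. {X (s i) -` A \<inter> space M |A. A \<in> sets (M' (s i))}) I"
  proof (rule indep_setsI)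
    show "{X (s i) -` A \<inter> space M |A. A \<in> sets (M' (s i))} \<subseteq> events" if "i \<in> I" for i
      using ind that unfolding indep_sets_def by auto
  next
    fix A J assume J: "J \<noteq> {}" "J \<subseteq> I" "finite J"
      and A: "\<forall>j\<in>J. A j \<in> {X (s j) -` A \<inter> space M |A. A \<in> sets (M' (s j))}"
    let ?t = "the_inv_into J s"
    have sJ: "inj_on s J" using s J(2) by (rule inj_on_subset)
    have t: "?t (s j) = j" if "j \<in> J" for j using sJ that by (rule the_inv_into_f_f)
    have "prob (\<Inter>k\<in>s ` J. A (?t k)) = (\<Prod>k\<in>s ` J. prob (A (?t k)))"
      by (rule indep_setsD[OF ind]) (use J A t in auto)
    then show "prob (\<Inter>j\<in>J. A j) = (\<Prod>j\<in>J. prob (A j))"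
      using sJ by (simp add: prod.reindex t)
  qed
qed

lemma (in prob_space) nn_integral_indep_gausses:
  assumes X: "indep_vars (\<lambda>_. borel) X {..<n}"
    and N: "\<And>k. k < n \<Longrightarrow> distributed M lborel (X k) std_normal_density"
    and f: "f \<in> borel_measurable seqs"
  shows "(\<integral>\<^sup>+w. f (\<lambda>k\<in>{..<n}. X k w) \<partial>M) = (\<integral>\<^sup>+x. f x \<partial>gausses n)"
proof (cases "n = 0")
  case True
  have "(\<integral>\<^sup>+w. f (\<lambda>k\<in>{..<n}. X k w) \<partial>M) = f (\<lambda>_. undefined)"
    using True by (simp add: emeasure_space_1 restrict_def)
  also have "\<dots> = (\<integral>\<^sup>+x. f x \<partial>gausses n)"
    using f True by (simp add: nn_integral_gausses PiM_empty nn_integral_count_space_finite)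
  finally show ?thesis .
next
  case False
  have rv[measurable]: "random_variable borel (X k)" if "k \<in> {..<n}" for k
    using X that unfolding indep_vars_def by auto
  have "distr M (PiM {..<n} (\<lambda>_. borel)) (\<lambda>w. \<lambda>k\<in>{..<n}. X k w) = PiM {..<n} (\<lambda>i. distr M borel (X i))"
    using indep_vars_iff_distr_eq_PiM'[where I = "{..<n}" and M' = "\<lambda>_. borel" and X = X] X False rv by auto
  also have "\<dots> = PiM {..<n} (\<lambda>_. gauss)"
    by (rule PiM_cong) (use N in \<open>auto intro: distr_std_normal\<close>)
  finally have d: "distr M (PiM {..<n} (\<lambda>_. borel)) (\<lambda>w. \<lambda>k\<in>{..<n}. X k w) = PiM {..<n} (\<lambda>_. gauss)" .
  have "(\<integral>\<^sup>+x. f x \<partial>gausses n) = (\<integral>\<^sup>+x. f x \<partial>distr M (PiM {..<n} (\<lambda>_. borel)) (\<lambda>w. \<lambda>k\<in>{..<n}. X k w))"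
    by (simp add: nn_integral_gausses[OF f] d)
  also have "\<dots> = (\<integral>\<^sup>+w. f (\<lambda>k\<in>{..<n}. X k w) \<partial>M)"
    by (rule nn_integral_distr) (auto intro!: measurable_restrict rv measurable_compose[OF measurable_PiM_seqs f])
  finally show ?thesis ..
qed

lemma sum_inverse_sqrt_le: "(\<Sum>k\<le>b. 1 / sqrt (real k + 1)) \<le> 2 * sqrt (real b + 1)"
proof (induction b)
  case (Suc b)
  have step: "2 * u + 1 / v \<le> 2 * v" if v: "0 < v" and uv: "u\<^sup>2 + 1 = v\<^sup>2" for u v :: real
  proof -
    have "2 * u * v + 1 \<le> 2 * v\<^sup>2"
      using sum_squares_bound[of u v] uv by linarith
    moreover have "(2 * u + 1 / v) * v = 2 * u * v + 1"
      using v by (simp add: distrib_right)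
    ultimately have "(2 * u + 1 / v) * v \<le> (2 * v) * v" by (simp only: power2_eq_square mult.assoc)
    then show ?thesis using v by (rule mult_right_le_imp_le)
  qed
  have "2 * sqrt (real b + 1) + 1 / sqrt (real b + 2) \<le> 2 * sqrt (real b + 2)"
    by (rule step) auto
  moreover have "(\<Sum>k\<le>Suc b. 1 / sqrt (real k + 1)) = (\<Sum>k\<le>b. 1 / sqrt (real k + 1)) + 1 / sqrt (real b + 2)"
    by (simp add: add.commute)
  moreover have "real (Suc b) + 1 = real b + 2" by simp
  ultimately show ?case using Suc by (simp only:)
qed simp

locale gaussian_walk = prob_space M for M :: "'w measure" +
  fixes X :: "nat \<Rightarrow> 'w \<Rightarrow> real" and n :: nat
  assumes indep_X: "indep_vars (\<lambda>_. borel) X {..<n}"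
    and normal_X: "\<And>k. k < n \<Longrightarrow> distributed M lborel (X k) std_normal_density"
begin

lemma X_measurable[measurable (raw)]: "k < n \<Longrightarrow> X k \<in> borel_measurable M"
  using indep_X unfolding indep_vars_def by auto

definition S :: "nat \<Rightarrow> 'w \<Rightarrow> real" where
  "S k w = (\<Sum>i<k. X i w)"

lemma S_measurable[measurable (raw)]: "k \<le> n \<Longrightarrow> S k \<in> borel_measurable M"
  unfolding S_def by (intro borel_measurable_sum X_measurable) auto

text \<open>The increments are exchangeable and symmetric, so this one sequence describes all
  one-sided events: the walk staying below its starting point, seen from any position in either
  direction of time.\<close>

definition stay_neg :: "nat \<Rightarrow> real" where
  "stay_neg k = measure (gausses k) {x. \<forall>l\<in>{1..k}. (\<Sum>i<l. x i) < 0}"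

lemma stay_neg_eq:
  assumes s: "inj_on s {..<k}" "s ` {..<k} \<subseteq> {..<n}" and sgn: "e = 1 \<or> e = - 1"
  shows "prob {w\<in>space M. \<forall>l\<in>{1..k}. (\<Sum>i<l. e * X (s i) w) < 0} = stay_neg k"
proof -
  let ?A = "{x. \<forall>l\<in>{1..k}. (\<Sum>i<l. x i) < 0} :: (nat \<Rightarrow> real) set"
  have A[measurable]: "?A \<in> sets seqs"
  proof -
    have "{x\<in>space seqs. \<forall>l\<in>{1..k}. (\<Sum>i<l. x i) < 0} \<in> sets seqs" by measurable
    then show ?thesis by simp
  qed
  have e: "(\<integral>\<^sup>+x. indicator ?A x \<partial>gausses k) = emeasure (gausses k) ?A"
    by (rule nn_integral_indicator) (use A in simp)
  have "indep_vars (\<lambda>_. borel) (\<lambda>i. X (s i)) {..<k}"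
  proof -
    have "indep_vars (\<lambda>_. borel) X (s ` {..<k})"
      by (rule indep_vars_subset[OF indep_X s(2)])
    then show ?thesis
      using indep_vars_reindex[OF s(1), of "\<lambda>_. borel" X] by simp
  qed
  then have 1: "indep_vars (\<lambda>_. borel) (\<lambda>i w. e * X (s i) w) {..<k}"
    by (rule indep_vars_compose2) auto
  have 2: "distributed M lborel (\<lambda>w. e * X (s i) w) std_normal_density" if "i < k" for i
    using normal_density_affine[OF normal_X[of "s i"], of e 0] s(2) that sgn by auto
  have "(\<integral>\<^sup>+w. indicator ?A (\<lambda>i\<in>{..<k}. e * X (s i) w) \<partial>M) = (\<integral>\<^sup>+x. indicator ?A x \<partial>gausses k)"
    by (rule nn_integral_indep_gausses[OF 1 2]) auto
  also have "(\<integral>\<^sup>+w. indicator ?A (\<lambda>i\<in>{..<k}. e * X (s i) w) \<partial>M)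
    = (\<integral>\<^sup>+w. indicator {w\<in>space M. \<forall>l\<in>{1..k}. (\<Sum>i<l. e * X (s i) w) < 0} w \<partial>M)"
    by (intro nn_integral_cong) (auto split: split_indicator)
  also have "\<dots> = emeasure M {w\<in>space M. \<forall>l\<in>{1..k}. (\<Sum>i<l. e * X (s i) w) < 0}"
  proof (rule nn_integral_indicator)
    have "(\<lambda>w. \<Sum>i<l. e * X (s i) w) \<in> borel_measurable M" if "l \<in> {1..k}" for l
    proof (intro borel_measurable_sum borel_measurable_times borel_measurable_const X_measurable)
      fix i assume "i \<in> {..<l}"
      then have "i \<in> {..<k}" using that by auto
      then show "s i < n" using s(2) by auto
    qed
    then have "{w\<in>space M. (\<Sum>i<l. e * X (s i) w) < 0} \<in> sets M" if "l \<in> {1..k}" for l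
      using that by measurable
    then show "{w\<in>space M. \<forall>l\<in>{1..k}. (\<Sum>i<l. e * X (s i) w) < 0} \<in> sets M"
      by (intro sets.sets_Collect_finite_All) auto
  qed
  finally show ?thesis
    unfolding e stay_neg_def measure_def by simp
qed

lemma S_diff: "S (c + l) w - S c w = (\<Sum>i<l. X (c + i) w)"
  unfolding S_def by (induction l) auto

lemma S_diff_rev:
  assumes "l \<le> k" shows "S k w - S (k - l) w = (\<Sum>i<l. X (k - 1 - i) w)"
  using assms
proof (induction l)
  case (Suc l)
  then have k: "k - l = Suc (k - Suc l)" "k - 1 - l = k - Suc l" by auto
  have "S (k - l) w = S (k - Suc l) w + X (k - Suc l) w"
    unfolding S_def k(1) by simp
  then show ?case using Suc k by simp
qed simp

text \<open>Seen from a strict maximum, the walk stays negative both backwards and forwards in time, and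
  these are events about disjoint sets of increments.\<close>

lemma strict_argmax_prob:
  assumes "c + h \<le> n" "k \<le> h"
  shows "prob {w\<in>space M. \<forall>l\<le>h. l \<noteq> k \<longrightarrow> S (c + l) w < S (c + k) w} = stay_neg k * stay_neg (h - k)"
proof -
  let ?A = "{c..<c + k}" and ?B = "{c + k..<c + h}"
  let ?XA = "\<lambda>w. restrict (\<lambda>i. X i w) ?A" and ?XB = "\<lambda>w. restrict (\<lambda>i. X i w) ?B"
  let ?PA = "PiM ?A (\<lambda>_. borel :: real measure)" and ?PB = "PiM ?B (\<lambda>_. borel :: real measure)"
  have ind: "indep_var ?PA ?XA ?PB ?XB"
    by (rule indep_var_restrict[OF indep_X]) (use assms in auto)
  define EA where "EA = {x\<in>space ?PA. \<forall>l\<in>{1..k}. (\<Sum>i<l. (- 1) * x (c + k - 1 - i)) < 0}"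
  define EB where "EB = {x\<in>space ?PB. \<forall>l\<in>{1..h - k}. (\<Sum>i<l. 1 * x (c + k + i)) < 0}"
  have mA: "EA \<in> sets ?PA"
    unfolding EA_def
  proof (intro sets.sets_Collect_finite_All)
    fix l assume l: "l \<in> {1..k}"
    have [measurable]: "(\<lambda>x. \<Sum>i<l. (- 1) * x (c + k - 1 - i)) \<in> borel_measurable ?PA"
      using l by (intro borel_measurable_sum borel_measurable_times borel_measurable_const measurable_component_singleton) auto
    show "{x\<in>space ?PA. (\<Sum>i<l. (- 1) * x (c + k - 1 - i)) < 0} \<in> sets ?PA" by measurable
  qed auto
  have mB: "EB \<in> sets ?PB"
    unfolding EB_def
  proof (intro sets.sets_Collect_finite_All)
    fix l assume l: "l \<in> {1..h - k}"
    have [measurable]: "(\<lambda>x. \<Sum>i<l. 1 * x (c + k + i)) \<in> borel_measurable ?PB"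
      using l by (intro borel_measurable_sum borel_measurable_times borel_measurable_const measurable_component_singleton) auto
    show "{x\<in>space ?PB. (\<Sum>i<l. 1 * x (c + k + i)) < 0} \<in> sets ?PB" by measurable
  qed auto
  have spA: "?XA w \<in> space ?PA" and spB: "?XB w \<in> space ?PB" for w
    by (auto simp: space_PiM)
  have eA: "?XA w \<in> EA \<longleftrightarrow> (\<forall>l\<in>{1..k}. (\<Sum>i<l. (- 1) * X (c + k - 1 - i) w) < 0)" for w
  proof -
    have "(\<Sum>i<l. (- 1) * ?XA w (c + k - 1 - i)) = (\<Sum>i<l. (- 1) * X (c + k - 1 - i) w)" if "l \<in> {1..k}" for l
      using that by (intro sum.cong) auto
    then show ?thesis unfolding EA_def using spA by simp
  qed
  have eB: "?XB w \<in> EB \<longleftrightarrow> (\<forall>l\<in>{1..h - k}. (\<Sum>i<l. 1 * X (c + k + i) w) < 0)" for w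
  proof -
    have "(\<Sum>i<l. 1 * ?XB w (c + k + i)) = (\<Sum>i<l. 1 * X (c + k + i) w)" if "l \<in> {1..h - k}" for l
      using that by (intro sum.cong) auto
    then show ?thesis unfolding EB_def using spB by simp
  qed
  have evA: "?XA -` EA \<inter> space M = {w\<in>space M. \<forall>l\<in>{1..k}. (\<Sum>i<l. (- 1) * X (c + k - 1 - i) w) < 0}"
    unfolding eA[symmetric] by blast
  have evB: "?XB -` EB \<inter> space M = {w\<in>space M. \<forall>l\<in>{1..h - k}. (\<Sum>i<l. 1 * X (c + k + i) w) < 0}"
    unfolding eB[symmetric] by blast
  have pA: "prob (?XA -` EA \<inter> space M) = stay_neg k"
    unfolding evA using assms by (intro stay_neg_eq) (auto intro!: inj_onI)
  have pB: "prob (?XB -` EB \<inter> space M) = stay_neg (h - k)"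
    unfolding evB using assms by (intro stay_neg_eq) (auto intro!: inj_onI)
  have "{w\<in>space M. \<forall>l\<le>h. l \<noteq> k \<longrightarrow> S (c + l) w < S (c + k) w}
     = (\<lambda>w. (?XA w, ?XB w)) -` (EA \<times> EB) \<inter> space M"
  proof -
    have "(\<forall>l\<le>h. l \<noteq> k \<longrightarrow> S (c + l) w < S (c + k) w) \<longleftrightarrow>
      (\<forall>l\<in>{1..k}. (\<Sum>i<l. (- 1) * X (c + k - 1 - i) w) < 0) \<and> (\<forall>l\<in>{1..h - k}. (\<Sum>i<l. 1 * X (c + k + i) w) < 0)" 
      (is "?L \<longleftrightarrow> ?R1 \<and> ?R2") for w
    proof -
      have b: "(\<Sum>i<l. (- 1) * X (c + k - 1 - i) w) = S (c + (k - l)) w - S (c + k) w" if "l \<le> k" for l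
        using S_diff_rev[of l "c + k" w] that by (simp add: sum_negf)
      have f: "(\<Sum>i<l. 1 * X (c + k + i) w) = S (c + (k + l)) w - S (c + k) w" for l
        using S_diff[of "c + k" l w] by (simp add: add.assoc)
      have "?R1 \<longleftrightarrow> (\<forall>l<k. S (c + l) w < S (c + k) w)"
      proof safe
        fix l assume R: ?R1 "l < k"
        then have "k - l \<in> {1..k}" by auto
        with R(1) have "(\<Sum>i<k - l. (- 1) * X (c + k - 1 - i) w) < 0" by blast
        then show "S (c + l) w < S (c + k) w" using b[of "k - l"] R(2) by simp
      next
        fix l assume R: "\<forall>l<k. S (c + l) w < S (c + k) w" "l \<in> {1..k}"
        then have "l \<le> k" "k - l < k" by auto
        then show "(\<Sum>i<l. (- 1) * X (c + k - 1 - i) w) < 0" unfolding b[OF \<open>l \<le> k\<close>] using R(1)[rule_format, of "k - l"] by linarith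
      qed
      moreover have "?R2 \<longleftrightarrow> (\<forall>l. k < l \<and> l \<le> h \<longrightarrow> S (c + l) w < S (c + k) w)"
      proof safe
        fix l assume R: ?R2 "k < l" "l \<le> h"
        then have "l - k \<in> {1..h - k}" by auto
        with R(1) have "(\<Sum>i<l - k. 1 * X (c + k + i) w) < 0" by blast
        then show "S (c + l) w < S (c + k) w" using f[of "l - k"] R(2) by simp
      next
        fix l assume R: "\<forall>l. k < l \<and> l \<le> h \<longrightarrow> S (c + l) w < S (c + k) w" "l \<in> {1..h - k}"
        then show "(\<Sum>i<l. 1 * X (c + k + i) w) < 0" unfolding f using assms by auto
      qed
      moreover have "?L \<longleftrightarrow> (\<forall>l<k. S (c + l) w < S (c + k) w) \<and> (\<forall>l. k < l \<and> l \<le> h \<longrightarrow> S (c + l) w < S (c + k) w)"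
        using assms(2) by (auto simp: neq_iff)
      ultimately show ?thesis by blast
    qed
    then show ?thesis unfolding eA[symmetric] eB[symmetric] by blast
  qed
  then show ?thesis
    using indep_varD[OF ind mA mB] pA pB by simp
qed

lemma stay_neg_nonneg: "0 \<le> stay_neg k"
  by (simp add: stay_neg_def)

lemma stay_neg_mono:
  assumes "k \<le> h" "h \<le> n" shows "stay_neg h \<le> stay_neg k"
proof -
  have e: "stay_neg j = prob {w\<in>space M. \<forall>l\<in>{1..j}. (\<Sum>i<l. 1 * X i w) < 0}" if "j \<le> n" for j
    by (rule stay_neg_eq[symmetric, where s = "\<lambda>i. i"]) (use that in auto)
  have "{w\<in>space M. \<forall>l\<in>{1..k}. (\<Sum>i<l. 1 * X i w) < 0} \<in> sets M"
  proof (intro sets.sets_Collect_finite_All)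
    fix l assume l: "l \<in> {1..k}"
    have [measurable]: "(\<lambda>x. \<Sum>i<l. 1 * X i x) \<in> borel_measurable M"
      using l assms by (intro borel_measurable_sum borel_measurable_times borel_measurable_const X_measurable) auto
    show "{x\<in>space M. (\<Sum>i<l. 1 * X i x) < 0} \<in> sets M" by measurable
  qed auto
  then show ?thesis
    using assms by (simp only: e order_trans[OF assms]) (rule finite_measure_mono, auto)
qed

lemma strict_argmax_sets[measurable]:
  assumes "c + h \<le> n" "k \<le> h"
  shows "{w\<in>space M. \<forall>l\<le>h. l \<noteq> k \<longrightarrow> S (c + l) w < S (c + k) w} \<in> sets M"
proof -
  have [measurable]: "S (c + l) \<in> borel_measurable M" if "l \<le> h" for l
    using assms that by (intro S_measurable) auto
  have "{w\<in>space M. \<forall>l\<in>{..h}. l \<noteq> k \<longrightarrow> S (c + l) w < S (c + k) w} \<in> sets M"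
  proof (intro sets.sets_Collect_finite_All)
    fix l assume "l \<in> {..h}"
    then have [measurable]: "S (c + l) \<in> borel_measurable M" "S (c + k) \<in> borel_measurable M"
      using assms by auto
    show "{w\<in>space M. l \<noteq> k \<longrightarrow> S (c + l) w < S (c + k) w} \<in> sets M" by measurable
  qed auto
  then show ?thesis unfolding Ball_def atMost_iff .
qed

text \<open>The positions of a strict maximum are disjoint events, and each has probability at least
  \<open>(stay_neg h)\<^sup>2\<close> by monotonicity.\<close>

lemma stay_neg_bound:
  assumes "h \<le> n" shows "stay_neg h \<le> 1 / sqrt (h + 1)"
proof -
  let ?E = "\<lambda>k. {w\<in>space M. \<forall>l\<le>h. l \<noteq> k \<longrightarrow> S (0 + l) w < S (0 + k) w}"
  have "(h + 1) * (stay_neg h)\<^sup>2 = (\<Sum>k\<le>h. (stay_neg h)\<^sup>2)" by simp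
  also have "\<dots> \<le> (\<Sum>k\<le>h. stay_neg k * stay_neg (h - k))"
    unfolding power2_eq_square using assms
    by (intro sum_mono mult_mono stay_neg_mono stay_neg_nonneg) auto
  also have "\<dots> = (\<Sum>k\<le>h. prob (?E k))"
    using assms by (intro sum.cong refl strict_argmax_prob[symmetric]) auto
  also have "\<dots> = prob (\<Union>k\<in>{..h}. ?E k)"
  proof (rule finite_measure_finite_Union[symmetric])
    show "disjoint_family_on ?E {..h}"
      unfolding disjoint_family_on_def
    proof (intro ballI impI equalityI subsetI)
      fix k k' w assume kk: "k \<in> {..h}" "k' \<in> {..h}" "k \<noteq> k'" and w: "w \<in> ?E k \<inter> ?E k'"
      have "S (0 + k') w < S (0 + k) w" "S (0 + k) w < S (0 + k') w" using kk w by auto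
      then show "w \<in> {}" by simp
    qed auto
  qed (use assms strict_argmax_sets[of 0 h] in auto)
  also have "\<dots> \<le> 1" by simp
  finally have "(stay_neg h)\<^sup>2 \<le> 1 / (h + 1)" by (simp add: field_simps)
  then have "sqrt ((stay_neg h)\<^sup>2) \<le> sqrt (1 / (h + 1))" by (rule real_sqrt_le_mono)
  then show ?thesis
    by (simp only: real_sqrt_abs abs_of_nonneg[OF stay_neg_nonneg] real_sqrt_divide real_sqrt_one)
qed

text \<open>Near an end of the window one of the two factors is only bounded by \<open>1/\<surd>(k + 1)\<close> at distance \<open>k\<close> from that
  end, but these bounds sum to at most \<open>2\<surd>(b + 1)\<close>; the other factor is at most \<open>1/\<surd>m\<close>.\<close>

lemma argmax_in_window_bound:
  fixes d :: "nat \<Rightarrow> nat" and m b c h :: nat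
  assumes w: "\<And>k. k \<in> K \<Longrightarrow> k \<le> h" and c: "c + h \<le> n" and b: "inj_on d K" "d ` K \<subseteq> {..b}"
    and far: "\<And>k. k \<in> K \<Longrightarrow> (d k = k \<and> m \<le> h - k) \<or> (d k = h - k \<and> m \<le> k)" and m: "0 < m"
  shows "prob {w\<in>space M. \<exists>k\<in>K. \<forall>l\<le>h. l \<noteq> k \<longrightarrow> S (c + l) w < S (c + k) w} \<le> 2 * sqrt (real b + 1) / sqrt (real m)"
proof -
  let ?E = "\<lambda>k. {w\<in>space M. \<forall>l\<le>h. l \<noteq> k \<longrightarrow> S (c + l) w < S (c + k) w}"
  have fK: "finite K" using w by (intro finite_subset[of K "{..h}"]) auto
  have "prob {w\<in>space M. \<exists>k\<in>K. \<forall>l\<le>h. l \<noteq> k \<longrightarrow> S (c + l) w < S (c + k) w} = prob (\<Union>k\<in>K. ?E k)"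
    by (rule arg_cong[where f = prob]) auto
  also have "\<dots> \<le> (\<Sum>k\<in>K. prob (?E k))"
  proof (rule finite_measure_subadditive_finite[OF fK])
    show "?E ` K \<subseteq> events" using strict_argmax_sets[OF c w] by blast
  qed
  also have "\<dots> = (\<Sum>k\<in>K. stay_neg k * stay_neg (h - k))"
    by (rule sum.cong[OF refl strict_argmax_prob[OF c w]])
  also have "\<dots> \<le> (\<Sum>k\<in>K. 1 / sqrt (real (d k) + 1) * (1 / sqrt m))"
  proof (rule sum_mono)
    fix k assume k: "k \<in> K"
    have s: "stay_neg j \<le> 1 / sqrt m" if "m \<le> j" "j \<le> n" for j
    proof -
      have "stay_neg j \<le> 1 / sqrt (j + 1)" by (rule stay_neg_bound) fact
      also have "\<dots> \<le> 1 / sqrt m" using that m by (intro frac_le) auto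
      finally show ?thesis .
    qed
    have t: "stay_neg j \<le> 1 / sqrt (real j + 1)" if "j \<le> n" for j
      using stay_neg_bound[OF that] by (simp add: add.commute)
    from far[OF k] show "stay_neg k * stay_neg (h - k) \<le> 1 / sqrt (real (d k) + 1) * (1 / sqrt m)"
    proof (elim disjE conjE)
      assume d: "d k = k" "m \<le> h - k"
      then show ?thesis using w[OF k] c unfolding d(1) by (intro mult_mono s t stay_neg_nonneg) auto
    next
      assume d: "d k = h - k" "m \<le> k"
      then show ?thesis using w[OF k] c unfolding d(1)
        by (subst mult.commute) (intro mult_mono s t stay_neg_nonneg, auto)
    qed
  qed
  also have "\<dots> = (\<Sum>j\<in>d ` K. 1 / sqrt (real j + 1)) * (1 / sqrt m)"
    unfolding sum_distrib_right using b(1) by (simp add: sum.reindex)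
  also have "\<dots> \<le> (\<Sum>j\<le>b. 1 / sqrt (real j + 1)) * (1 / sqrt m)"
    using b(2) by (intro mult_right_mono sum_mono2) auto
  also have "\<dots> \<le> 2 * sqrt (real b + 1) * (1 / sqrt m)"
    by (intro mult_right_mono sum_inverse_sqrt_le) auto
  finally show ?thesis by simp
qed

text \<open>The block is made an end of the window: the part of the walk on the side of the shorter
  remainder is dropped, which only enlarges the event and leaves a window that extends at least \<open>q b\<close>
  beyond the block.\<close>

lemma argmax_in_block_bound:
  fixes q b i :: nat
  assumes n: "n = 4 * q * b" and b: "0 < b" and i: "i < 4 * q"
    and K: "\<And>k. k \<in> K \<Longrightarrow> i * b \<le> k \<and> k \<le> (i + 1) * b"
  shows "prob {w\<in>space M. \<exists>k\<in>K. \<forall>l\<le>n. l \<noteq> k \<longrightarrow> S l w < S k w} \<le> 2 * sqrt (real b + 1) / sqrt (real (q * b))"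
proof (cases "i < 2 * q")
  case True
  have ib: "(i + 1) * b \<le> 2 * q * b" using True by (intro mult_le_mono1) simp
  moreover have "i * b \<le> 4 * q * b" using True by (intro mult_le_mono1) simp
  ultimately have ib: "(i + 1) * b \<le> 2 * q * b" "i * b \<le> n" unfolding n by simp_all
  let ?L = "(\<lambda>k. k - i * b) ` K" and ?h = "n - i * b"
  have meas: "{w\<in>space M. \<exists>k\<in>?L. \<forall>l\<le>?h. l \<noteq> k \<longrightarrow> S (i * b + l) w < S (i * b + k) w} \<in> sets M"
  proof -
    have "finite K" using K by (intro finite_subset[of K "{..(i + 1) * b}"]) auto
    then have "finite ?L" by simp
    moreover have "k \<le> ?h" if "k \<in> ?L" for k
    proof -
      obtain k' where k': "k' \<in> K" "k = k' - i * b" using \<open>k \<in> ?L\<close> by auto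
      then have "k' \<le> n" using K[OF k'(1)] ib n by linarith
      then show ?thesis using k' by auto
    qed
    ultimately show ?thesis using ib
      by (intro sets.sets_Collect_finite_Ex[rotated] strict_argmax_sets) auto
  qed
  have "prob {w\<in>space M. \<exists>k\<in>K. \<forall>l\<le>n. l \<noteq> k \<longrightarrow> S l w < S k w}
    \<le> prob {w\<in>space M. \<exists>k\<in>?L. \<forall>l\<le>?h. l \<noteq> k \<longrightarrow> S (i * b + l) w < S (i * b + k) w}"
  proof (rule finite_measure_mono[OF _ meas], safe)
    fix w k assume "k \<in> K" and a: "\<forall>l\<le>n. l \<noteq> k \<longrightarrow> S l w < S k w"
    have "i * b + (k - i * b) = k" using K[OF \<open>k \<in> K\<close>] by auto
    then show "\<exists>k\<in>?L. \<forall>l\<le>?h. l \<noteq> k \<longrightarrow> S (i * b + l) w < S (i * b + k) w"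
      using a \<open>k \<in> K\<close> ib by (intro bexI[of _ "k - i * b"]) auto
  qed
  also have "\<dots> \<le> 2 * sqrt (real b + 1) / sqrt (real (q * b))"
  proof (rule argmax_in_window_bound[where d = "\<lambda>k. k"])
    fix k assume "k \<in> ?L"
    then obtain k' where k': "k' \<in> K" "k = k' - i * b" by auto
    have "k \<le> b" using K[OF k'(1)] k'(2) by auto
    moreover have "b \<le> q * b" using i b by (cases q) auto
    ultimately show "k = k \<and> q * b \<le> ?h - k \<or> k = ?h - k \<and> q * b \<le> k" "k \<le> ?h"
      using K[OF k'(1)] k'(2) ib n by auto
  next
    show "i * b + ?h \<le> n" using ib by simp
    show "0 < q * b" using i b by auto
    show "(\<lambda>k. k) ` ?L \<subseteq> {..b}"
    proof
      fix k assume "k \<in> (\<lambda>k. k) ` ?L"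
      then obtain k' where "k' \<in> K" "k = k' - i * b" by auto
      then show "k \<in> {..b}" using K[of k'] by auto
    qed
  qed simp
  finally show ?thesis .
next
  case False
  let ?h = "(i + 1) * b"
  have ib: "2 * (q * b) \<le> i * b" using False by (metis mult.assoc mult_le_mono1 not_less)
  have "?h \<le> 4 * q * b" using i by (intro mult_le_mono1) auto
  then have h: "?h \<le> n" unfolding n .
  have meas: "{w\<in>space M. \<exists>k\<in>K. \<forall>l\<le>?h. l \<noteq> k \<longrightarrow> S (0 + l) w < S (0 + k) w} \<in> sets M"
  proof -
    have "finite K" using K by (intro finite_subset[of K "{..(i + 1) * b}"]) auto
    then show ?thesis
    proof (rule sets.sets_Collect_finite_Ex[rotated])
      fix k assume "k \<in> K"
      then show "{w\<in>space M. \<forall>l\<le>?h. l \<noteq> k \<longrightarrow> S (0 + l) w < S (0 + k) w} \<in> sets M"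
        using h K by (intro strict_argmax_sets) auto
    qed
  qed
  have "prob {w\<in>space M. \<exists>k\<in>K. \<forall>l\<le>n. l \<noteq> k \<longrightarrow> S l w < S k w}
    \<le> prob {w\<in>space M. \<exists>k\<in>K. \<forall>l\<le>?h. l \<noteq> k \<longrightarrow> S (0 + l) w < S (0 + k) w}"
  proof (rule finite_measure_mono[OF _ meas], safe)
    fix w k assume k: "k \<in> K" and a: "\<forall>l\<le>n. l \<noteq> k \<longrightarrow> S l w < S k w"
    have "\<forall>l\<le>?h. l \<noteq> k \<longrightarrow> S (0 + l) w < S (0 + k) w"
      using a h unfolding add_0 by (meson order_trans)
    with k show "\<exists>k\<in>K. \<forall>l\<le>?h. l \<noteq> k \<longrightarrow> S (0 + l) w < S (0 + k) w" by blast
  qed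
  also have "\<dots> \<le> 2 * sqrt (real b + 1) / sqrt (real (q * b))"
  proof (rule argmax_in_window_bound[where d = "\<lambda>k. ?h - k"])
    show "inj_on (\<lambda>k. ?h - k) K"
    proof (rule inj_onI)
      fix x y assume "x \<in> K" "y \<in> K" "?h - x = ?h - y"
      then show "x = y" using K[of x] K[of y] by linarith
    qed
    show "(\<lambda>k. ?h - k) ` K \<subseteq> {..b}" using K by fastforce
    show "0 + ?h \<le> n" using h by simp
    show "k \<le> ?h" if "k \<in> K" for k using K[OF that] by simp
    show "0 < q * b" using i b by auto
    fix k assume "k \<in> K"
    have "i * b \<le> k" using K[OF \<open>k \<in> K\<close>] by simp
    with ib have "q * b \<le> k" by linarith
    then show "?h - k = k \<and> q * b \<le> ?h - k \<or> ?h - k = ?h - k \<and> q * b \<le> k"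
      by simp
  qed
  finally show ?thesis .
qed

end

section \<open>Block sums with shared summands\<close>

lemma nn_integral_lborel_shift:
  fixes a :: real
  assumes "F \<in> borel_measurable borel"
  shows "(\<integral>\<^sup>+b. F (a + b) \<partial>lborel) = (\<integral>\<^sup>+x. F x \<partial>lborel)"
  using nn_integral_real_affine[OF assms, of 1 a] by simp

lemma (in prob_space) nn_integral_distributed_borel:
  assumes "distributed M lborel X (\<lambda>x. ennreal (f x))" and [measurable]: "H \<in> borel_measurable borel" "f \<in> borel_measurable borel"
  shows "(\<integral>\<^sup>+x. H x \<partial>distr M borel X) = (\<integral>\<^sup>+x. H x * ennreal (f x) \<partial>lborel)"
proof -
  have "distr M borel X = distr M lborel X" by (rule distr_cong) auto
  also have "\<dots> = density lborel f" by (rule distributed_distr_eq_density[OF assms(1)])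
  finally show ?thesis by (simp add: nn_integral_density mult.commute)
qed

lemma (in prob_space) nn_integral_indep_var:
  assumes i: "indep_var S X T Y" and h[measurable]: "h \<in> borel_measurable (S \<Otimes>\<^sub>M T)"
  shows "(\<integral>\<^sup>+w. h (X w, Y w) \<partial>M) = (\<integral>\<^sup>+x. \<integral>\<^sup>+y. h (x, y) \<partial>distr M T Y \<partial>distr M S X)"
proof -
  have [measurable]: "random_variable S X" "random_variable T Y"
    using i indep_var_rv1 indep_var_rv2 by blast+
  interpret Y: prob_space "distr M T Y" by (rule prob_space_distr) measurable
  have "(\<integral>\<^sup>+w. h (X w, Y w) \<partial>M) = (\<integral>\<^sup>+p. h p \<partial>distr M (S \<Otimes>\<^sub>M T) (\<lambda>w. (X w, Y w)))"
    by (simp add: nn_integral_distr)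
  also have "\<dots> = (\<integral>\<^sup>+p. h p \<partial>(distr M S X \<Otimes>\<^sub>M distr M T Y))"
    using i unfolding indep_var_distribution_eq by simp
  also have "\<dots> = (\<integral>\<^sup>+x. \<integral>\<^sup>+y. h (x, y) \<partial>distr M T Y \<partial>distr M S X)"
    by (rule Y.nn_integral_fst[symmetric]) simp
  finally show ?thesis .
qed

lemma (in prob_space) scaled_sum_normal:
  assumes "finite I" "I \<noteq> {}" "indep_vars (\<lambda>_. borel) Z I" "0 < m"
    and "\<And>i. i \<in> I \<Longrightarrow> distributed M lborel (Z i) std_normal_density"
  shows "distributed M lborel (\<lambda>w. (\<Sum>i\<in>I. Z i w) / sqrt m) (normal_density 0 (sqrt (real (card I) / m)))"
proof -
  have "distributed M lborel (\<lambda>w. \<Sum>i\<in>I. Z i w) (normal_density (\<Sum>i\<in>I. 0) (sqrt (\<Sum>i\<in>I. 1\<^sup>2)))"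
    by (rule sum_indep_normal) (use assms in auto)
  then have 1: "distributed M lborel (\<lambda>w. \<Sum>i\<in>I. Z i w) (normal_density 0 (sqrt (real (card I))))"
    by simp
  have "card I > 0" using assms by (simp add: card_gt_0_iff)
  then have "distributed M lborel (\<lambda>w. 0 + (1 / sqrt m) * (\<Sum>i\<in>I. Z i w))
      (normal_density (0 + (1 / sqrt m) * 0) (\<bar>1 / sqrt m\<bar> * sqrt (real (card I))))"
    using assms(4) by (intro normal_density_affine[OF 1]) auto
  then show ?thesis using assms(4) by (simp add: real_sqrt_divide)
qed

lemma (in prob_space) shared_sum_pair_law:
  fixes \<zeta> :: "nat \<times> bool \<Rightarrow> 'a \<Rightarrow> real" and \<kappa> :: "nat \<Rightarrow> bool"
  assumes B: "finite B" and ind: "indep_vars (\<lambda>_. borel) \<zeta> (B \<times> UNIV)"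
    and N: "\<And>p. p \<in> B \<times> UNIV \<Longrightarrow> distributed M lborel (\<zeta> p) std_normal_density"
    and R: "{i\<in>B. \<not> \<kappa> i} \<noteq> {}" and m: "m = card B" and r: "r = card {i\<in>B. \<kappa> i} / m"
    and h[measurable]: "h \<in> borel_measurable (borel \<Otimes>\<^sub>M borel)"
  shows "(\<integral>\<^sup>+w. h ((\<Sum>i\<in>B. \<zeta> (i, False) w) / sqrt m, (\<Sum>i\<in>B. \<zeta> (i, \<not> \<kappa> i) w) / sqrt m) \<partial>M)
    = (\<integral>\<^sup>+x. \<integral>\<^sup>+y. h (x, y) * ennreal (mehler r x y) \<partial>lborel \<partial>gauss)"
proof -
  let ?K = "{i\<in>B. \<kappa> i}" and ?R = "{i\<in>B. \<not> \<kappa> i}"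
  have BKR: "B = ?K \<union> ?R" "?K \<inter> ?R = {}" "finite ?K" "finite ?R" using B by auto
  have cm: "card B = card ?K + card ?R"
    using card_Un_disjoint[OF BKR(3,4,2)] BKR(1) by simp
  have R0: "0 < card ?R" using R B by (simp add: card_gt_0_iff)
  have m0: "0 < m" using cm R0 m by simp
  have r1: "1 - r = card ?R / m" 
  proof -
    have "1 - r = (real m - real (card ?K)) / real m" using m0 by (simp add: r diff_divide_distrib)
    then show ?thesis using cm m by simp
  qed
  have rlt: "0 \<le> r" "r < 1" using r1 R0 m0 by (auto simp: r field_simps)
  define a where "a w = (\<Sum>i\<in>?K. \<zeta> (i, False) w) / sqrt m" for w
  define b where "b c w = (\<Sum>i\<in>?R. \<zeta> (i, c) w) / sqrt m" for c w
  have X: "(\<Sum>i\<in>B. \<zeta> (i, False) w) / sqrt m = a w + b False w" for w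
    unfolding a_def b_def add_divide_distrib[symmetric]
    by (subst BKR(1), subst sum.union_disjoint[OF BKR(3,4,2)]) simp
  have Y: "(\<Sum>i\<in>B. \<zeta> (i, \<not> \<kappa> i) w) / sqrt m = a w + b True w" for w
    unfolding a_def b_def add_divide_distrib[symmetric]
    by (subst BKR(1), subst sum.union_disjoint[OF BKR(3,4,2)]) simp
  have inds: "indep_vars (\<lambda>_. borel) (\<lambda>i. \<zeta> (i, c)) I" if "I \<subseteq> B" for I c
  proof -
    have "indep_vars (\<lambda>_. borel) \<zeta> ((\<lambda>i. (i, c)) ` I)"
      by (rule indep_vars_subset[OF ind]) (use that in auto)
    moreover have "inj_on (\<lambda>i. (i, c)) I" by (rule inj_onI) simp
    ultimately show ?thesis
      using indep_vars_reindex[where s = "\<lambda>i. (i, c)" and I = I and M' = "\<lambda>_. borel" and X = \<zeta>] by simp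
  qed
  have lb: "distributed M lborel (b c) (normal_density 0 (sqrt (1 - r)))" for c
    unfolding b_def r1 using m0 R N BKR by (intro scaled_sum_normal inds) auto
  have ibb: "indep_var borel (b False) borel (b True)"
  proof -
    let ?A = "?R \<times> {False}" and ?B = "?R \<times> {True}"
    have "indep_var (PiM ?A (\<lambda>_. borel)) (\<lambda>w. restrict (\<lambda>i. \<zeta> i w) ?A) (PiM ?B (\<lambda>_. borel)) (\<lambda>w. restrict (\<lambda>i. \<zeta> i w) ?B)"
      by (rule indep_var_restrict[OF ind]) auto
    then have "indep_var borel ((\<lambda>x. (\<Sum>i\<in>?R. x (i, False)) / sqrt m) \<circ> (\<lambda>w. restrict (\<lambda>i. \<zeta> i w) ?A))
        borel ((\<lambda>x. (\<Sum>i\<in>?R. x (i, True)) / sqrt m) \<circ> (\<lambda>w. restrict (\<lambda>i. \<zeta> i w) ?B))"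
      by (rule indep_var_compose) (auto intro!: borel_measurable_divide borel_measurable_sum measurable_component_singleton)
    moreover have "(\<lambda>x. (\<Sum>i\<in>?R. x (i, False)) / sqrt m) \<circ> (\<lambda>w. restrict (\<lambda>i. \<zeta> i w) ?A) = b False"
      "(\<lambda>x. (\<Sum>i\<in>?R. x (i, True)) / sqrt m) \<circ> (\<lambda>w. restrict (\<lambda>i. \<zeta> i w) ?B) = b True"
      by (auto simp: b_def fun_eq_iff intro!: arg_cong2[where f = "(/)"] sum.cong)
    ultimately show ?thesis by simp
  qed
  have [measurable]: "random_variable borel (b c)" for c
    using ibb by (cases c) (auto dest: indep_var_rv1 indep_var_rv2)
  let ?n = "normal_density 0 (sqrt (1 - r))"
  show ?thesis
  proof (cases "?K = {}")
    case True
    then have r0: "r = 0" and a0: "a = (\<lambda>_. 0)" 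
      unfolding r a_def[abs_def] True by simp_all
    have "(\<integral>\<^sup>+w. h (b False w, b True w) \<partial>M)
      = (\<integral>\<^sup>+x. \<integral>\<^sup>+y. h (x, y) \<partial>distr M borel (b True) \<partial>distr M borel (b False))"
      by (rule nn_integral_indep_var[OF ibb]) simp
    also have "\<dots> = (\<integral>\<^sup>+x. \<integral>\<^sup>+y. h (x, y) * ennreal (?n y) \<partial>lborel \<partial>distr M borel (b False))"
      by (subst nn_integral_distributed_borel[OF lb]) simp_all
    also have "distr M borel (b False) = gauss"
      by (rule distr_std_normal) (use lb[of False] r0 in simp)
    finally show ?thesis unfolding X Y by (simp add: a0 r0 mehler_0)
  next
    case False
    have rp: "0 < r" using False B m0 by (simp add: r card_gt_0_iff)
    have la: "distributed M lborel a (normal_density 0 (sqrt r))"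
      unfolding a_def r using m0 False N BKR by (intro scaled_sum_normal inds) auto
    have iab: "indep_var (borel \<Otimes>\<^sub>M borel) (\<lambda>w. (a w, 0 :: real)) (borel \<Otimes>\<^sub>M borel) (\<lambda>w. (b False w, b True w))"
    proof -
      let ?A = "?K \<times> {False}" and ?B = "?R \<times> UNIV"
      have "indep_var (PiM ?A (\<lambda>_. borel)) (\<lambda>w. restrict (\<lambda>i. \<zeta> i w) ?A) (PiM ?B (\<lambda>_. borel)) (\<lambda>w. restrict (\<lambda>i. \<zeta> i w) ?B)"
        by (rule indep_var_restrict[OF ind]) auto
      then have "indep_var (borel \<Otimes>\<^sub>M borel) ((\<lambda>x. ((\<Sum>i\<in>?K. x (i, False)) / sqrt m, 0 :: real)) \<circ> (\<lambda>w. restrict (\<lambda>i. \<zeta> i w) ?A))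
          (borel \<Otimes>\<^sub>M borel) ((\<lambda>x. ((\<Sum>i\<in>?R. x (i, False)) / sqrt m, (\<Sum>i\<in>?R. x (i, True)) / sqrt m)) \<circ> (\<lambda>w. restrict (\<lambda>i. \<zeta> i w) ?B))"
        by (rule indep_var_compose) (auto intro!: measurable_Pair borel_measurable_divide borel_measurable_sum measurable_component_singleton)
      moreover have "(\<lambda>x. ((\<Sum>i\<in>?K. x (i, False)) / sqrt m, 0 :: real)) \<circ> (\<lambda>w. restrict (\<lambda>i. \<zeta> i w) ?A) = (\<lambda>w. (a w, 0))"
        "(\<lambda>x. ((\<Sum>i\<in>?R. x (i, False)) / sqrt m, (\<Sum>i\<in>?R. x (i, True)) / sqrt m)) \<circ> (\<lambda>w. restrict (\<lambda>i. \<zeta> i w) ?B) = (\<lambda>w. (b False w, b True w))"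
        by (auto simp: a_def b_def fun_eq_iff intro!: arg_cong2[where f = "(/)"] sum.cong)
      ultimately show ?thesis by simp
    qed
    let ?na = "normal_density 0 (sqrt r)"
    have "(\<integral>\<^sup>+w. h (a w + b False w, a w + b True w) \<partial>M)
      = (\<integral>\<^sup>+w. (\<lambda>p. h (fst (fst p) + fst (snd p), fst (fst p) + snd (snd p))) ((a w, 0 :: real), (b False w, b True w)) \<partial>M)"
      by simp
    also have "\<dots> = (\<integral>\<^sup>+x. \<integral>\<^sup>+p. h (fst x + fst p, fst x + snd p) \<partial>distr M (borel \<Otimes>\<^sub>M borel) (\<lambda>w. (b False w, b True w))
        \<partial>distr M (borel \<Otimes>\<^sub>M borel) (\<lambda>w. (a w, 0 :: real)))"
      by (subst nn_integral_indep_var[OF iab]) simp_all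
    also have "\<dots> = (\<integral>\<^sup>+x. \<integral>\<^sup>+p. h (x + fst p, x + snd p) \<partial>distr M (borel \<Otimes>\<^sub>M borel) (\<lambda>w. (b False w, b True w)) \<partial>distr M borel a)"
    proof -
      have [measurable]: "random_variable borel a" by (rule distributed_measurable[OF la, simplified])
      interpret BB: prob_space "distr M (borel \<Otimes>\<^sub>M borel) (\<lambda>w. (b False w, b True w))"
        by (rule prob_space_distr) measurable
      show ?thesis by (subst (1 2) nn_integral_distr) simp_all
    qed
    also have "\<dots> = (\<integral>\<^sup>+x. (\<integral>\<^sup>+p. h (x + fst p, x + snd p) \<partial>distr M (borel \<Otimes>\<^sub>M borel) (\<lambda>w. (b False w, b True w))) * ennreal (?na x) \<partial>lborel)"
    proof -
      interpret BB: prob_space "distr M (borel \<Otimes>\<^sub>M borel) (\<lambda>w. (b False w, b True w))"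
        by (rule prob_space_distr) measurable
      show ?thesis by (subst nn_integral_distributed_borel[OF la]) simp_all
    qed
    also have "\<dots> = (\<integral>\<^sup>+t. (\<integral>\<^sup>+x. \<integral>\<^sup>+y. h (x, y) * ennreal (?n (y - t)) * ennreal (?n (x - t)) * ennreal (?na t) \<partial>lborel \<partial>lborel) \<partial>lborel)"
    proof (rule nn_integral_cong)
      fix t :: real
      have "(\<integral>\<^sup>+p. h (t + fst p, t + snd p) \<partial>distr M (borel \<Otimes>\<^sub>M borel) (\<lambda>w. (b False w, b True w)))
        = (\<integral>\<^sup>+w. (\<lambda>p. h (t + fst p, t + snd p)) (b False w, b True w) \<partial>M)"
        by (subst nn_integral_distr) simp_all
      also have "\<dots> = (\<integral>\<^sup>+x. \<integral>\<^sup>+y. h (t + x, t + y) \<partial>distr M borel (b True) \<partial>distr M borel (b False))"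
        by (subst nn_integral_indep_var[OF ibb]) simp_all
      also have "\<dots> = (\<integral>\<^sup>+x. (\<integral>\<^sup>+y. h (t + x, t + y) * ennreal (?n y) \<partial>lborel) * ennreal (?n x) \<partial>lborel)"
        by (subst (1 2) nn_integral_distributed_borel[OF lb]) simp_all
      also have "\<dots> = (\<integral>\<^sup>+x. (\<integral>\<^sup>+y. h (t + x, y) * ennreal (?n (y - t)) \<partial>lborel) * ennreal (?n x) \<partial>lborel)"
        by (subst nn_integral_lborel_shift[of _ t, symmetric]) simp_all
      also have "\<dots> = (\<integral>\<^sup>+x. (\<integral>\<^sup>+y. h (x, y) * ennreal (?n (y - t)) \<partial>lborel) * ennreal (?n (x - t)) \<partial>lborel)"
        by (subst (2) nn_integral_lborel_shift[of _ t, symmetric]) simp_all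
      finally show "(\<integral>\<^sup>+p. h (t + fst p, t + snd p) \<partial>distr M (borel \<Otimes>\<^sub>M borel) (\<lambda>w. (b False w, b True w))) * ennreal (?na t)
        = (\<integral>\<^sup>+x. \<integral>\<^sup>+y. h (x, y) * ennreal (?n (y - t)) * ennreal (?n (x - t)) * ennreal (?na t) \<partial>lborel \<partial>lborel)"
        by (simp add: nn_integral_multc)
    qed
    also have "\<dots> = (\<integral>\<^sup>+x. \<integral>\<^sup>+t. \<integral>\<^sup>+y. h (x, y) * ennreal (?n (y - t)) * ennreal (?n (x - t)) * ennreal (?na t) \<partial>lborel \<partial>lborel \<partial>lborel)"
      by (rule lborel_pair.Fubini') measurable
    also have "\<dots> = (\<integral>\<^sup>+x. \<integral>\<^sup>+y. \<integral>\<^sup>+t. h (x, y) * ennreal (?n (y - t)) * ennreal (?n (x - t)) * ennreal (?na t) \<partial>lborel \<partial>lborel \<partial>lborel)"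
      by (intro nn_integral_cong lborel_pair.Fubini') measurable
    also have "\<dots> = (\<integral>\<^sup>+x. \<integral>\<^sup>+y. h (x, y) * (ennreal (std_normal_density x) * ennreal (mehler r x y)) \<partial>lborel \<partial>lborel)"
    proof (intro nn_integral_cong)
      fix x y :: real
      have "(\<integral>\<^sup>+t. h (x, y) * ennreal (?n (y - t)) * ennreal (?n (x - t)) * ennreal (?na t) \<partial>lborel)
        = (\<integral>\<^sup>+t. h (x, y) * (ennreal (?na t) * (ennreal (?n (x - t)) * ennreal (?n (y - t)))) \<partial>lborel)"
        by (simp add: mult_ac)
      also have "\<dots> = h (x, y) * (ennreal (std_normal_density x) * ennreal (mehler r x y))"
        unfolding mehler_common_part[OF rp rlt(2), symmetric] by (rule nn_integral_cmult) measurable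
      finally show "(\<integral>\<^sup>+t. h (x, y) * ennreal (?n (y - t)) * ennreal (?n (x - t)) * ennreal (?na t) \<partial>lborel)
        = h (x, y) * (ennreal (std_normal_density x) * ennreal (mehler r x y))" .
    qed
    also have "\<dots> = (\<integral>\<^sup>+x. \<integral>\<^sup>+y. h (x, y) * ennreal (mehler r x y) \<partial>lborel \<partial>gauss)"
      by (subst nn_integral_gauss) (auto intro!: nn_integral_cong simp: nn_integral_cmult[symmetric] mult_ac)
    finally show ?thesis unfolding X Y .
  qed
qed

text \<open>Independent pairs, each with density given by Mehler's kernel, realize the noise operator.\<close>

lemma nn_integral_PiM_pairs:
  fixes \<mu> :: "nat \<Rightarrow> (real \<times> real) measure"
  assumes P: "\<And>k. prob_space (\<mu> k)" and S[measurable_cong]: "\<And>k. sets (\<mu> k) = sets (borel \<Otimes>\<^sub>M borel)"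
    and L: "\<And>k h. k < n \<Longrightarrow> h \<in> borel_measurable (borel \<Otimes>\<^sub>M borel) \<Longrightarrow>
      (\<integral>\<^sup>+p. h p \<partial>\<mu> k) = (\<integral>\<^sup>+x. \<integral>\<^sup>+y. h (x, y) * ennreal (mehler (r k) x y) \<partial>lborel \<partial>gauss)"
    and fg: "f \<in> borel_measurable seqs" "g \<in> borel_measurable seqs"
  shows "(\<integral>\<^sup>+z. f (\<lambda>k\<in>{..<n}. fst (z k)) * g (\<lambda>k\<in>{..<n}. snd (z k)) \<partial>PiM {..<n} \<mu>)
    = (\<integral>\<^sup>+x. f x * noise_op n r g x \<partial>gausses n)"
  using L fg
proof (induction n arbitrary: f g)
  case 0
  then show ?case by (simp add: nn_integral_gausses PiM_empty nn_integral_count_space_finite restrict_def)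
next
  case (Suc n)
  interpret P: product_sigma_finite \<mu> by (rule product_sigma_finite.intro) (rule prob_space_imp_sigma_finite[OF P])
  note [measurable] = Suc.prems(2,3)
  have mr: "(\<lambda>z. \<lambda>k\<in>{..<j}. c (z k)) \<in> measurable (PiM {..<j} \<mu>) seqs" if "c \<in> borel_measurable (borel \<Otimes>\<^sub>M borel)" for c :: "real \<times> real \<Rightarrow> real" and j
  proof -
    have "(\<lambda>z. \<lambda>k\<in>{..<j}. c (z k)) \<in> measurable (PiM {..<j} \<mu>) (PiM {..<j} (\<lambda>_. borel))"
    proof (rule measurable_restrict)
      fix i assume "i \<in> {..<j}"
      have "c \<in> borel_measurable (\<mu> i)" using that by measurable
      then show "(\<lambda>z. c (z i)) \<in> borel_measurable (PiM {..<j} \<mu>)"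
        using \<open>i \<in> {..<j}\<close> by (rule measurable_compose[OF measurable_component_singleton, rotated])
    qed
    then show ?thesis by (rule measurable_compose) (rule measurable_PiM_seqs, simp)
  qed
  have i: "{..<Suc n} = insert n {..<n}" by auto
  let ?h = "\<lambda>z. f (\<lambda>k\<in>{..<Suc n}. fst (z k)) * g (\<lambda>k\<in>{..<Suc n}. snd (z k))"
  let ?H = "\<lambda>u v. \<integral>\<^sup>+x. f (x(n := u)) * noise_op n r g (x(n := v)) \<partial>gausses n"
  have "(\<integral>\<^sup>+z. ?h z \<partial>PiM {..<Suc n} \<mu>) = (\<integral>\<^sup>+p. \<integral>\<^sup>+z. ?h (z(n := p)) \<partial>PiM {..<n} \<mu> \<partial>\<mu> n)"
    unfolding i
  proof (rule P.product_nn_integral_insert_rev)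
    have "?h \<in> borel_measurable (PiM {..<Suc n} \<mu>)"
      by (intro borel_measurable_times_ennreal measurable_compose[OF mr]) measurable
    then show "(\<lambda>z. f (\<lambda>k\<in>insert n {..<n}. fst (z k)) * g (\<lambda>k\<in>insert n {..<n}. snd (z k))) \<in> borel_measurable (PiM (insert n {..<n}) \<mu>)"
      unfolding i .
  qed auto
  also have "\<dots> = (\<integral>\<^sup>+p. ?H (fst p) (snd p) \<partial>\<mu> n)"
  proof (rule nn_integral_cong)
    fix p
    have e: "(\<lambda>k\<in>{..<Suc n}. c ((z(n := p)) k)) = (\<lambda>k\<in>{..<n}. c (z k))(n := c p)" for z and c :: "real \<times> real \<Rightarrow> real"
      by (auto simp: fun_eq_iff restrict_def)
    have "(\<integral>\<^sup>+z. ?h (z(n := p)) \<partial>PiM {..<n} \<mu>)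
      = (\<integral>\<^sup>+z. (\<lambda>x. f (x(n := fst p))) (\<lambda>k\<in>{..<n}. fst (z k)) * (\<lambda>x. g (x(n := snd p))) (\<lambda>k\<in>{..<n}. snd (z k)) \<partial>PiM {..<n} \<mu>)"
      unfolding e ..
    also have "\<dots> = (\<integral>\<^sup>+x. f (x(n := fst p)) * noise_op n r (\<lambda>x. g (x(n := snd p))) x \<partial>gausses n)"
    proof (rule Suc.IH)
      show "(\<lambda>x. f (x(n := fst p))) \<in> borel_measurable seqs" "(\<lambda>x. g (x(n := snd p))) \<in> borel_measurable seqs" by measurable
    qed (use Suc.prems(1) in auto)
    finally show "(\<integral>\<^sup>+z. ?h (z(n := p)) \<partial>PiM {..<n} \<mu>) = ?H (fst p) (snd p)"
      by (simp add: noise_op_upd)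
  qed
  also have "\<dots> = (\<integral>\<^sup>+u. \<integral>\<^sup>+v. ?H u v * ennreal (mehler (r n) u v) \<partial>lborel \<partial>gauss)"
    by (subst Suc.prems(1)) simp_all
  also have "\<dots> = (\<integral>\<^sup>+u. \<integral>\<^sup>+v. \<integral>\<^sup>+x. f (x(n := u)) * (noise_op n r g (x(n := v)) * ennreal (mehler (r n) u v)) \<partial>gausses n \<partial>lborel \<partial>gauss)"
    by (subst nn_integral_multc[symmetric]) (simp_all add: mult.assoc)
  also have "\<dots> = (\<integral>\<^sup>+u. \<integral>\<^sup>+x. \<integral>\<^sup>+v. f (x(n := u)) * (noise_op n r g (x(n := v)) * ennreal (mehler (r n) u v)) \<partial>lborel \<partial>gausses n \<partial>gauss)"
  proof (rule nn_integral_cong)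
    fix u
    interpret Q: pair_sigma_finite "gausses n" lborel ..
    show "(\<integral>\<^sup>+v. \<integral>\<^sup>+x. f (x(n := u)) * (noise_op n r g (x(n := v)) * ennreal (mehler (r n) u v)) \<partial>gausses n \<partial>lborel)
      = (\<integral>\<^sup>+x. \<integral>\<^sup>+v. f (x(n := u)) * (noise_op n r g (x(n := v)) * ennreal (mehler (r n) u v)) \<partial>lborel \<partial>gausses n)"
      by (rule Q.Fubini') measurable
  qed
  also have "\<dots> = (\<integral>\<^sup>+u. \<integral>\<^sup>+x. f (x(n := u)) * coord_op n (r n) (noise_op n r g) (x(n := u)) \<partial>gausses n \<partial>gauss)"
  proof (intro nn_integral_cong)
    fix u x
    have [measurable]: "(\<lambda>v. noise_op n r g (x(n := v))) \<in> borel_measurable borel"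
      by (rule measurable_section) measurable
    show "(\<integral>\<^sup>+v. f (x(n := u)) * (noise_op n r g (x(n := v)) * ennreal (mehler (r n) u v)) \<partial>lborel)
      = f (x(n := u)) * coord_op n (r n) (noise_op n r g) (x(n := u))"
      unfolding coord_op_upd_same mehler_op_def by (rule nn_integral_cmult) measurable
  qed
  also have "\<dots> = (\<integral>\<^sup>+x. f x * noise_op (Suc n) r g x \<partial>gausses (Suc n))"
    by (subst nn_integral_gausses_Suc) simp_all
  finally show ?case .
qed

text \<open>The second process replaces the increments on the cells outside \<open>\<kappa>\<close> by independent copies
  (index \<open>True\<close>); the correlation of two block sums is the fraction of common summands.\<close>

theorem (in prob_space) block_sums_noise_op:
  fixes \<zeta> :: "nat \<times> bool \<Rightarrow> 'a \<Rightarrow> real" and \<kappa> :: "nat \<Rightarrow> bool" and n m :: nat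
  assumes ind: "indep_vars (\<lambda>_. borel) \<zeta> ({..<n * m} \<times> UNIV)"
    and N: "\<And>p. p \<in> {..<n * m} \<times> UNIV \<Longrightarrow> distributed M lborel (\<zeta> p) std_normal_density"
    and R: "\<And>k. k < n \<Longrightarrow> \<exists>i\<in>{k * m..<k * m + m}. \<not> \<kappa> i"
    and r: "\<And>k. k < n \<Longrightarrow> r k = card {i\<in>{k * m..<k * m + m}. \<kappa> i} / real m"
    and fg: "f \<in> borel_measurable seqs" "g \<in> borel_measurable seqs"
  shows "(\<integral>\<^sup>+w. f (\<lambda>k\<in>{..<n}. (\<Sum>i\<in>{k * m..<k * m + m}. \<zeta> (i, False) w) / sqrt m)
      * g (\<lambda>k\<in>{..<n}. (\<Sum>i\<in>{k * m..<k * m + m}. \<zeta> (i, \<not> \<kappa> i) w) / sqrt m) \<partial>M)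
    = (\<integral>\<^sup>+x. f x * noise_op n r g x \<partial>gausses n)"
proof (cases "n = 0")
  case True
  then show ?thesis using fg
    by (simp add: nn_integral_gausses PiM_empty nn_integral_count_space_finite restrict_def emeasure_space_1)
next
  case False
  let ?B = "\<lambda>k. {k * m..<k * m + m}"
  have Bsub: "?B k \<subseteq> {..<n * m}" if "k < n" for k
  proof -
    have "Suc k * m \<le> n * m" using that by (intro mult_le_mono1) auto
    then show ?thesis by auto
  qed
  define c where "c k x = ((\<Sum>i\<in>?B k. x (i, False)) / sqrt m, (\<Sum>i\<in>?B k. x (i, \<not> \<kappa> i)) / sqrt m)" for k and x :: "nat \<times> bool \<Rightarrow> real"
  define Z where "Z k w = c k (\<lambda>p. \<zeta> p w)" for k w
  have indZ: "indep_vars (\<lambda>_. borel \<Otimes>\<^sub>M borel) Z {..<n}"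
  proof -
    have "indep_vars (\<lambda>k. PiM (?B k \<times> UNIV) (\<lambda>_. borel)) (\<lambda>k w. restrict (\<lambda>p. \<zeta> p w) (?B k \<times> UNIV)) {..<n}"
    proof (rule indep_vars_restrict[OF ind])
      show "?B k \<times> UNIV \<subseteq> {..<n * m} \<times> UNIV" if "k \<in> {..<n}" for k using Bsub that by auto
      have "k = k'" if "i \<in> ?B k" "i \<in> ?B k'" for i k k'
      proof -
        have "i div m = k" "i div m = k'" using that by (auto intro!: div_nat_eqI simp: mult.commute)
        then show ?thesis by simp
      qed
      then show "disjoint_family_on (\<lambda>k. ?B k \<times> (UNIV :: bool set)) {..<n}"
        unfolding disjoint_family_on_def by blast
    qed
    then have "indep_vars (\<lambda>_. borel \<Otimes>\<^sub>M borel) (\<lambda>k w. c k (restrict (\<lambda>p. \<zeta> p w) (?B k \<times> UNIV))) {..<n}"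
      by (rule indep_vars_compose2)
        (auto simp: c_def intro!: measurable_Pair borel_measurable_divide borel_measurable_sum measurable_component_singleton)
    moreover have "c k (restrict (\<lambda>p. \<zeta> p w) (?B k \<times> UNIV)) = Z k w" for k w
      by (auto simp: Z_def c_def intro!: arg_cong2[where f = "(/)"] sum.cong)
    ultimately show ?thesis by simp
  qed
  then have rvZ: "Z k \<in> measurable M (borel \<Otimes>\<^sub>M borel)" if "k < n" for k
    using that unfolding indep_vars_def by auto
  define \<mu> where "\<mu> k = (if k < n then distr M (borel \<Otimes>\<^sub>M borel) (Z k) else distr M (borel \<Otimes>\<^sub>M borel) (Z 0))" for k
  have P: "prob_space (\<mu> k)" for k
    unfolding \<mu>_def using rvZ False by (auto intro: prob_space_distr)
  have S: "sets (\<mu> k) = sets (borel \<Otimes>\<^sub>M borel)" for k by (simp add: \<mu>_def)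
  have "distr M (PiM {..<n} (\<lambda>_. borel \<Otimes>\<^sub>M borel)) (\<lambda>w. \<lambda>k\<in>{..<n}. Z k w) = PiM {..<n} (\<lambda>i. distr M (borel \<Otimes>\<^sub>M borel) (Z i))"
    using indep_vars_iff_distr_eq_PiM'[where I = "{..<n}" and M' = "\<lambda>_. borel \<Otimes>\<^sub>M borel" and X = Z] indZ rvZ False by auto
  also have "\<dots> = PiM {..<n} \<mu>" by (rule PiM_cong) (auto simp: \<mu>_def)
  finally have d: "distr M (PiM {..<n} (\<lambda>_. borel \<Otimes>\<^sub>M borel)) (\<lambda>w. \<lambda>k\<in>{..<n}. Z k w) = PiM {..<n} \<mu>" .
  have L: "(\<integral>\<^sup>+p. h p \<partial>\<mu> k) = (\<integral>\<^sup>+x. \<integral>\<^sup>+y. h (x, y) * ennreal (mehler (r k) x y) \<partial>lborel \<partial>gauss)"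
    if k: "k < n" and h: "h \<in> borel_measurable (borel \<Otimes>\<^sub>M borel)" for k h
  proof -
    have "(\<integral>\<^sup>+p. h p \<partial>\<mu> k) = (\<integral>\<^sup>+w. h (Z k w) \<partial>M)"
      using k h rvZ by (simp add: \<mu>_def nn_integral_distr)
    also have "\<dots> = (\<integral>\<^sup>+x. \<integral>\<^sup>+y. h (x, y) * ennreal (mehler (r k) x y) \<partial>lborel \<partial>gauss)"
      unfolding Z_def c_def
      by (rule shared_sum_pair_law[OF _ indep_vars_subset[OF ind] _ _ _ _ h])
         (use R[OF k] r[OF k] Bsub[OF k] in \<open>auto intro!: N\<close>)
    finally show ?thesis .
  qed
  have mr: "(\<lambda>z. \<lambda>k\<in>{..<n}. c (z k)) \<in> measurable (PiM {..<n} (\<lambda>_. borel \<Otimes>\<^sub>M borel)) seqs" if "c \<in> borel_measurable (borel \<Otimes>\<^sub>M borel)" for c :: "real \<times> real \<Rightarrow> real"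
  proof -
    have "(\<lambda>z. \<lambda>k\<in>{..<n}. c (z k)) \<in> measurable (PiM {..<n} (\<lambda>_. borel \<Otimes>\<^sub>M borel)) (PiM {..<n} (\<lambda>_. borel))"
      using that by (intro measurable_restrict measurable_compose[OF measurable_component_singleton]) auto
    then show ?thesis by (rule measurable_compose) (rule measurable_PiM_seqs, simp)
  qed
  have "(\<integral>\<^sup>+w. f (\<lambda>k\<in>{..<n}. fst (Z k w)) * g (\<lambda>k\<in>{..<n}. snd (Z k w)) \<partial>M)
    = (\<integral>\<^sup>+w. (\<lambda>z. f (\<lambda>k\<in>{..<n}. fst (z k)) * g (\<lambda>k\<in>{..<n}. snd (z k))) (\<lambda>k\<in>{..<n}. Z k w) \<partial>M)"
    by (intro nn_integral_cong arg_cong2[where f = "(*)"] arg_cong[where f = f] arg_cong[where f = g]) auto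
  also have "\<dots> = (\<integral>\<^sup>+z. f (\<lambda>k\<in>{..<n}. fst (z k)) * g (\<lambda>k\<in>{..<n}. snd (z k)) \<partial>PiM {..<n} \<mu>)"
  proof -
    have "(\<lambda>w. \<lambda>k\<in>{..<n}. Z k w) \<in> measurable M (PiM {..<n} (\<lambda>_. borel \<Otimes>\<^sub>M borel))"
      using rvZ by (intro measurable_restrict) auto
    moreover have "(\<lambda>z. f (\<lambda>k\<in>{..<n}. fst (z k)) * g (\<lambda>k\<in>{..<n}. snd (z k))) \<in> borel_measurable (PiM {..<n} (\<lambda>_. borel \<Otimes>\<^sub>M borel))"
      using fg by (intro borel_measurable_times_ennreal measurable_compose[OF mr]) auto
    ultimately show ?thesis
      unfolding d[symmetric] by (subst nn_integral_distr) auto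
  qed
  also have "\<dots> = (\<integral>\<^sup>+x. f x * noise_op n r g x \<partial>gausses n)"
    by (rule nn_integral_PiM_pairs[OF P S L fg])
  finally show ?thesis by (simp add: Z_def c_def)
qed

section \<open>Approximation of the mixed process by patched paths\<close>

lemma two_sided_BM_D:
  assumes "two_sided_BM M B"
  shows "prob_space M" "\<And>t. (\<lambda>w. B w t) \<in> borel_measurable M" "\<And>w. w \<in> space M \<Longrightarrow> B w 0 = 0"
    "\<And>w. w \<in> space M \<Longrightarrow> continuous_on UNIV (B w)"
    "\<And>s t. s < t \<Longrightarrow> distributed M lborel (\<lambda>w. B w t - B w s) (normal_density 0 (sqrt (t - s)))"
    "\<And>(t :: nat \<Rightarrow> real) n. mono t \<Longrightarrow> prob_space.indep_vars M (\<lambda>_. borel) (\<lambda>i w. B w (t (Suc i)) - B w (t i)) {..<n}"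
  using assms unfolding two_sided_BM_def by auto

lemma BM_increment_square:
  assumes BM: "two_sided_BM M B"
  shows "integrable M (\<lambda>w. (B w t - B w s)\<^sup>2)" "(\<integral>w. (B w t - B w s)\<^sup>2 \<partial>M) = \<bar>t - s\<bar>"
proof -
  interpret prob_space M by (rule two_sided_BM_D(1)[OF BM])
  have *: "integrable M (\<lambda>w. (B w t - B w s)\<^sup>2) \<and> (\<integral>w. (B w t - B w s)\<^sup>2 \<partial>M) = t - s" if st: "s < t" for s t
  proof -
    note D = two_sided_BM_D(5)[OF BM st]
    have "integrable lborel (\<lambda>x. normal_density 0 (sqrt (t - s)) x * x\<^sup>2)"
      using integrable_normal_moment[of "sqrt (t - s)" 0 2] st by simp
    then have 1: "integrable M (\<lambda>w. (B w t - B w s)\<^sup>2)"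
      by (subst distributed_integrable[OF D, symmetric]) auto
    have "(\<integral>w. (B w t - B w s)\<^sup>2 \<partial>M) = (\<integral>x. normal_density 0 (sqrt (t - s)) x * x\<^sup>2 \<partial>lborel)"
      by (rule distributed_integral[OF D, symmetric]) auto
    also have "\<dots> = t - s"
      using integral_normal_moment_even[of "sqrt (t - s)" 0 1] st by simp
    finally show ?thesis using 1 by simp
  qed
  consider "s < t" | "t < s" | "s = t" by linarith
  then have "integrable M (\<lambda>w. (B w t - B w s)\<^sup>2) \<and> (\<integral>w. (B w t - B w s)\<^sup>2 \<partial>M) = \<bar>t - s\<bar>"
  proof cases
    case 1 then show ?thesis using *[of s t] by simp
  next
    case 2 then show ?thesis using *[of t s] by (simp add: power2_commute)
  qed simp
  then show "integrable M (\<lambda>w. (B w t - B w s)\<^sup>2)" "(\<integral>w. (B w t - B w s)\<^sup>2 \<partial>M) = \<bar>t - s\<bar>" by auto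
qed

text \<open>Polarization reduces the covariance of two increments to four variances, whatever the relative
  position of the two intervals.\<close>

lemma BM_increment_product:
  assumes BM: "two_sided_BM M B"
  shows "integrable M (\<lambda>w. (B w b - B w a) * (B w d - B w c))"
    and "(\<integral>w. (B w b - B w a) * (B w d - B w c) \<partial>M) = (\<bar>b - c\<bar> + \<bar>a - d\<bar> - \<bar>b - d\<bar> - \<bar>a - c\<bar>) / 2"
proof -
  have e: "(\<lambda>w. (B w b - B w a) * (B w d - B w c)) = (\<lambda>w. ((B w b - B w c)\<^sup>2 + (B w a - B w d)\<^sup>2 - (B w b - B w d)\<^sup>2 - (B w a - B w c)\<^sup>2) / 2)"
    by (rule ext) (simp add: power2_eq_square field_simps)
  note I = BM_increment_square[OF BM]
  show "integrable M (\<lambda>w. (B w b - B w a) * (B w d - B w c))"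
    unfolding e using I(1) by simp
  show "(\<integral>w. (B w b - B w a) * (B w d - B w c) \<partial>M) = (\<bar>b - c\<bar> + \<bar>a - d\<bar> - \<bar>b - d\<bar> - \<bar>a - c\<bar>) / 2"
    unfolding e using I(1) by (simp add: I(2))
qed

lemma lebesgue_indicator_product:
  assumes "a \<le> b" "c \<le> d"
  shows "integrable lebesgue (\<lambda>x. indicator {a<..b} x * indicator {c<..d} x :: real)"
    and "(\<integral>x. indicator {a<..b} x * indicator {c<..d} x \<partial>lebesgue) = (\<bar>b - c\<bar> + \<bar>a - d\<bar> - \<bar>b - d\<bar> - \<bar>a - c\<bar>) / (2::real)"
proof -
  let ?I = "{max a c<..min b d}"
  have e: "(\<lambda>x. indicator {a<..b} x * indicator {c<..d} x :: real) = indicator ?I"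
    by (auto simp: fun_eq_iff indicator_def)
  have m: "?I \<in> lmeasurable" using fmeasurable_cbox by (intro bounded_set_imp_lmeasurable) auto
  show "integrable lebesgue (\<lambda>x. indicator {a<..b} x * indicator {c<..d} x :: real)"
    unfolding e using m by (simp add: integrable_indicator_iff fmeasurable_def)
  have "measure lebesgue ?I = (if max a c \<le> min b d then min b d - max a c else 0)"
    by (auto simp: measure_lborel_Ioc)
  then show "(\<integral>x. indicator {a<..b} x * indicator {c<..d} x \<partial>lebesgue) = (\<bar>b - c\<bar> + \<bar>a - d\<bar> - \<bar>b - d\<bar> - \<bar>a - c\<bar>) / (2::real)"
    unfolding e using m assms by (simp add: max_def min_def abs_if)
qed

lemma step_Nil[simp]: "step_fun [] x = 0" "step_integral [] v = 0" "step_list []"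
  by (auto simp: step_fun_def step_integral_def step_list_def)

lemma step_Cons[simp]:
  "step_fun ((c, a, b) # p) x = c * indicator {a<..b} x + step_fun p x"
  "step_integral ((c, a, b) # p) v = c * (v b - v a) + step_integral p v"
  "step_list ((c, a, b) # p) \<longleftrightarrow> a \<le> b \<and> step_list p"
  by (auto simp: step_fun_def step_integral_def step_list_def)

lemma step_fun_measurable[measurable]: "step_fun p \<in> borel_measurable lebesgue"
proof (induction p)
  case (Cons z p)
  obtain c a b where "z = (c, a, b)" by (cases z)
  then show ?case using Cons
    by (auto simp: step_Cons(1)[abs_def] intro!: borel_measurable_add borel_measurable_times borel_measurable_indicator)
qed (simp add: step_Nil(1)[abs_def])

lemma step_integral_measurable:
  assumes "\<And>t. (\<lambda>w. B w t) \<in> borel_measurable M"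
  shows "(\<lambda>w. step_integral p (B w)) \<in> borel_measurable M"
proof (induction p)
  case (Cons z p)
  obtain c a b where "z = (c, a, b)" by (cases z)
  then show ?case using Cons assms by simp
qed simp

lemma step_isometry_product:
  assumes BM: "two_sided_BM M B" and "step_list p" "step_list q"
  shows "integrable M (\<lambda>w. step_integral p (B w) * step_integral q (B w)) \<and>
    integrable lebesgue (\<lambda>x. step_fun p x * step_fun q x) \<and>
    (\<integral>w. step_integral p (B w) * step_integral q (B w) \<partial>M) = (\<integral>x. step_fun p x * step_fun q x \<partial>lebesgue)"
  using assms(2)
proof (induction p)
  case (Cons z p)
  obtain c a b where z: "z = (c, a, b)" by (cases z)
  have ab: "a \<le> b" and p: "step_list p" using Cons.prems by (auto simp: z)
  have q: "integrable M (\<lambda>w. (B w b - B w a) * step_integral q (B w)) \<and>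
    integrable lebesgue (\<lambda>x. indicator {a<..b} x * step_fun q x) \<and>
    (\<integral>w. (B w b - B w a) * step_integral q (B w) \<partial>M) = (\<integral>x. indicator {a<..b} x * step_fun q x \<partial>lebesgue)"
    using assms(3)
  proof (induction q)
    case (Cons z q)
    obtain c' a' b' where z': "z = (c', a', b')" by (cases z)
    have ab': "a' \<le> b'" and q: "step_list q" using Cons.prems by (auto simp: z')
    note IH = Cons.IH[OF q]
    have 1: "(\<lambda>w. (B w b - B w a) * step_integral (z # q) (B w))
      = (\<lambda>w. c' * ((B w b - B w a) * (B w b' - B w a')) + (B w b - B w a) * step_integral q (B w))"
      by (auto simp: z' algebra_simps)
    have 2: "(\<lambda>x. indicator {a<..b} x * step_fun (z # q) x)
      = (\<lambda>x. c' * (indicator {a<..b} x * indicator {a'<..b'} x) + indicator {a<..b} x * step_fun q x)"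
      by (auto simp: z' algebra_simps)
    show ?case unfolding 1 2
      using IH BM_increment_product[OF BM, of b a b' a'] lebesgue_indicator_product[OF ab ab'] by simp
  qed simp
  note IH = Cons.IH[OF p]
  have 1: "(\<lambda>w. step_integral (z # p) (B w) * step_integral q (B w))
    = (\<lambda>w. c * ((B w b - B w a) * step_integral q (B w)) + step_integral p (B w) * step_integral q (B w))"
    by (auto simp: z algebra_simps)
  have 2: "(\<lambda>x. step_fun (z # p) x * step_fun q x)
    = (\<lambda>x. c * (indicator {a<..b} x * step_fun q x) + step_fun p x * step_fun q x)"
    by (auto simp: z algebra_simps)
  show ?case unfolding 1 2 using IH q by simp
qed simp

lemma step_isometry:
  assumes BM: "two_sided_BM M B" and p: "step_list p" "step_list q"
  shows "(\<integral>\<^sup>+w. ennreal ((step_integral p (B w) - step_integral q (B w))\<^sup>2) \<partial>M)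
    = (\<integral>\<^sup>+x. ennreal ((step_fun p x - step_fun q x)\<^sup>2) \<partial>lebesgue)"
proof -
  note I = step_isometry_product[OF BM]
  have 1: "(\<lambda>w. (step_integral p (B w) - step_integral q (B w))\<^sup>2) = (\<lambda>w. step_integral p (B w) * step_integral p (B w)
      - 2 * (step_integral p (B w) * step_integral q (B w)) + step_integral q (B w) * step_integral q (B w))"
    by (auto simp: power2_eq_square algebra_simps)
  have 2: "(\<lambda>x. (step_fun p x - step_fun q x)\<^sup>2) = (\<lambda>x. step_fun p x * step_fun p x
      - 2 * (step_fun p x * step_fun q x) + step_fun q x * step_fun q x)"
    by (auto simp: power2_eq_square algebra_simps)
  have i1: "integrable M (\<lambda>w. (step_integral p (B w) - step_integral q (B w))\<^sup>2)"
    unfolding 1 using I[OF p(1) p(1)] I[OF p] I[OF p(2) p(2)] by simp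
  have i2: "integrable lebesgue (\<lambda>x. (step_fun p x - step_fun q x)\<^sup>2)"
    unfolding 2 using I[OF p(1) p(1)] I[OF p] I[OF p(2) p(2)] by simp
  have "(\<integral>w. (step_integral p (B w) - step_integral q (B w))\<^sup>2 \<partial>M) = (\<integral>x. (step_fun p x - step_fun q x)\<^sup>2 \<partial>lebesgue)"
    unfolding 1 2 using I[OF p(1) p(1)] I[OF p] I[OF p(2) p(2)] by simp
  then show ?thesis using i1 i2 by (simp add: nn_integral_eq_integral)
qed

lemma ennreal_square_add_le: "ennreal ((x + y)\<^sup>2) \<le> 2 * ennreal (x\<^sup>2) + 2 * ennreal (y\<^sup>2)"
proof -
  have "(x + y)\<^sup>2 \<le> 2 * x\<^sup>2 + 2 * y\<^sup>2"
    using sum_squares_bound[of x y] by (simp add: power2_sum)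
  then have "ennreal ((x + y)\<^sup>2) \<le> ennreal (2 * x\<^sup>2 + 2 * y\<^sup>2)" by (rule ennreal_leI)
  then show ?thesis by (simp add: ennreal_plus ennreal_mult)
qed

lemma nn_integral_square_add_le:
  fixes f g :: "'a \<Rightarrow> real"
  assumes [measurable]: "f \<in> borel_measurable M" "g \<in> borel_measurable M"
  shows "(\<integral>\<^sup>+x. ennreal ((f x + g x)\<^sup>2) \<partial>M) \<le> 2 * (\<integral>\<^sup>+x. ennreal ((f x)\<^sup>2) \<partial>M) + 2 * (\<integral>\<^sup>+x. ennreal ((g x)\<^sup>2) \<partial>M)"
proof -
  have "(\<integral>\<^sup>+x. ennreal ((f x + g x)\<^sup>2) \<partial>M) \<le> (\<integral>\<^sup>+x. 2 * ennreal ((f x)\<^sup>2) + 2 * ennreal ((g x)\<^sup>2) \<partial>M)"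
    by (intro nn_integral_mono ennreal_square_add_le)
  also have "\<dots> = 2 * (\<integral>\<^sup>+x. ennreal ((f x)\<^sup>2) \<partial>M) + 2 * (\<integral>\<^sup>+x. ennreal ((g x)\<^sup>2) \<partial>M)"
    by (simp add: nn_integral_add nn_integral_cmult)
  finally show ?thesis .
qed

text \<open>The isometry is known between step functions only; passing through an approximating sequence
  costs the factor \<open>4\<close>.\<close>

lemma wiener_integral_step_error:
  assumes BM: "two_sided_BM M B" and X: "has_wiener_integral M B f X" and q: "step_list q"
  shows "(\<integral>\<^sup>+w. ennreal ((X w - step_integral q (B w))\<^sup>2) \<partial>M)
    \<le> 4 * (\<integral>\<^sup>+x. ennreal ((f x - step_fun q x)\<^sup>2) \<partial>lebesgue)"
proof -
  have [measurable]: "f \<in> borel_measurable lebesgue" "X \<in> borel_measurable M"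
    using X by (auto simp: has_wiener_integral_def)
  note [measurable] = step_integral_measurable[OF two_sided_BM_D(2)[OF BM]]
  obtain p where p: "\<And>n. step_list (p n)"
    "(\<lambda>n. \<integral>\<^sup>+ x. ennreal ((f x - step_fun (p n) x)\<^sup>2) \<partial>lebesgue) \<longlonglongrightarrow> 0"
    "(\<lambda>n. \<integral>\<^sup>+ w. ennreal ((X w - step_integral (p n) (B w))\<^sup>2) \<partial>M) \<longlonglongrightarrow> 0"
    using X unfolding has_wiener_integral_def by blast
  let ?c = "\<integral>\<^sup>+x. ennreal ((f x - step_fun q x)\<^sup>2) \<partial>lebesgue"
  let ?a = "\<lambda>n. \<integral>\<^sup>+ w. ennreal ((X w - step_integral (p n) (B w))\<^sup>2) \<partial>M"
  let ?b = "\<lambda>n. \<integral>\<^sup>+ x. ennreal ((f x - step_fun (p n) x)\<^sup>2) \<partial>lebesgue"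
  have "(\<integral>\<^sup>+w. ennreal ((X w - step_integral q (B w))\<^sup>2) \<partial>M) \<le> 2 * ?a n + 2 * (2 * ?b n + 2 * ?c)" for n
  proof -
    have "(\<integral>\<^sup>+w. ennreal ((X w - step_integral q (B w))\<^sup>2) \<partial>M)
      = (\<integral>\<^sup>+w. ennreal (((X w - step_integral (p n) (B w)) + (step_integral (p n) (B w) - step_integral q (B w)))\<^sup>2) \<partial>M)"
      by simp
    also have "\<dots> \<le> 2 * ?a n + 2 * (\<integral>\<^sup>+w. ennreal ((step_integral (p n) (B w) - step_integral q (B w))\<^sup>2) \<partial>M)"
      by (rule nn_integral_square_add_le) measurable
    also have "(\<integral>\<^sup>+w. ennreal ((step_integral (p n) (B w) - step_integral q (B w))\<^sup>2) \<partial>M)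
      = (\<integral>\<^sup>+x. ennreal (((step_fun (p n) x - f x) + (f x - step_fun q x))\<^sup>2) \<partial>lebesgue)"
      by (simp add: step_isometry[OF BM p(1) q])
    also have "\<dots> \<le> 2 * (\<integral>\<^sup>+x. ennreal ((step_fun (p n) x - f x)\<^sup>2) \<partial>lebesgue) + 2 * ?c"
      by (rule nn_integral_square_add_le) measurable
    also have "(\<integral>\<^sup>+x. ennreal ((step_fun (p n) x - f x)\<^sup>2) \<partial>lebesgue) = ?b n"
      by (simp add: power2_commute)
    finally show ?thesis by (simp add: add_left_mono mult_left_mono)
  qed
  moreover have "(\<lambda>n. 2 * ?a n + 2 * (2 * ?b n + 2 * ?c)) \<longlonglongrightarrow> 2 * 0 + 2 * (2 * 0 + 2 * ?c)"
    by (intro tendsto_add ennreal_tendsto_cmult tendsto_const p) auto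
  ultimately have "(\<integral>\<^sup>+w. ennreal ((X w - step_integral q (B w))\<^sup>2) \<partial>M) \<le> 2 * 0 + 2 * (2 * 0 + 2 * ?c)"
    by (intro LIMSEQ_le_const) auto
  then show ?thesis by (simp add: mult.assoc[symmetric])
qed

definition cell_steps :: "nat \<Rightarrow> (nat \<Rightarrow> bool) \<Rightarrow> nat \<Rightarrow> (real \<times> real \<times> real) list" where
  "cell_steps L \<kappa> j = map (\<lambda>i. (1, real i / real L, real (Suc i) / real L)) (filter \<kappa> [0..<j])"

text \<open>Cells are half-open on the left, like the intervals of step functions, so \<open>x > 0\<close> lies in the cell
  \<open>(i/L, (i+1)/L]\<close> for this \<open>i\<close>.\<close>

definition cell_index :: "nat \<Rightarrow> real \<Rightarrow> nat" where
  "cell_index L x = nat (\<lceil>x * real L\<rceil> - 1)"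

lemma cell_index_iff:
  assumes "0 < L" "0 < x"
  shows "cell_index L x = i \<longleftrightarrow> real i / real L < x \<and> x \<le> real (Suc i) / real L"
proof -
  have "0 < x * real L" using assms by simp
  then have c: "1 \<le> \<lceil>x * real L\<rceil>" by (simp add: le_ceiling_iff)
  have "cell_index L x = i \<longleftrightarrow> \<lceil>x * real L\<rceil> = int i + 1"
    unfolding cell_index_def using c by auto
  also have "\<dots> \<longleftrightarrow> real i < x * real L \<and> x * real L \<le> real i + 1"
    by (simp add: ceiling_eq_iff)
  also have "\<dots> \<longleftrightarrow> real i / real L < x \<and> x \<le> real (Suc i) / real L"
    using assms by (simp add: divide_less_eq le_divide_eq add.commute)
  finally show ?thesis .
qed

lemma step_list_cell_steps: "step_list (cell_steps L \<kappa> j)"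
  by (auto simp: step_list_def cell_steps_def divide_right_mono)

lemma step_integral_cell_steps:
  "step_integral (cell_steps L \<kappa> j) v = (\<Sum>i<j. if \<kappa> i then v (real (Suc i) / real L) - v (real i / real L) else 0)"
  by (induction j) (auto simp: cell_steps_def step_integral_def)

lemma step_fun_cell_steps:
  assumes "0 < L"
  shows "step_fun (cell_steps L \<kappa> j) x = (if 0 < x \<and> x \<le> real j / real L \<and> \<kappa> (cell_index L x) then 1 else 0)"
proof -
  have e: "step_fun (cell_steps L \<kappa> j) x = (\<Sum>i<j. if \<kappa> i then indicator {real i / real L<..real (Suc i) / real L} x else 0)"
    by (induction j) (auto simp: cell_steps_def step_fun_def)
  show ?thesis
  proof (cases "0 < x")
    case True
    have "indicator {real i / real L<..real (Suc i) / real L} x = (if i = cell_index L x then 1 else 0 :: real)" for i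
      using cell_index_iff[OF assms True, of i] by (auto simp: indicator_def)
    then have "step_fun (cell_steps L \<kappa> j) x = (\<Sum>i<j. if i = cell_index L x then (if \<kappa> i then 1 else 0) else 0)"
      unfolding e by (intro sum.cong) auto
    also have "\<dots> = (if cell_index L x < j \<and> \<kappa> (cell_index L x) then 1 else 0)"
      by (simp add: sum.delta)
    also have "cell_index L x < j \<longleftrightarrow> x \<le> real j / real L"
    proof -
      let ?i = "cell_index L x"
      have i: "real ?i / real L < x" "x \<le> real (Suc ?i) / real L" using cell_index_iff[OF assms True, of ?i] by auto
      show ?thesis
      proof
        assume "?i < j"
        then have "real (Suc ?i) / real L \<le> real j / real L" by (intro divide_right_mono) auto
        with i show "x \<le> real j / real L" by linarith
      next
        assume "x \<le> real j / real L"
        with i have "real ?i / real L < real j / real L" by linarith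
        then show "?i < j" using assms by (simp add: divide_less_cancel)
      qed
    qed
    finally show ?thesis using True by simp
  next
    case False
    have "indicator {real i / real L<..real (Suc i) / real L} x = (0 :: real)" for i
    proof -
      have "0 \<le> real i / real L" by simp
      with False have "\<not> real i / real L < x" by linarith
      then show ?thesis by (simp add: indicator_def)
    qed
    then have "step_fun (cell_steps L \<kappa> j) x = 0" unfolding e by (intro sum.neutral) auto
    then show ?thesis using False by simp
  qed
qed

definition cell_error :: "real set \<Rightarrow> nat \<Rightarrow> (nat \<Rightarrow> bool) \<Rightarrow> real set" where
  "cell_error E L \<kappa> = {x\<in>{0<..1}. (x \<in> E) \<noteq> \<kappa> (cell_index L x)}"

lemma integrand_cell_error:
  assumes L: "0 < L" and j: "j \<le> L" and E: "cell_error E L \<kappa> \<in> sets lebesgue"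
  shows "(\<integral>\<^sup>+x. ennreal ((integrand E (real j / real L) x - step_fun (cell_steps L \<kappa> j) x)\<^sup>2) \<partial>lebesgue)
    \<le> emeasure lebesgue (cell_error E L \<kappa>)"
proof -
  have j1: "real j / real L \<le> 1" using L j by (simp add: divide_le_eq)
  have "(\<integral>\<^sup>+x. ennreal ((integrand E (real j / real L) x - step_fun (cell_steps L \<kappa> j) x)\<^sup>2) \<partial>lebesgue)
    \<le> (\<integral>\<^sup>+x. indicator (cell_error E L \<kappa>) x \<partial>lebesgue)"
    using j1 by (intro nn_integral_mono) (auto simp: step_fun_cell_steps[OF L] integrand_def cell_error_def split: split_indicator)
  then show ?thesis using E by simp
qed

lemma cell_error_Compl: "cell_error (- E) L (\<lambda>i. \<not> \<kappa> i) = cell_error E L \<kappa>"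
  by (auto simp: cell_error_def)

text \<open>The discrete counterpart of \<open>W\<^sub>E\<close> at the grid points, for \<open>v = W\<close> and \<open>v' = W'\<close>, with \<open>E\<close> replaced by
  the union of the cells in \<open>\<kappa>\<close>.\<close>

definition patched :: "nat \<Rightarrow> (nat \<Rightarrow> bool) \<Rightarrow> (real \<Rightarrow> real) \<Rightarrow> (real \<Rightarrow> real) \<Rightarrow> nat \<Rightarrow> real" where
  "patched L \<kappa> v v' j = (\<Sum>i<j. if \<kappa> i then v (real (Suc i) / real L) - v (real i / real L)
      else v' (real (Suc i) / real L) - v' (real i / real L))"

lemma patched_eq_step_integrals:
  "patched L \<kappa> v v' j = step_integral (cell_steps L \<kappa> j) v + step_integral (cell_steps L (\<lambda>i. \<not> \<kappa> i) j) v'"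
  unfolding patched_def step_integral_cell_steps sum.distrib[symmetric] by (intro sum.cong) auto

lemma mixed_process_error:
  assumes BM: "two_sided_BM Q W" "two_sided_BM Q W'" and V: "mixed_process Q W W' E V"
    and L: "0 < L" and j: "j \<le> L" and E: "cell_error E L \<kappa> \<in> sets lebesgue"
  shows "(\<integral>\<^sup>+w. ennreal ((V w (real j / real L) - patched L \<kappa> (W w) (W' w) j)\<^sup>2) \<partial>Q)
    \<le> 16 * emeasure lebesgue (cell_error E L \<kappa>)"
proof -
  obtain Y Y' where Y: "indicator_integral Q W E Y" "indicator_integral Q W' (- E) Y'"
    "AE w in Q. \<forall>t. V w t = Y w t + Y' w t"
    using V unfolding mixed_process_def by blast
  let ?t = "real j / real L"
  let ?c = "emeasure lebesgue (cell_error E L \<kappa>)"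
  let ?p = "cell_steps L \<kappa> j" and ?p' = "cell_steps L (\<lambda>i. \<not> \<kappa> i) j"
  have w: "has_wiener_integral Q W (integrand E ?t) (\<lambda>w. Y w ?t)"
    "has_wiener_integral Q W' (integrand (- E) ?t) (\<lambda>w. Y' w ?t)"
    using Y by (auto simp: indicator_integral_def)
  then have [measurable]: "(\<lambda>w. Y w ?t) \<in> borel_measurable Q" "(\<lambda>w. Y' w ?t) \<in> borel_measurable Q"
    by (auto simp: has_wiener_integral_def)
  note [measurable] = step_integral_measurable[OF two_sided_BM_D(2)[OF BM(1)]] step_integral_measurable[OF two_sided_BM_D(2)[OF BM(2)]]
  have 1: "(\<integral>\<^sup>+w. ennreal ((Y w ?t - step_integral ?p (W w))\<^sup>2) \<partial>Q) \<le> 4 * ?c"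
    using wiener_integral_step_error[OF BM(1) w(1) step_list_cell_steps] integrand_cell_error[OF L j E]
    by (rule order_trans[OF _ mult_left_mono]) simp
  have E': "cell_error (- E) L (\<lambda>i. \<not> \<kappa> i) \<in> sets lebesgue" using E unfolding cell_error_Compl .
  have 2: "(\<integral>\<^sup>+w. ennreal ((Y' w ?t - step_integral ?p' (W' w))\<^sup>2) \<partial>Q) \<le> 4 * ?c"
    using wiener_integral_step_error[OF BM(2) w(2) step_list_cell_steps] integrand_cell_error[OF L j E', unfolded cell_error_Compl]
    by (rule order_trans[OF _ mult_left_mono]) simp
  have "(\<integral>\<^sup>+w. ennreal ((V w ?t - patched L \<kappa> (W w) (W' w) j)\<^sup>2) \<partial>Q)
    = (\<integral>\<^sup>+w. ennreal (((Y w ?t - step_integral ?p (W w)) + (Y' w ?t - step_integral ?p' (W' w)))\<^sup>2) \<partial>Q)"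
    using Y(3) by (intro nn_integral_cong_AE) (auto simp: patched_eq_step_integrals algebra_simps)
  also have "\<dots> \<le> 2 * (\<integral>\<^sup>+w. ennreal ((Y w ?t - step_integral ?p (W w))\<^sup>2) \<partial>Q)
      + 2 * (\<integral>\<^sup>+w. ennreal ((Y' w ?t - step_integral ?p' (W' w))\<^sup>2) \<partial>Q)"
    by (rule nn_integral_square_add_le) measurable
  also have "\<dots> \<le> 2 * (4 * ?c) + 2 * (4 * ?c)"
    using 1 2 by (intro add_mono mult_left_mono) auto
  also have "\<dots> = 16 * ?c" by (simp add: mult.assoc[symmetric] distrib_right[symmetric])
  finally show ?thesis .
qed

lemma AE_tendsto_0_if_summable:
  fixes X :: "nat \<Rightarrow> 'a \<Rightarrow> real"
  assumes [measurable]: "\<And>m. X m \<in> borel_measurable M"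
    and b: "\<And>m. (\<integral>\<^sup>+w. ennreal ((X m w)\<^sup>2) \<partial>M) \<le> ennreal (c m)" and c: "summable c" "\<And>m. 0 \<le> c m"
  shows "AE w in M. (\<lambda>m. X m w) \<longlonglongrightarrow> 0"
proof -
  have "(\<integral>\<^sup>+w. (\<Sum>m. ennreal ((X m w)\<^sup>2)) \<partial>M) = (\<Sum>m. \<integral>\<^sup>+w. ennreal ((X m w)\<^sup>2) \<partial>M)"
    by (rule nn_integral_suminf) measurable
  also have "\<dots> \<le> (\<Sum>m. ennreal (c m))" using b by (intro suminf_le) auto
  also have "\<dots> < \<infinity>" using c by (simp add: suminf_ennreal_eq[OF _ summable_sums] less_top)
  finally have "AE w in M. (\<Sum>m. ennreal ((X m w)\<^sup>2)) \<noteq> \<infinity>"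
    by (intro nn_integral_PInf_AE) auto
  then show ?thesis
  proof eventually_elim
    case (elim w)
    then have "summable (\<lambda>m. (X m w)\<^sup>2)" by (intro summable_suminf_not_top) auto
    then have "(\<lambda>m. (X m w)\<^sup>2) \<longlonglongrightarrow> 0" by (rule summable_LIMSEQ_zero)
    then have "(\<lambda>m. sqrt ((X m w)\<^sup>2)) \<longlonglongrightarrow> sqrt 0" by (rule tendsto_real_sqrt)
    then show ?case by (simp add: tendsto_rabs_zero_iff)
  qed
qed

section \<open>Brownian motion on a grid\<close>

lemma (in prob_space) indep_vars_two_families:
  fixes x :: "'i \<Rightarrow> 'b \<Rightarrow> real"
  assumes FG: "indep_var N F N G" and I: "finite I" "I \<noteq> {}"
    and x: "\<And>i. i \<in> I \<Longrightarrow> x i \<in> borel_measurable N"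
    and X: "indep_vars (\<lambda>_. borel) (\<lambda>i w. x i (F w)) I" and Y: "indep_vars (\<lambda>_. borel) (\<lambda>i w. x i (G w)) I"
  shows "indep_vars (\<lambda>_. borel) (\<lambda>p w. x (fst p) (if snd p then G w else F w)) (I \<times> UNIV)"
proof -
  let ?Z = "\<lambda>p w. x (fst p) (if snd p then G w else F w)"
  have FM: "F \<in> measurable M N" "G \<in> measurable M N"
    using FG by (auto dest: indep_var_rv1 indep_var_rv2)
  have Zm: "random_variable borel (?Z p)" if "p \<in> I \<times> UNIV" for p
    using that x FM by (cases "snd p") auto
  have "indep_sets (\<lambda>p. {?Z p -` A \<inter> space M |A. A \<in> sets borel}) (I \<times> UNIV)"
  proof (subst indep_sets_finite)
    show "I \<times> (UNIV :: bool set) \<noteq> {}" "finite (I \<times> (UNIV :: bool set))" using I by auto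
    show "{?Z p -` A \<inter> space M |A. A \<in> sets borel} \<subseteq> events" if "p \<in> I \<times> UNIV" for p
      using Zm[OF that] by (auto intro: measurable_sets)
    show "space M \<in> {?Z p -` A \<inter> space M |A. A \<in> sets borel}" for p
      by (auto intro!: exI[of _ UNIV])
    show "\<forall>A\<in>Pi (I \<times> UNIV) (\<lambda>p. {?Z p -` A \<inter> space M |A. A \<in> sets borel}).
      prob (\<Inter>p\<in>I \<times> UNIV. A p) = (\<Prod>p\<in>I \<times> UNIV. prob (A p))"
    proof
      fix A assume A: "A \<in> Pi (I \<times> UNIV) (\<lambda>p. {?Z p -` A \<inter> space M |A. A \<in> sets borel})"
      have "\<forall>p\<in>I \<times> UNIV. \<exists>a. a \<in> sets borel \<and> A p = ?Z p -` a \<inter> space M"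
      proof
        fix p assume "p \<in> I \<times> (UNIV :: bool set)"
        with A have "A p \<in> {?Z p -` a \<inter> space M |a. a \<in> sets borel}" by (rule Pi_mem)
        then show "\<exists>a. a \<in> sets borel \<and> A p = ?Z p -` a \<inter> space M" by blast
      qed
      then obtain a where a: "\<And>p. p \<in> I \<times> UNIV \<Longrightarrow> a p \<in> sets borel" "\<And>p. p \<in> I \<times> UNIV \<Longrightarrow> A p = ?Z p -` a p \<inter> space M"
        by metis
      define S where "S c = {v\<in>space N. \<forall>i\<in>I. x i v \<in> a (i, c)}" for c
      have S: "S c \<in> sets N" for c
        unfolding S_def
      proof (intro sets.sets_Collect_finite_All I)
        fix i assume "i \<in> I"
        then show "{v\<in>space N. x i v \<in> a (i, c)} \<in> sets N"
          using measurable_sets[OF x, of i "a (i, c)"] a(1)[of "(i, c)"] by (auto simp: vimage_def Int_def conj_commute)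
      qed
      have sp: "F w \<in> space N" "G w \<in> space N" if "w \<in> space M" for w
        using that FM by (auto dest: measurable_space)
      have 0: "(\<Inter>p\<in>I \<times> UNIV. A p) = (\<lambda>w. (F w, G w)) -` (S False \<times> S True) \<inter> space M"
      proof (intro set_eqI iffI)
        fix w assume w: "w \<in> (\<Inter>p\<in>I \<times> UNIV. A p)"
        obtain i where i: "i \<in> I" using I by auto
        have wA: "w \<in> ?Z (j, c) -` a (j, c) \<inter> space M" if "j \<in> I" for j c
          using w that a(2)[of "(j, c)"] by auto
        from wA[OF i] have "w \<in> space M" by auto
        moreover have "x j (F w) \<in> a (j, False)" "x j (G w) \<in> a (j, True)" if "j \<in> I" for j
          using wA[OF that, of False] wA[OF that, of True] by auto
        ultimately show "w \<in> (\<lambda>w. (F w, G w)) -` (S False \<times> S True) \<inter> space M"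
          using sp by (auto simp: S_def)
      next
        fix w assume "w \<in> (\<lambda>w. (F w, G w)) -` (S False \<times> S True) \<inter> space M"
        then show "w \<in> (\<Inter>p\<in>I \<times> UNIV. A p)"
          by (auto simp: S_def a(2))
      qed
      have 1: "prob (F -` S False \<inter> space M) = (\<Prod>i\<in>I. prob (A (i, False)))"
      proof -
        have "F -` S False \<inter> space M = (\<Inter>i\<in>I. (\<lambda>w. x i (F w)) -` a (i, False) \<inter> space M)"
          using I sp by (auto simp: S_def)
        then show ?thesis
          using indep_varsD_finite[OF X I(2,1), of "\<lambda>i. a (i, False)"] a by simp
      qed
      have 2: "prob (G -` S True \<inter> space M) = (\<Prod>i\<in>I. prob (A (i, True)))"
      proof -
        have "G -` S True \<inter> space M = (\<Inter>i\<in>I. (\<lambda>w. x i (G w)) -` a (i, True) \<inter> space M)"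
          using I sp by (auto simp: S_def)
        then show ?thesis
          using indep_varsD_finite[OF Y I(2,1), of "\<lambda>i. a (i, True)"] a by simp
      qed
      have "(\<Prod>p\<in>I \<times> UNIV. prob (A p)) = (\<Prod>i\<in>I. \<Prod>c\<in>UNIV. prob (A (i, c)))"
        by (simp add: prod.cartesian_product)
      also have "\<dots> = (\<Prod>i\<in>I. prob (A (i, False))) * (\<Prod>i\<in>I. prob (A (i, True)))"
        by (simp add: UNIV_bool prod.distrib mult.commute)
      finally show "prob (\<Inter>p\<in>I \<times> UNIV. A p) = (\<Prod>p\<in>I \<times> UNIV. prob (A p))"
        unfolding 0 indep_varD[OF FG S S] 1 2 ..
    qed
  qed
  then show ?thesis unfolding indep_vars_def2 using Zm by auto
qed

lemma indep_vars_distr_iff: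
  assumes P: "prob_space P" and Q: "prob_space Q" and W: "W \<in> measurable Q P" and d: "distr Q P W = P"
    and X: "\<And>i. i \<in> I \<Longrightarrow> X i \<in> borel_measurable P" and I: "I \<noteq> {}"
    and ind: "prob_space.indep_vars P (\<lambda>_. borel) X I"
  shows "prob_space.indep_vars Q (\<lambda>_. borel) (\<lambda>i w. X i (W w)) I"
proof -
  interpret P: prob_space P by fact
  interpret Q: prob_space Q by fact
  have X': "(\<lambda>w. X i (W w)) \<in> borel_measurable Q" if "i \<in> I" for i
    using measurable_compose[OF W X[OF that]] .
  have d1: "distr Q borel (\<lambda>w. X i (W w)) = distr P borel (X i)" if "i \<in> I" for i
    using distr_distr[OF X[OF that] W] by (simp add: d comp_def)
  have r: "(\<lambda>v. \<lambda>i\<in>I. X i v) \<in> measurable P (PiM I (\<lambda>_. borel))"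
    using X by (intro measurable_restrict) auto
  have "distr Q (PiM I (\<lambda>_. borel)) (\<lambda>w. \<lambda>i\<in>I. X i (W w)) = distr P (PiM I (\<lambda>_. borel)) (\<lambda>v. \<lambda>i\<in>I. X i v)"
    using distr_distr[OF r W] by (simp add: d comp_def)
  also have "\<dots> = PiM I (\<lambda>i. distr P borel (X i))"
    using P.indep_vars_iff_distr_eq_PiM'[where I = I and M' = "\<lambda>_. borel" and X = X] ind I X by auto
  also have "\<dots> = PiM I (\<lambda>i. distr Q borel (\<lambda>w. X i (W w)))"
    by (rule PiM_cong) (auto simp: d1)
  finally show ?thesis
    using Q.indep_vars_iff_distr_eq_PiM'[where I = I and M' = "\<lambda>_. borel" and X = "\<lambda>i w. X i (W w)"] I X' by auto
qed

lemma path_algebra_eval[measurable]: "(\<lambda>v. v t) \<in> borel_measurable path_algebra"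
  unfolding path_algebra_def by (rule measurable_restrict_space1) simp

lemma space_path_algebra: "space path_algebra = Omega0"
  by (simp add: path_algebra_def space_restrict_space space_PiM)

text \<open>The coordinate process is a Brownian motion under the uncompleted measure, and \<open>W\<close> is measurable
  and measure preserving for it as well.\<close>

lemma wiener_extension_BM:
  assumes WW: "completed_wiener_measure WW" and Q: "wiener_extension WW Q W W'"
  shows "two_sided_BM Q W" "two_sided_BM Q W'" "\<And>w. w \<in> space Q \<Longrightarrow> W w \<in> Omega0"
    "prob_space.indep_var Q path_algebra W path_algebra W'" "complete_measure Q"
proof -
  obtain P where P: "sets P = sets path_algebra" "two_sided_BM P (\<lambda>w. w)" "WW = completion P"
    using WW unfolding completed_wiener_measure_def by blast
  show BM': "two_sided_BM Q W'" and ind: "prob_space.indep_var Q path_algebra W path_algebra W'" and "complete_measure Q"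
    using Q unfolding wiener_extension_def by auto
  have prQ: "prob_space Q" using Q unfolding wiener_extension_def by auto
  have WM: "W \<in> measurable Q WW" and dW: "distr Q WW W = WW" using Q unfolding wiener_extension_def by auto
  interpret Q: prob_space Q by fact
  interpret P: prob_space P by (rule two_sided_BM_D(1)[OF P(2)])
  have spP: "space P = Omega0" using sets_eq_imp_space_eq[OF P(1)] by (simp add: space_path_algebra)
  show W0: "W w \<in> Omega0" if "w \<in> space Q" for w
    using measurable_space[OF WM that] by (simp add: P(3) spP)
  have WP: "W \<in> measurable Q P"
  proof (rule measurableI)
    fix A assume "A \<in> sets P"
    then have "A \<in> sets WW" by (simp add: P(3))
    then show "W -` A \<inter> space Q \<in> sets Q" by (rule measurable_sets[OF WM])
  qed (use W0 spP in auto)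
  have d: "distr Q P W = P"
  proof (rule measure_eqI)
    fix A assume "A \<in> sets (distr Q P W)"
    then have A: "A \<in> sets P" by simp
    then have "A \<in> sets WW" by (simp add: P(3))
    have "emeasure (distr Q P W) A = emeasure (distr Q WW W) A"
      using A \<open>A \<in> sets WW\<close> WP WM by (simp add: emeasure_distr)
    also have "\<dots> = emeasure P A" unfolding dW using A by (simp add: P(3))
    finally show "emeasure (distr Q P W) A = emeasure P A" .
  qed simp
  note B = two_sided_BM_D[OF P(2)]
  show "two_sided_BM Q W"
    unfolding two_sided_BM_def
  proof (intro conjI allI impI ballI)
    show "prob_space Q" by fact
    show "(\<lambda>w. W w t) \<in> borel_measurable Q" for t
      by (rule measurable_compose[OF WP B(2)])
    show "W w 0 = 0" "continuous_on UNIV (W w)" if "w \<in> space Q" for w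
      using W0[OF that] by (auto simp: Omega0_def)
  next
    fix s t :: real assume st: "s < t"
    note D = B(5)[OF st]
    have m: "(\<lambda>v. v t - v s) \<in> borel_measurable P" using B(2) by measurable
    then have m': "(\<lambda>v. v t - v s) \<in> measurable P lborel" by simp
    have "distr Q lborel (\<lambda>w. W w t - W w s) = distr P lborel (\<lambda>v. v t - v s)"
      using distr_distr[OF m' WP] by (simp add: d comp_def)
    then show "distributed Q lborel (\<lambda>w. W w t - W w s) (normal_density 0 (sqrt (t - s)))"
      using D measurable_compose[OF WP m] unfolding distributed_def by auto
  next
    fix t :: "nat \<Rightarrow> real" and n :: nat assume t: "mono t"
    show "Q.indep_vars (\<lambda>_. borel) (\<lambda>i w. W w (t (Suc i)) - W w (t i)) {..<n}"
    proof (cases "n = 0")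
      case True
      then show ?thesis unfolding Q.indep_vars_def2 Q.indep_sets_def by simp
    next
      case False
      show ?thesis
        by (rule indep_vars_distr_iff[OF P.prob_space_axioms prQ WP d])
           (use False B(2) B(6)[OF t] in auto)
    qed
  qed
qed

text \<open>Increments are normalized to variance \<open>1\<close>.\<close>

definition inc :: "nat \<Rightarrow> (real \<Rightarrow> real) \<Rightarrow> nat \<Rightarrow> real" where
  "inc L v i = sqrt (real L) * (v (real (Suc i) / real L) - v (real i / real L))"

lemma BM_inc_normal:
  assumes BM: "two_sided_BM M B" and L: "0 < L"
  shows "distributed M lborel (\<lambda>w. inc L (B w) i) std_normal_density"
proof -
  interpret prob_space M by (rule two_sided_BM_D(1)[OF BM])
  have "real i / real L < real (Suc i) / real L" using L by (simp add: divide_strict_right_mono)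
  note D = two_sided_BM_D(5)[OF BM this]
  have e: "real (Suc i) / real L - real i / real L = 1 / real L" by (simp add: diff_divide_distrib[symmetric])
  have "distributed M lborel (\<lambda>w. (B w (real (Suc i) / real L) - B w (real i / real L) - 0) / sqrt (1 / real L)) std_normal_density"
    using D L unfolding e by (subst normal_standard_normal_convert[symmetric]) auto
  moreover have "(\<lambda>w. (B w (real (Suc i) / real L) - B w (real i / real L) - 0) / sqrt (1 / real L)) = (\<lambda>w. inc L (B w) i)"
    using L by (auto simp: inc_def real_sqrt_divide mult.commute)
  ultimately show ?thesis by simp
qed

lemma BM_inc_indep:
  assumes BM: "two_sided_BM M B"
  shows "prob_space.indep_vars M (\<lambda>_. borel) (\<lambda>i w. inc L (B w) i) {..<n}"
proof -
  interpret prob_space M by (rule two_sided_BM_D(1)[OF BM])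
  have "mono (\<lambda>i. real i / real L)" by (auto simp: mono_def divide_right_mono)
  from two_sided_BM_D(6)[OF BM this, of n]
  have "indep_vars (\<lambda>_. borel) (\<lambda>i w. (\<lambda>x. sqrt (real L) * x) (B w (real (Suc i) / real L) - B w (real i / real L))) {..<n}"
    by (rule indep_vars_compose2) simp
  then show ?thesis by (simp add: inc_def)
qed

lemma BM_gaussian_walk:
  assumes "two_sided_BM M B" "0 < L"
  shows "gaussian_walk M (\<lambda>i w. inc L (B w) i) L"
  using assms BM_inc_indep[OF assms(1)] BM_inc_normal[OF assms] two_sided_BM_D(1)[OF assms(1)]
  by (simp add: gaussian_walk_def gaussian_walk_axioms_def)

lemma sum_inc:
  assumes "v 0 = 0" shows "(\<Sum>i<k. inc L v i) = sqrt (real L) * v (real k / real L)"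
  by (induction k) (auto simp: inc_def assms algebra_simps)

lemma sum_inc_block:
  assumes "0 < n" "0 < m"
  shows "(\<Sum>i\<in>{k * m..<k * m + m}. inc (n * m) v i) / sqrt (real m) = inc n v k"
proof -
  have t: "(\<Sum>i\<in>{a..<a + j}. v (real (Suc i) / c) - v (real i / c)) = v (real (a + j) / c) - v (real a / c)" for a j and c :: real
    by (induction j) auto
  have 1: "real (k * m + m) / real (n * m) = real (Suc k) / real n" "real (k * m) / real (n * m) = real k / real n"
    using assms by (auto simp: field_simps)
  have "(\<Sum>i\<in>{k * m..<k * m + m}. inc (n * m) v i) = sqrt (real (n * m)) * (v (real (Suc k) / real n) - v (real k / real n))"
    unfolding inc_def sum_distrib_left[symmetric] t 1 ..
  then show ?thesis using assms by (simp add: inc_def real_sqrt_mult)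
qed

locale bm_pair = prob_space Q for Q :: "'w measure" +
  fixes W W' :: "'w \<Rightarrow> real \<Rightarrow> real"
  assumes BM: "two_sided_BM Q W" and BM': "two_sided_BM Q W'"
    and indep: "indep_var path_algebra W path_algebra W'"
begin

definition cell_inc :: "nat \<Rightarrow> nat \<times> bool \<Rightarrow> 'w \<Rightarrow> real" where
  "cell_inc L p w = inc L (if snd p then W' w else W w) (fst p)"

lemma cell_inc_indep: "indep_vars (\<lambda>_. borel) (cell_inc L) ({..<n} \<times> UNIV)"
proof (cases "n = 0")
  case True
  then show ?thesis unfolding indep_vars_def2 indep_sets_def by simp
next
  case False
  have "(\<lambda>v. inc L v i) \<in> borel_measurable path_algebra" for i unfolding inc_def by measurable
  then show ?thesis
    unfolding cell_inc_def using False
    by (intro indep_vars_two_families[OF indep, of _ "\<lambda>i v. inc L v i"] BM_inc_indep BM BM') auto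
qed

lemma cell_inc_normal:
  assumes "0 < L" shows "distributed Q lborel (cell_inc L p) std_normal_density"
  using BM_inc_normal[OF BM assms] BM_inc_normal[OF BM' assms] by (cases "snd p") (simp_all add: cell_inc_def[abs_def])

text \<open>However one chooses in each cell between the increments of the two motions, the result is
  a sequence of independent standard normal variables.\<close>

lemma patched_inc_law:
  assumes L: "0 < L" and f: "f \<in> borel_measurable seqs"
  shows "(\<integral>\<^sup>+w. f (\<lambda>i\<in>{..<L}. cell_inc L (i, \<not> \<kappa> i) w) \<partial>Q) = (\<integral>\<^sup>+x. f x \<partial>gausses L)"
proof (rule nn_integral_indep_gausses[OF _ _ f])
  have "inj_on (\<lambda>i. (i, \<not> \<kappa> i)) {..<L}" by (rule inj_onI) simp
  moreover have "indep_vars (\<lambda>_. borel) (cell_inc L) ((\<lambda>i. (i, \<not> \<kappa> i)) ` {..<L})"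
    by (rule indep_vars_subset[OF cell_inc_indep[of L L]]) auto
  ultimately show "indep_vars (\<lambda>_. borel) (\<lambda>i. cell_inc L (i, \<not> \<kappa> i)) {..<L}"
    using indep_vars_reindex[where s = "\<lambda>i. (i, \<not> \<kappa> i)" and I = "{..<L}" and M' = "\<lambda>_. borel" and X = "cell_inc L"] by simp
qed (rule cell_inc_normal[OF L])

lemma sum_cell_inc_patched:
  "(\<Sum>i<j. cell_inc L (i, \<not> \<kappa> i) w) = sqrt (real L) * patched L \<kappa> (W w) (W' w) j"
  unfolding patched_def sum_distrib_left cell_inc_def inc_def by (intro sum.cong) auto

lemma pair_stability:
  assumes n: "0 < n" "0 < m" and R: "\<And>k. k < n \<Longrightarrow> \<exists>i\<in>{k * m..<k * m + m}. \<not> \<kappa> i"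
    and r: "\<And>k. k < n \<Longrightarrow> r k = card {i\<in>{k * m..<k * m + m}. \<kappa> i} / real m"
    and A: "A \<in> sets seqs"
  shows "(\<integral>\<^sup>+w. indicator A (\<lambda>k\<in>{..<n}. inc n (W w) k)
      * indicator A (\<lambda>k\<in>{..<n}. (\<Sum>i\<in>{k * m..<k * m + m}. cell_inc (n * m) (i, \<not> \<kappa> i) w) / sqrt (real m)) \<partial>Q)
    = stability n r (indicator A)"
proof -
  have e: "inc n (W w) k = (\<Sum>i\<in>{k * m..<k * m + m}. cell_inc (n * m) (i, False) w) / sqrt (real m)" for k w
    using sum_inc_block[OF n, where k = k and v = "W w"] by (simp add: cell_inc_def)
  show ?thesis
    unfolding e stability_def
    by (rule block_sums_noise_op[OF cell_inc_indep cell_inc_normal R r]) (use n A in auto)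
qed

end

section \<open>Dyadic grids and the position of the maximum\<close>

type_synonym dyadic_values = "nat \<Rightarrow> nat \<Rightarrow> real"

definition path_values :: "(real \<Rightarrow> real) \<Rightarrow> dyadic_values" where
  "path_values v e k = v (real k / 2 ^ e)"

text \<open>The last grid point \<open>2 ^ e\<close> is assigned to the last block; hence the minimum.\<close>

definition block :: "nat \<Rightarrow> nat \<Rightarrow> nat \<Rightarrow> nat set" where
  "block c e i = {k. k \<le> 2 ^ e \<and> min (k div 2 ^ (e - c)) (2 ^ c - 1) = i}"

text \<open>Two ways in which block \<open>i\<close> contains the grid maximum.  The stronger one asks for a strict maximum,
  to which noise stability and the arcsine bound apply; the weaker one only compares with points outside the block, and so
  eventually holds for the block of the maximum of a path, even if the grid has ties inside that block.
  All conditions are strict inequalities between finitely many values and thus stable under small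
  perturbations.\<close>

definition top_in :: "nat \<Rightarrow> nat \<Rightarrow> nat \<Rightarrow> dyadic_values \<Rightarrow> bool" where
  "top_in c e i y \<longleftrightarrow> (\<exists>k\<in>block c e i. \<forall>l\<le>2 ^ e. l \<noteq> k \<longrightarrow> y e l < y e k)"

definition leads :: "nat \<Rightarrow> nat \<Rightarrow> nat \<Rightarrow> dyadic_values \<Rightarrow> bool" where
  "leads c e i y \<longleftrightarrow> (\<exists>k\<in>block c e i. \<forall>l\<le>2 ^ e. l \<notin> block c e i \<longrightarrow> y e l < y e k)"

definition near_tie :: "nat \<Rightarrow> real \<Rightarrow> dyadic_values \<Rightarrow> bool" where
  "near_tie e \<epsilon> y \<longleftrightarrow> (\<exists>k\<le>2 ^ e. \<exists>l\<le>2 ^ e. k \<noteq> l \<and> \<bar>y e k - y e l\<bar> < \<epsilon>)"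

definition conflict :: "nat \<Rightarrow> nat \<Rightarrow> nat \<Rightarrow> dyadic_values \<Rightarrow> bool" where
  "conflict c e e' y \<longleftrightarrow> (\<exists>i<2 ^ c. \<exists>i'<2 ^ c. i \<noteq> i' \<and> top_in c e i y \<and> leads c e' i' y)"

text \<open>Off these events the grid maximum at level \<open>e\<close> is strict and its block is not contradicted at a
  finer level, so that it is the block of the maximum of the path.  The truncation at level \<open>e1\<close>
  makes the event depend on finitely many values.\<close>

definition bad :: "nat \<Rightarrow> nat \<Rightarrow> real \<Rightarrow> nat \<Rightarrow> dyadic_values \<Rightarrow> bool" where
  "bad c e \<epsilon> e1 y \<longleftrightarrow> near_tie e \<epsilon> y \<or> (\<exists>e'\<in>{e..e1}. conflict c e e' y)"

definition unique_max :: "(real \<Rightarrow> real) \<Rightarrow> real \<Rightarrow> bool" where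
  "unique_max v t \<longleftrightarrow> t \<in> {0..1} \<and> (\<forall>s\<in>{0..1}. s \<noteq> t \<longrightarrow> v s < v t)"

lemma block_subset: "block c e i \<subseteq> {..2 ^ e}" and finite_block[simp]: "finite (block c e i)"
  by (auto simp: block_def intro: finite_subset[of _ "{..2 ^ e}"])

lemma block_disjoint: "k \<in> block c e i \<Longrightarrow> k \<in> block c e i' \<Longrightarrow> i = i'"
  by (auto simp: block_def)

lemma block_bounds:
  assumes "c \<le> e" "k \<in> block c e i"
  shows "i < 2 ^ c" "i * 2 ^ (e - c) \<le> k" "k \<le> (i + 1) * 2 ^ (e - c)"
proof -
  let ?b = "2 ^ (e - c) :: nat"
  have e: "(2::nat) ^ e = 2 ^ c * ?b" using assms(1) by (simp add: power_add[symmetric])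
  have k: "k \<le> 2 ^ c * ?b" "min (k div ?b) (2 ^ c - 1) = i" using assms(2) by (auto simp: block_def e)
  have "i \<le> 2 ^ c - 1" using k(2) by auto
  then show "i < 2 ^ c" using one_le_power[of "2::nat" c] by linarith
  have "i \<le> k div ?b" using k(2) by auto
  then have "i * ?b \<le> k div ?b * ?b" by (rule mult_le_mono1)
  also have "\<dots> \<le> k" by (rule div_times_less_eq_dividend)
  finally show "i * ?b \<le> k" .
  show "k \<le> (i + 1) * ?b"
  proof (cases "k div ?b \<le> 2 ^ c - 1")
    case True
    then have "k div ?b = i" using k(2) by simp
    then have "k < (i + 1) * ?b" by (metis Suc_eq_plus1 dividend_less_div_times mult_Suc add.commute mult.commute zero_less_numeral zero_less_power)
    then show ?thesis by simp
  next
    case False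
    then have "i = 2 ^ c - 1" using k(2) by simp
    then have "i + 1 = 2 ^ c" by simp
    then show ?thesis using k(1) by (simp only:)
  qed
qed

lemma in_blockI:
  assumes "c \<le> e" "i < 2 ^ c" "i * 2 ^ (e - c) \<le> k" "k < (i + 1) * 2 ^ (e - c)"
  shows "k \<in> block c e i"
proof -
  let ?b = "2 ^ (e - c) :: nat"
  have e: "(2::nat) ^ e = 2 ^ c * ?b" using assms(1) by (simp add: power_add[symmetric])
  have "k div ?b = i" using assms(3,4) by (intro div_nat_eqI) (auto simp: mult.commute)
  moreover have "(i + 1) * ?b \<le> 2 ^ c * ?b" using assms(2) by (intro mult_le_mono1) simp
  ultimately show ?thesis using assms(2,4) unfolding block_def e by auto
qed

lemma dyadic_less_iff:
  assumes "c \<le> e"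
  shows "real i / 2 ^ c < real k / 2 ^ e \<longleftrightarrow> i * 2 ^ (e - c) < k"
    "real k / 2 ^ e < real i / 2 ^ c \<longleftrightarrow> k < i * 2 ^ (e - c)"
proof -
  have e: "(2::real) ^ e = 2 ^ c * 2 ^ (e - c)" using assms by (simp add: power_add[symmetric])
  have i: "real i / 2 ^ c = real (i * 2 ^ (e - c)) / 2 ^ e" unfolding e by simp
  show "real i / 2 ^ c < real k / 2 ^ e \<longleftrightarrow> i * 2 ^ (e - c) < k"
    unfolding i by (simp only: divide_less_cancel of_nat_less_iff) simp
  show "real k / 2 ^ e < real i / 2 ^ c \<longleftrightarrow> k < i * 2 ^ (e - c)"
    unfolding i by (simp only: divide_less_cancel of_nat_less_iff) simp
qed

text \<open>Outside the block the path stays below its maximum by a fixed amount, by compactness, while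
  inside the block some grid point comes arbitrarily close to the maximum.\<close>

lemma unique_max_leads:
  assumes cont: "continuous_on {0..1} v" and t: "unique_max v t" and nd: "\<And>k. k \<le> 2 ^ c \<Longrightarrow> t \<noteq> real k / 2 ^ c"
  shows "eventually (\<lambda>e. leads c e (nat \<lfloor>t * 2 ^ c\<rfloor>) (path_values v)) sequentially"
proof -
  define i where "i = nat \<lfloor>t * 2 ^ c\<rfloor>"
  have t01: "0 \<le> t" "t \<le> 1" and mx: "\<And>s. s \<in> {0..1} \<Longrightarrow> s \<noteq> t \<Longrightarrow> v s < v t"
    using t by (auto simp: unique_max_def)
  have i1: "real i \<le> t * 2 ^ c" "t * 2 ^ c < real i + 1"
    using t01 by (auto simp: i_def) 
  have t1: "t < 1" using nd[of "2 ^ c"] t01 by simp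
  then have "t * 2 ^ c < 1 * 2 ^ c" by (intro mult_strict_right_mono) auto
  with i1(1) have "real i < 2 ^ c" by linarith
  then have i2: "i < 2 ^ c" using of_nat_less_iff[of i "2 ^ c", where 'a = real] by simp
  let ?a = "real i / 2 ^ c" and ?b = "real (i + 1) / 2 ^ c"
  have "?a \<le> t" using i1(1) by (simp add: divide_le_eq)
  moreover have "t \<noteq> ?a" using nd[of i] i2 by simp
  ultimately have a: "?a < t" by simp
  have b: "t < ?b" using i1(2) by (simp add: less_divide_eq)
  have b1: "?b \<le> 1" using i2 by (simp add: divide_le_eq) (metis Suc_leI of_nat_Suc of_nat_le_iff of_nat_numeral of_nat_power)
  let ?C = "{0..1} - {?a<..<?b}"
  have "compact ?C" by (rule compact_diff) auto
  moreover have "?C \<noteq> {}"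
  proof -
    have "0 \<le> ?a" by simp
    moreover have "?a \<le> 1" using a t01 by linarith
    ultimately have "?a \<in> ?C" by (simp only: Diff_iff atLeastAtMost_iff greaterThanLessThan_iff) simp
    then show ?thesis by blast
  qed
  moreover have "continuous_on ?C v" by (rule continuous_on_subset[OF cont]) auto
  ultimately have "\<exists>x\<in>?C. \<forall>s\<in>?C. v s \<le> v x" by (rule continuous_attains_sup)
  then obtain x where x: "x \<in> ?C" "\<And>s. s \<in> ?C \<Longrightarrow> v s \<le> v x" by blast
  have "x \<noteq> t" using x(1) a b by auto
  then have "v x < v t" using mx x(1) by auto
  then obtain d where d: "0 < d" "\<And>s. s \<in> {0..1} \<Longrightarrow> dist s t < d \<Longrightarrow> dist (v s) (v t) < v t - v x"
  proof -
    have "\<forall>x\<in>{0..1}. \<forall>e>0. \<exists>d>0. \<forall>x'\<in>{0..1}. dist x' x < d \<longrightarrow> dist (v x') (v x) < e"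
      using cont unfolding continuous_on_iff .
    moreover have "t \<in> {0..1}" "0 < v t - v x" using t01 \<open>v x < v t\<close> by auto
    ultimately show ?thesis using that by blast
  qed
  let ?d = "min d (min (t - ?a) (?b - t))"
  have "0 < ?d" using d a b by auto
  moreover have "(\<lambda>e. (1 / 2) ^ e :: real) \<longlonglongrightarrow> 0" by (intro LIMSEQ_realpow_zero) auto
  ultimately have "eventually (\<lambda>e. (1 / 2) ^ e < ?d) sequentially" by (metis order_tendstoD(2))
  then show ?thesis unfolding i_def[symmetric]
    using eventually_ge_at_top[of c]
  proof eventually_elim
    case (elim e)
    then have ed: "1 / 2 ^ e < ?d" and ce: "c \<le> e" by (auto simp: power_divide)
    define k where "k = nat \<lfloor>t * 2 ^ e\<rfloor>"
    have "real k \<le> t * 2 ^ e" "t * 2 ^ e < real k + 1" using t01 by (auto simp: k_def)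
    then have k: "real k / 2 ^ e \<le> t" "t < real k / 2 ^ e + 1 / 2 ^ e"
      by (simp_all add: divide_le_eq less_divide_eq add_divide_distrib[symmetric])
    have ed': "1 / 2 ^ e < d" "1 / 2 ^ e < t - ?a" using ed by (simp_all only: min_less_iff_conj)
    have "0 \<le> real k / 2 ^ e" by simp
    moreover have "real k / 2 ^ e \<le> 1" using k(1) t01 by linarith
    ultimately have k01: "real k / 2 ^ e \<in> {0..1}" by (simp only: atLeastAtMost_iff)
    have "dist (real k / 2 ^ e) t < d" unfolding dist_real_def using k ed'(1) by linarith
    from d(2)[OF k01 this] have vk: "v x < v (real k / 2 ^ e)" unfolding dist_real_def by linarith
    have "?a < real k / 2 ^ e" using k(2) ed'(2) by linarith
    then have k3: "i * 2 ^ (e - c) < k" unfolding dyadic_less_iff(1)[OF ce] .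
    have "real k / 2 ^ e < ?b" using k(1) b by linarith
    then have k4: "k < (i + 1) * 2 ^ (e - c)" unfolding dyadic_less_iff(2)[OF ce] .
    have kb: "k \<in> block c e i" using k3 k4 by (intro in_blockI ce i2) auto
    show ?case unfolding leads_def
    proof (intro bexI[OF _ kb] allI impI)
      fix l :: nat assume l: "l \<le> 2 ^ e" "l \<notin> block c e i"
      have "real l / 2 ^ e \<notin> {?a<..<?b}"
      proof
        assume "real l / 2 ^ e \<in> {?a<..<?b}"
        then have "?a < real l / 2 ^ e" "real l / 2 ^ e < ?b" by (simp_all only: greaterThanLessThan_iff)
        then have "i * 2 ^ (e - c) < l" "l < (i + 1) * 2 ^ (e - c)"
          unfolding dyadic_less_iff[OF ce] .
        then show False using l(2) in_blockI[OF ce i2, of l] by auto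
      qed
      moreover have "real l \<le> real (2 ^ e)" using l(1) by (simp only: of_nat_le_iff)
      then have "real l / 2 ^ e \<in> {0..1}" by (simp add: divide_le_eq)
      ultimately have "v (real l / 2 ^ e) \<le> v x" using x(2) by blast
      then show "path_values v e l < path_values v e k" using vk by (simp add: path_values_def)
    qed
  qed
qed

lemma top_in_if_not_near_tie:
  assumes "0 < \<epsilon>" "\<not> near_tie e \<epsilon> y"
  shows "\<exists>i<2 ^ c. top_in c e i y"
proof -
  have fin: "finite (y e ` {..2 ^ e})" "y e ` {..2 ^ e} \<noteq> {}" by auto
  then have "Max (y e ` {..2 ^ e}) \<in> y e ` {..2 ^ e}" by (rule Max_in)
  then obtain k where "k \<in> {..2 ^ e}" "Max (y e ` {..2 ^ e}) = y e k" by blast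
  then have k: "k \<le> 2 ^ e" "y e k = Max (y e ` {..2 ^ e})" by auto
  have "y e l < y e k" if l: "l \<le> 2 ^ e" "l \<noteq> k" for l
  proof -
    have "y e l \<le> y e k" unfolding k(2) using fin(1) l(1) by (intro Max_ge) auto
    moreover have "y e l \<noteq> y e k" using assms k(1) l unfolding near_tie_def by force
    ultimately show ?thesis by simp
  qed
  moreover have "k \<in> block c e (min (k div 2 ^ (e - c)) (2 ^ c - 1))" using k(1) by (simp add: block_def)
  moreover have "min (k div 2 ^ (e - c)) (2 ^ c - 1) < (2 ^ c :: nat)"
    using one_le_power[of "2::nat" c] by linarith
  ultimately show ?thesis unfolding top_in_def by blast
qed

lemma top_in_leads: "top_in c e i y \<Longrightarrow> leads c e i y"
  unfolding top_in_def leads_def by blast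

lemma leads_unique:
  assumes "leads c e i y" "leads c e i' y" shows "i = i'"
proof (rule ccontr)
  assume ne: "i \<noteq> i'"
  obtain k where k: "k \<in> block c e i" "\<And>l. l \<le> 2 ^ e \<Longrightarrow> l \<notin> block c e i \<Longrightarrow> y e l < y e k"
    using assms(1) unfolding leads_def by blast
  obtain k' where k': "k' \<in> block c e i'" "\<And>l. l \<le> 2 ^ e \<Longrightarrow> l \<notin> block c e i' \<Longrightarrow> y e l < y e k'"
    using assms(2) unfolding leads_def by blast
  have "k' \<notin> block c e i" "k \<notin> block c e i'" using ne k(1) k'(1) block_disjoint by metis+
  moreover have "k \<le> 2 ^ e" "k' \<le> 2 ^ e" using k(1) k'(1) block_subset by auto
  ultimately have "y e k' < y e k" "y e k < y e k'" using k(2) k'(2) by auto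
  then show False by simp
qed

lemma top_in_block_of_max:
  assumes cont: "continuous_on {0..1} v" and t: "unique_max v t" and nd: "\<And>k. k \<le> 2 ^ c \<Longrightarrow> t \<noteq> real k / 2 ^ c"
    and e: "0 < \<epsilon>" and good: "\<And>e1. \<not> bad c e \<epsilon> e1 (path_values v)"
  shows "top_in c e (nat \<lfloor>t * 2 ^ c\<rfloor>) (path_values v)" "nat \<lfloor>t * 2 ^ c\<rfloor> < 2 ^ c"
proof -
  let ?i = "nat \<lfloor>t * 2 ^ c\<rfloor>"
  have "eventually (\<lambda>e'. leads c e' ?i (path_values v) \<and> c \<le> e' \<and> e \<le> e') sequentially"
    using unique_max_leads[OF cont t nd] by (intro eventually_conj eventually_ge_at_top)
  then obtain e' where e': "leads c e' ?i (path_values v)" "c \<le> e'" "e \<le> e'"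
    by (auto simp: eventually_sequentially)
  from e'(1) obtain k where "k \<in> block c e' ?i" unfolding leads_def by blast
  then show i: "?i < 2 ^ c" using block_bounds(1)[OF e'(2)] by blast
  have "\<not> near_tie e \<epsilon> (path_values v)" using good[of 0] by (auto simp: bad_def)
  from top_in_if_not_near_tie[OF e this] obtain j where j: "j < 2 ^ c" "top_in c e j (path_values v)" by blast
  have "\<not> conflict c e e' (path_values v)" using good[of e'] e'(3) by (auto simp: bad_def)
  then have "j = ?i" using j i e'(1) unfolding conflict_def by blast
  then show "top_in c e ?i (path_values v)" using j by simp
qed

lemma eventually_less_lim:
  fixes a b :: "nat \<Rightarrow> real"
  assumes "a \<longlonglongrightarrow> x" "b \<longlonglongrightarrow> y" "x < y"
  shows "eventually (\<lambda>m. a m < b m) sequentially"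
proof -
  have "(\<lambda>m. b m - a m) \<longlonglongrightarrow> y - x" using assms by (intro tendsto_diff)
  then have "eventually (\<lambda>m. 0 < b m - a m) sequentially" using assms(3) by (intro order_tendstoD(1)) auto
  then show ?thesis by eventually_elim simp
qed

lemma top_in_open:
  assumes "\<And>k. k \<le> 2 ^ e \<Longrightarrow> (\<lambda>m. ym m e k) \<longlonglongrightarrow> y e k" "top_in c e i y"
  shows "eventually (\<lambda>m. top_in c e i (ym m)) sequentially"
proof -
  obtain k where k: "k \<in> block c e i" "\<And>l. l \<le> 2 ^ e \<Longrightarrow> l \<noteq> k \<Longrightarrow> y e l < y e k"
    using assms(2) unfolding top_in_def by blast
  have ke: "k \<le> 2 ^ e" using k(1) block_subset by auto
  have "eventually (\<lambda>m. \<forall>l\<in>{..2 ^ e} - {k}. ym m e l < ym m e k) sequentially"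
  proof (rule eventually_ball_finite)
    show "\<forall>l\<in>{..2 ^ e} - {k}. eventually (\<lambda>m. ym m e l < ym m e k) sequentially"
    proof
      fix l assume l: "l \<in> {..2 ^ e} - {k}"
      then have "l \<le> 2 ^ e" "y e l < y e k" using k(2)[of l] by auto
      then show "eventually (\<lambda>m. ym m e l < ym m e k) sequentially"
        using eventually_less_lim[OF assms(1)[of l] assms(1)[of k]] ke by blast
    qed
  qed simp
  then show ?thesis by eventually_elim (use k(1) in \<open>auto simp: top_in_def\<close>)
qed

lemma leads_open:
  assumes "\<And>k. k \<le> 2 ^ e \<Longrightarrow> (\<lambda>m. ym m e k) \<longlonglongrightarrow> y e k" "leads c e i y"
  shows "eventually (\<lambda>m. leads c e i (ym m)) sequentially"
proof -
  obtain k where k: "k \<in> block c e i" "\<And>l. l \<le> 2 ^ e \<Longrightarrow> l \<notin> block c e i \<Longrightarrow> y e l < y e k"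
    using assms(2) unfolding leads_def by blast
  have ke: "k \<le> 2 ^ e" using k(1) block_subset by auto
  have "eventually (\<lambda>m. \<forall>l\<in>{..2 ^ e} - block c e i. ym m e l < ym m e k) sequentially"
  proof (rule eventually_ball_finite)
    show "\<forall>l\<in>{..2 ^ e} - block c e i. eventually (\<lambda>m. ym m e l < ym m e k) sequentially"
    proof
      fix l assume l: "l \<in> {..2 ^ e} - block c e i"
      then have "l \<le> 2 ^ e" "y e l < y e k" using k(2)[of l] by auto
      then show "eventually (\<lambda>m. ym m e l < ym m e k) sequentially"
        using eventually_less_lim[OF assms(1)[of l] assms(1)[of k]] ke by blast
    qed
  qed simp
  then show ?thesis by eventually_elim (use k(1) in \<open>auto simp: leads_def\<close>)
qed

lemma near_tie_open:
  assumes "\<And>k. k \<le> 2 ^ e \<Longrightarrow> (\<lambda>m. ym m e k) \<longlonglongrightarrow> y e k" "near_tie e \<epsilon> y"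
  shows "eventually (\<lambda>m. near_tie e \<epsilon> (ym m)) sequentially"
proof -
  obtain k l where k: "k \<le> 2 ^ e" "l \<le> 2 ^ e" "k \<noteq> l" "\<bar>y e k - y e l\<bar> < \<epsilon>"
    using assms(2) unfolding near_tie_def by blast
  have "(\<lambda>m. \<bar>ym m e k - ym m e l\<bar>) \<longlonglongrightarrow> \<bar>y e k - y e l\<bar>"
    by (intro tendsto_rabs tendsto_diff assms(1) k)
  then have "eventually (\<lambda>m. \<bar>ym m e k - ym m e l\<bar> < \<epsilon>) sequentially" using k(4) by (rule order_tendstoD(2))
  then show ?thesis by eventually_elim (use k in \<open>auto simp: near_tie_def\<close>)
qed

lemma bad_open:
  assumes "\<And>e' k. e' \<le> max e e1 \<Longrightarrow> k \<le> 2 ^ e' \<Longrightarrow> (\<lambda>m. ym m e' k) \<longlonglongrightarrow> y e' k" "bad c e \<epsilon> e1 y"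
  shows "eventually (\<lambda>m. bad c e \<epsilon> e1 (ym m)) sequentially"
  using assms(2) unfolding bad_def
proof
  assume "near_tie e \<epsilon> y"
  then have "eventually (\<lambda>m. near_tie e \<epsilon> (ym m)) sequentially" by (rule near_tie_open[rotated]) (rule assms(1), auto)
  then show "eventually (\<lambda>m. near_tie e \<epsilon> (ym m) \<or> (\<exists>e'\<in>{e..e1}. conflict c e e' (ym m))) sequentially"
    by eventually_elim simp
next
  assume "\<exists>e'\<in>{e..e1}. conflict c e e' y"
  then obtain e' i i' where c: "e' \<in> {e..e1}" "i < 2 ^ c" "i' < 2 ^ c" "i \<noteq> i'" "top_in c e i y" "leads c e' i' y"
    unfolding conflict_def by blast
  have 1: "eventually (\<lambda>m. top_in c e i (ym m)) sequentially"
    by (rule top_in_open[OF _ c(5)]) (rule assms(1), auto)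
  have 2: "eventually (\<lambda>m. leads c e' i' (ym m)) sequentially"
    by (rule leads_open[OF _ c(6)]) (rule assms(1), use c(1) in auto)
  show "eventually (\<lambda>m. near_tie e \<epsilon> (ym m) \<or> (\<exists>e'\<in>{e..e1}. conflict c e e' (ym m))) sequentially"
    using 1 2
  proof eventually_elim
    case (elim m)
    then have "conflict c e e' (ym m)" using c unfolding conflict_def by blast
    then show ?case using c(1) by blast
  qed
qed

lemma top_in_cong:
  assumes "\<And>k. k \<le> 2 ^ e \<Longrightarrow> y e k = a * y' e k" "0 < a"
  shows "top_in c e i y = top_in c e i y'"
proof -
  have "k \<le> 2 ^ e" if "k \<in> block c e i" for k using that block_subset by auto
  then show ?thesis unfolding top_in_def
    by (intro bex_cong all_cong refl) (simp add: assms)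
qed

lemma leads_cong:
  assumes "\<And>k. k \<le> 2 ^ e \<Longrightarrow> y e k = y' e k"
  shows "leads c e i y = leads c e i y'"
proof -
  have "k \<le> 2 ^ e" if "k \<in> block c e i" for k using that block_subset by auto
  then show ?thesis unfolding leads_def
    by (intro bex_cong all_cong refl) (simp add: assms)
qed

lemma bad_cong:
  assumes "\<And>e' k. e' \<le> max e e1 \<Longrightarrow> k \<le> 2 ^ e' \<Longrightarrow> y e' k = y' e' k"
  shows "bad c e \<epsilon> e1 y = bad c e \<epsilon> e1 y'"
proof -
  have "near_tie e \<epsilon> y = near_tie e \<epsilon> y'" unfolding near_tie_def
    by (intro ex_cong1 conj_cong refl) (simp add: assms)
  moreover have "top_in c e i y = top_in c e i y'" for i by (rule top_in_cong[where a = 1]) (use assms[of e] in auto)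
  moreover have "leads c e' i y = leads c e' i y'" if "e' \<in> {e..e1}" for e' i
    by (rule leads_cong) (use assms[of e'] that in auto)
  ultimately show ?thesis unfolding bad_def conflict_def by auto
qed

lemma top_in_measurable:
  assumes "\<And>k. k \<le> 2 ^ e \<Longrightarrow> (\<lambda>w. y w e k) \<in> borel_measurable M"
  shows "{w\<in>space M. top_in c e i (y w)} \<in> sets M"
proof -
  have "{w\<in>space M. \<exists>k\<in>block c e i. \<forall>l\<in>{..2 ^ e}. l \<noteq> k \<longrightarrow> y w e l < y w e k} \<in> sets M"
  proof (intro sets.sets_Collect_finite_Ex sets.sets_Collect_finite_All)
    fix k l :: nat assume "k \<in> block c e i" "l \<in> {..2 ^ e}"
    then have [measurable]: "(\<lambda>w. y w e k) \<in> borel_measurable M" "(\<lambda>w. y w e l) \<in> borel_measurable M"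
      using assms block_subset[of c e i] by (auto simp: subset_iff)
    show "{w\<in>space M. l \<noteq> k \<longrightarrow> y w e l < y w e k} \<in> sets M" by measurable
  qed auto
  then show ?thesis unfolding top_in_def Ball_def atMost_iff .
qed

lemma leads_measurable:
  assumes "\<And>k. k \<le> 2 ^ e \<Longrightarrow> (\<lambda>w. y w e k) \<in> borel_measurable M"
  shows "{w\<in>space M. leads c e i (y w)} \<in> sets M"
proof -
  have "{w\<in>space M. \<exists>k\<in>block c e i. \<forall>l\<in>{..2 ^ e}. l \<notin> block c e i \<longrightarrow> y w e l < y w e k} \<in> sets M"
  proof (intro sets.sets_Collect_finite_Ex sets.sets_Collect_finite_All)
    fix k l :: nat assume "k \<in> block c e i" "l \<in> {..2 ^ e}"
    then have [measurable]: "(\<lambda>w. y w e k) \<in> borel_measurable M" "(\<lambda>w. y w e l) \<in> borel_measurable M"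
      using assms block_subset[of c e i] by (auto simp: subset_iff)
    show "{w\<in>space M. l \<notin> block c e i \<longrightarrow> y w e l < y w e k} \<in> sets M" by measurable
  qed auto
  then show ?thesis unfolding leads_def Ball_def atMost_iff .
qed

lemma near_tie_measurable:
  assumes "\<And>k. k \<le> 2 ^ e \<Longrightarrow> (\<lambda>w. y w e k) \<in> borel_measurable M"
  shows "{w\<in>space M. near_tie e \<epsilon> (y w)} \<in> sets M"
proof -
  have "{w\<in>space M. \<exists>k\<in>{..2 ^ e}. \<exists>l\<in>{..2 ^ e}. k \<noteq> l \<and> \<bar>y w e k - y w e l\<bar> < \<epsilon>} \<in> sets M"
  proof (intro sets.sets_Collect_finite_Ex)
    fix k l :: nat assume "k \<in> {..2 ^ e}" "l \<in> {..2 ^ e}"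
    then have [measurable]: "(\<lambda>w. y w e k) \<in> borel_measurable M" "(\<lambda>w. y w e l) \<in> borel_measurable M"
      using assms by auto
    show "{w\<in>space M. k \<noteq> l \<and> \<bar>y w e k - y w e l\<bar> < \<epsilon>} \<in> sets M" by measurable
  qed auto
  then show ?thesis unfolding near_tie_def Bex_def atMost_iff .
qed

lemma conflict_measurable:
  assumes "\<And>k. k \<le> 2 ^ e \<Longrightarrow> (\<lambda>w. y w e k) \<in> borel_measurable M" "\<And>k. k \<le> 2 ^ e' \<Longrightarrow> (\<lambda>w. y w e' k) \<in> borel_measurable M"
  shows "{w\<in>space M. conflict c e e' (y w)} \<in> sets M"
proof -
  have "{w\<in>space M. \<exists>i\<in>{..<2 ^ c}. \<exists>i'\<in>{..<2 ^ c}. i \<noteq> i' \<and> top_in c e i (y w) \<and> leads c e' i' (y w)} \<in> sets M"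
  proof (intro sets.sets_Collect_finite_Ex)
    fix i i' :: nat
    have "{w\<in>space M. i \<noteq> i' \<and> top_in c e i (y w) \<and> leads c e' i' (y w)}
      = (if i = i' then {} else {w\<in>space M. top_in c e i (y w)} \<inter> {w\<in>space M. leads c e' i' (y w)})" by auto
    then show "{w\<in>space M. i \<noteq> i' \<and> top_in c e i (y w) \<and> leads c e' i' (y w)} \<in> sets M"
      using top_in_measurable[where y = y and M = M, OF assms(1), of c i] leads_measurable[where y = y and M = M, OF assms(2), of c i'] by auto
  qed auto
  then show ?thesis unfolding conflict_def Bex_def lessThan_iff .
qed

lemma bad_measurable:
  assumes "\<And>e' k. e' \<le> max e e1 \<Longrightarrow> k \<le> 2 ^ e' \<Longrightarrow> (\<lambda>w. y w e' k) \<in> borel_measurable M"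
  shows "{w\<in>space M. bad c e \<epsilon> e1 (y w)} \<in> sets M"
proof -
  have "{w\<in>space M. near_tie e \<epsilon> (y w)} \<in> sets M"
    by (rule near_tie_measurable) (rule assms, auto)
  moreover have "{w\<in>space M. \<exists>e'\<in>{e..e1}. conflict c e e' (y w)} \<in> sets M"
  proof (rule sets.sets_Collect_finite_Ex)
    fix e' assume "e' \<in> {e..e1}"
    then show "{w\<in>space M. conflict c e e' (y w)} \<in> sets M"
      by (intro conflict_measurable assms) auto
  qed simp
  moreover have "{w\<in>space M. bad c e \<epsilon> e1 (y w)}
    = {w\<in>space M. near_tie e \<epsilon> (y w)} \<union> {w\<in>space M. \<exists>e'\<in>{e..e1}. conflict c e e' (y w)}"
    by (auto simp: bad_def)
  ultimately show ?thesis by simp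
qed

section \<open>Almost sure uniqueness of the maximum\<close>

context gaussian_walk
begin

text \<open>The increment \<open>D\<close> over the gap between the two index sets is normal with variance \<open>m\<close>, independent of
  the other increments, and shifts the difference of the two maxima; so this difference has a density
  bounded by \<open>1/(2\<surd>m)\<close>.\<close>

lemma max_tie_bound:
  assumes s: "s + m \<le> n" and m: "0 < m" and \<epsilon>: "0 \<le> \<epsilon>"
  shows "prob {w\<in>space M. \<bar>Max ((\<lambda>k. S k w) ` {..s}) - Max ((\<lambda>k. S k w) ` {s + m..n})\<bar> < \<epsilon>} \<le> \<epsilon> / sqrt (real m)"
proof -
  let ?A = "{s..<s + m}"
  let ?B = "{..<n} - ?A"
  define T where "T k y = (\<Sum>i\<in>{..<k} - ?A. y i)" for k and y :: "nat \<Rightarrow> real"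
  define F where "F y = Max ((\<lambda>k. T k y) ` {..s}) - Max ((\<lambda>k. T k y) ` {s + m..n})" for y
  define D where "D w = (\<Sum>i\<in>?A. X i w)" for w
  define FX where "FX w = F (\<lambda>i. X i w)" for w
  have Tm: "(\<lambda>y. T k y) \<in> borel_measurable (PiM ?B (\<lambda>_. borel))" if "k \<le> n" for k
    unfolding T_def using that by (intro borel_measurable_sum measurable_component_singleton) auto
  have Fm: "F \<in> borel_measurable (PiM ?B (\<lambda>_. borel))"
    unfolding F_def using s by (intro borel_measurable_diff borel_measurable_Max Tm) auto
  have Dm: "(\<lambda>y :: nat \<Rightarrow> real. \<Sum>i\<in>?A. 1 * y i) \<in> borel_measurable (PiM ?A (\<lambda>_. borel))"
    by (intro borel_measurable_sum borel_measurable_times borel_measurable_const measurable_component_singleton) auto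
  have "indep_var (PiM ?B (\<lambda>_. borel)) (\<lambda>w. restrict (\<lambda>i. X i w) ?B) (PiM ?A (\<lambda>_. borel)) (\<lambda>w. restrict (\<lambda>i. X i w) ?A)"
    by (rule indep_var_restrict[OF indep_X]) (use s in auto)
  from indep_var_compose[OF this Fm Dm]
  have "indep_var borel (F \<circ> (\<lambda>w. restrict (\<lambda>i. X i w) ?B)) borel ((\<lambda>y. \<Sum>i\<in>?A. 1 * y i) \<circ> (\<lambda>w. restrict (\<lambda>i. X i w) ?A))" .
  moreover have "F \<circ> (\<lambda>w. restrict (\<lambda>i. X i w) ?B) = FX"
  proof
    fix w
    have "T k (restrict (\<lambda>i. X i w) ?B) = T k (\<lambda>i. X i w)" if "k \<le> n" for k
      unfolding T_def using that by (intro sum.cong) auto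
    then have "(\<lambda>k. T k (restrict (\<lambda>i. X i w) ?B)) ` K = (\<lambda>k. T k (\<lambda>i. X i w)) ` K" if "K \<subseteq> {..n}" for K
      using that by (intro image_cong) auto
    then show "(F \<circ> (\<lambda>w. restrict (\<lambda>i. X i w) ?B)) w = FX w"
      unfolding comp_def F_def FX_def using s by (simp add: subset_iff)
  qed
  moreover have "(\<lambda>y. \<Sum>i\<in>?A. 1 * y i) \<circ> (\<lambda>w. restrict (\<lambda>i. X i w) ?A) = D"
    by (auto simp: D_def fun_eq_iff)
  ultimately have ind: "indep_var borel FX borel D" by simp
  have [measurable]: "FX \<in> borel_measurable M" "D \<in> borel_measurable M"
    using ind by (auto dest: indep_var_rv1 indep_var_rv2)
  have "indep_vars (\<lambda>_. borel) X ?A" by (rule indep_vars_subset[OF indep_X]) (use s in auto)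
  then have "distributed M lborel D (normal_density (\<Sum>i\<in>?A. 0) (sqrt (\<Sum>i\<in>?A. 1\<^sup>2)))"
    unfolding D_def by (intro sum_indep_normal) (use s m normal_X in auto)
  then have LD: "distributed M lborel D (normal_density 0 (sqrt (real m)))" by simp
  have SX: "S k w = T k (\<lambda>i. X i w) + (if s + m \<le> k then D w else 0)" if "k \<le> s \<or> s + m \<le> k" for k w
  proof (cases "s + m \<le> k")
    case True
    then have "{..<k} = ({..<k} - ?A) \<union> ?A" by auto
    then have "S k w = (\<Sum>i\<in>({..<k} - ?A) \<union> ?A. X i w)" by (simp add: S_def)
    also have "\<dots> = T k (\<lambda>i. X i w) + D w" unfolding T_def D_def by (rule sum.union_disjoint) auto
    finally show ?thesis using True by simp
  next
    case False
    then have "{..<k} - ?A = {..<k}" using that by auto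
    then show ?thesis using False by (simp add: S_def T_def)
  qed
  have eq: "Max ((\<lambda>k. S k w) ` {..s}) - Max ((\<lambda>k. S k w) ` {s + m..n}) = FX w - D w" for w
  proof -
    have "(\<lambda>k. S k w) ` {..s} = (\<lambda>k. T k (\<lambda>i. X i w)) ` {..s}"
      using m by (intro image_cong refl) (simp add: SX)
    moreover have "(\<lambda>k. S k w) ` {s + m..n} = (\<lambda>x. x + D w) ` (\<lambda>k. T k (\<lambda>i. X i w)) ` {s + m..n}"
      unfolding image_image by (intro image_cong refl) (simp add: SX)
    moreover have "Max ((\<lambda>x. x + D w) ` (\<lambda>k. T k (\<lambda>i. X i w)) ` {s + m..n}) = Max ((\<lambda>k. T k (\<lambda>i. X i w)) ` {s + m..n}) + D w"
      using s by (intro mono_Max_commute[symmetric]) (auto simp: mono_def)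
    ultimately show ?thesis by (simp add: FX_def F_def)
  qed
  have s2: "2 \<le> sqrt (2 * pi)" using pi_ge_two by (intro real_le_rsqrt) simp
  have mE: "{w\<in>space M. \<bar>FX w - D w\<bar> < \<epsilon>} \<in> sets M" by measurable
  have "emeasure M {w\<in>space M. \<bar>FX w - D w\<bar> < \<epsilon>} = (\<integral>\<^sup>+w. indicator {w\<in>space M. \<bar>FX w - D w\<bar> < \<epsilon>} w \<partial>M)"
    using mE by simp
  also have "\<dots> = (\<integral>\<^sup>+w. indicator {p. \<bar>fst p - snd p\<bar> < \<epsilon>} (FX w, D w) \<partial>M)"
    by (intro nn_integral_cong) (auto split: split_indicator)
  also have "\<dots> = (\<integral>\<^sup>+x. \<integral>\<^sup>+y. indicator {p. \<bar>fst p - snd p\<bar> < \<epsilon>} (x, y) \<partial>distr M borel D \<partial>distr M borel FX)"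
    by (rule nn_integral_indep_var[OF ind]) measurable
  also have "\<dots> \<le> (\<integral>\<^sup>+x. ennreal (\<epsilon> / sqrt (real m)) \<partial>distr M borel FX)"
  proof (rule nn_integral_mono)
    fix x
    have "(\<integral>\<^sup>+y. indicator {p. \<bar>fst p - snd p\<bar> < \<epsilon>} (x, y) \<partial>distr M borel D)
      = (\<integral>\<^sup>+y. indicator {p. \<bar>fst p - snd p\<bar> < \<epsilon>} (x, y) * ennreal (normal_density 0 (sqrt (real m)) y) \<partial>lborel)"
      by (rule nn_integral_distributed_borel[OF LD]) measurable
    also have "\<dots> \<le> (\<integral>\<^sup>+y. ennreal (1 / (2 * sqrt (real m))) * indicator {x - \<epsilon>..x + \<epsilon>} y \<partial>lborel)"
    proof (rule nn_integral_mono)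
      fix y
      have "normal_density 0 (sqrt (real m)) y \<le> 1 / sqrt (2 * pi * real m) * 1"
        unfolding normal_density_def by (intro mult_mono) auto
      also have "\<dots> \<le> 1 / (2 * sqrt (real m)) * 1"
        using m s2 by (simp add: real_sqrt_mult frac_le)
      finally have "ennreal (normal_density 0 (sqrt (real m)) y) \<le> ennreal (1 / (2 * sqrt (real m)))"
        by (intro ennreal_leI) simp
      then show "indicator {p. \<bar>fst p - snd p\<bar> < \<epsilon>} (x, y) * ennreal (normal_density 0 (sqrt (real m)) y)
        \<le> ennreal (1 / (2 * sqrt (real m))) * indicator {x - \<epsilon>..x + \<epsilon>} y"
        by (auto split: split_indicator)
    qed
    also have "\<dots> = ennreal (1 / (2 * sqrt (real m))) * ennreal (2 * \<epsilon>)"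
      using \<epsilon> by (subst nn_integral_cmult_indicator) auto
    also have "\<dots> = ennreal (\<epsilon> / sqrt (real m))"
      using \<epsilon> by (subst ennreal_mult[symmetric]) auto
    finally show "(\<integral>\<^sup>+y. indicator {p. \<bar>fst p - snd p\<bar> < \<epsilon>} (x, y) \<partial>distr M borel D) \<le> ennreal (\<epsilon> / sqrt (real m))" .
  qed
  also have "\<dots> = ennreal (\<epsilon> / sqrt (real m))"
  proof -
    interpret FD: prob_space "distr M borel FX" by (rule prob_space_distr) measurable
    show ?thesis using FD.emeasure_space_1 by simp
  qed
  finally show ?thesis unfolding eq using \<epsilon> by (simp add: emeasure_eq_measure)
qed

lemma strict_argmax_at_bound:
  assumes k: "k \<le> n" and h: "2 * h \<le> n" "0 < h"
  shows "prob {w\<in>space M. \<forall>l\<le>n. l \<noteq> k \<longrightarrow> S l w < S k w} \<le> 1 / sqrt (real h)"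
proof -
  have s1: "stay_neg j \<le> 1" if "j \<le> n" for j
  proof -
    have "stay_neg j \<le> 1 / sqrt (j + 1)" by (rule stay_neg_bound[OF that])
    also have "\<dots> \<le> 1" by simp
    finally show ?thesis .
  qed
  have sh: "stay_neg j \<le> 1 / sqrt (real h)" if "j \<le> n" "h \<le> j" for j
  proof -
    have "stay_neg j \<le> 1 / sqrt (j + 1)" by (rule stay_neg_bound[OF that(1)])
    also have "\<dots> \<le> 1 / sqrt (real h)" using that(2) h(2) by (intro divide_left_mono) auto
    finally show ?thesis .
  qed
  have "prob {w\<in>space M. \<forall>l\<le>n. l \<noteq> k \<longrightarrow> S (0 + l) w < S (0 + k) w} = stay_neg k * stay_neg (n - k)"
    by (rule strict_argmax_prob) (use k in auto)
  also have "\<dots> \<le> 1 / sqrt (real h)"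
  proof (cases "h \<le> k")
    case True
    have "stay_neg k * stay_neg (n - k) \<le> 1 / sqrt (real h) * 1"
      using True k by (intro mult_mono sh s1 stay_neg_nonneg) auto
    then show ?thesis by simp
  next
    case False
    have "stay_neg k * stay_neg (n - k) \<le> 1 * (1 / sqrt (real h))"
      using False k h(1) by (intro mult_mono sh s1 stay_neg_nonneg) auto
    then show ?thesis by simp
  qed
  finally show ?thesis by simp
qed

end

text \<open>Fatou's lemma for events; it carries bounds for open conditions from the approximations to the
  limit.\<close>

lemma (in prob_space) prob_le_if_eventually:
  assumes A: "A \<in> sets M" "\<And>m. B m \<in> sets M" and AB: "AE w in M. w \<in> A \<longrightarrow> eventually (\<lambda>m. w \<in> B m) sequentially"
    and b: "eventually (\<lambda>m. prob (B m) \<le> \<beta>) sequentially"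
  shows "prob A \<le> \<beta>"
proof -
  define C where "C j = (\<Inter>m\<in>{j..}. B m)" for j
  have C: "C j \<in> sets M" for j unfolding C_def using A(2) by (intro sets.countable_INT) auto
  have "incseq C" by (auto simp: incseq_def C_def)
  then have lim: "(\<lambda>j. prob (C j)) \<longlonglongrightarrow> prob (\<Union>j. C j)"
    using C by (intro finite_Lim_measure_incseq) auto
  have "prob A \<le> prob (\<Union>j. C j)"
  proof (rule finite_measure_mono_AE)
    show "AE w in M. w \<in> A \<longrightarrow> w \<in> (\<Union>j. C j)"
      using AB by eventually_elim (auto simp: C_def eventually_sequentially)
  qed (use C in auto)
  also have "prob (\<Union>j. C j) \<le> \<beta>"
  proof (rule LIMSEQ_le_const2[OF lim])
    obtain N where N: "\<And>m. N \<le> m \<Longrightarrow> prob (B m) \<le> \<beta>" using b by (auto simp: eventually_sequentially)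
    have "prob (C j) \<le> \<beta>" if "N \<le> j" for j
    proof -
      have "prob (C j) \<le> prob (B j)" by (rule finite_measure_mono) (use A(2) in \<open>auto simp: C_def\<close>)
      then show ?thesis using N[OF that] by linarith
    qed
    then show "\<exists>N. \<forall>j\<ge>N. prob (C j) \<le> \<beta>" by blast
  qed
  finally show ?thesis .
qed

context prob_space
begin

lemma BM_no_ties:
  assumes BM: "two_sided_BM M B" and ab: "a \<noteq> b"
  shows "AE w in M. B w a \<noteq> B w b"
proof -
  have *: "AE w in M. B w t - B w s \<noteq> 0" if "s < t" for s t
    using AE_lborel_singleton[of "0::real"]
    by (subst distributed_AE2[OF two_sided_BM_D(5)[OF BM that]]) auto
  show ?thesis
  proof (cases "a < b")
    case True
    from *[OF True] show ?thesis by eventually_elim auto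
  next
    case False
    then have "b < a" using ab by simp
    from *[OF this] show ?thesis by eventually_elim auto
  qed
qed

lemma BM_max_not_dyadic:
  assumes BM: "two_sided_BM M B" and k: "k \<le> 2 ^ e"
  shows "AE w in M. \<exists>s\<in>{0..1}. B w (real k / 2 ^ e) < B w s"
proof -
  define t where "t = real k / 2 ^ e"
  define N where "N j = {w\<in>space M. \<forall>l\<le>2 ^ Suc (e + j). l \<noteq> k * 2 ^ Suc j \<longrightarrow> B w (real l / 2 ^ Suc (e + j)) < B w t}" for j
  have tj: "t = real (k * 2 ^ Suc j) / 2 ^ Suc (e + j)" for j by (simp add: t_def power_add)
  have k2: "k * 2 ^ Suc j \<le> 2 ^ Suc (e + j)" for j using k by (simp add: power_add)
  have pN: "N j \<in> sets M \<and> prob (N j) \<le> (1 / sqrt 2) ^ j" for j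
  proof -
    let ?n = "2 ^ Suc (e + j) :: nat"
    interpret gw: gaussian_walk M "\<lambda>i w. inc ?n (B w) i" ?n by (rule BM_gaussian_walk[OF BM]) simp
    have S: "gw.S l w = sqrt (real ?n) * B w (real l / real ?n)" if "w \<in> space M" for l w
      unfolding gw.S_def by (rule sum_inc) (rule two_sided_BM_D(3)[OF BM that])
    have "gw.S l w < gw.S (k * 2 ^ Suc j) w \<longleftrightarrow> B w (real l / 2 ^ Suc (e + j)) < B w t" if "w \<in> space M" for l w
      unfolding S[OF that] tj[of j] by (simp only: of_nat_power of_nat_numeral mult_less_cancel_left_pos[OF real_sqrt_gt_zero[OF zero_less_power[OF zero_less_numeral]]])
    then have e: "N j = {w\<in>space M. \<forall>l\<le>?n. l \<noteq> k * 2 ^ Suc j \<longrightarrow> gw.S l w < gw.S (k * 2 ^ Suc j) w}"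
      unfolding N_def by (intro Collect_cong conj_cong refl) (simp only:)
    have "N j \<in> sets M" unfolding e
      by (rule gw.strict_argmax_sets[of 0 ?n "k * 2 ^ Suc j", unfolded add_0, OF order_refl k2[of j]])
    moreover have "prob (N j) \<le> 1 / sqrt (real (2 ^ (e + j)))"
      unfolding e by (rule gw.strict_argmax_at_bound[OF k2[of j]]) simp_all
    moreover have "1 / sqrt (real (2 ^ (e + j))) \<le> 1 / sqrt (2 ^ j)"
      by (intro divide_left_mono) auto
    ultimately show ?thesis by (simp add: real_sqrt_power power_divide)
  qed
  define Z where "Z = (\<Inter>j. N j)"
  have Z: "Z \<in> sets M" unfolding Z_def using pN by auto
  have Zb: "prob Z \<le> (1 / sqrt 2) ^ j" for j
  proof -
    have "prob Z \<le> prob (N j)" by (rule finite_measure_mono) (use pN in \<open>auto simp: Z_def\<close>)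
    then show ?thesis using pN[of j] by linarith
  qed
  have "(\<lambda>j. (1 / sqrt 2) ^ j) \<longlonglongrightarrow> 0" by (intro LIMSEQ_realpow_zero) auto
  then have "prob Z \<le> 0" by (rule LIMSEQ_le_const) (use Zb in blast)
  then have "prob Z = 0" using measure_nonneg[of M Z] by linarith
  then have "Z \<in> null_sets M" using Z by (simp add: null_sets_def emeasure_eq_measure)
  then have 1: "AE w in M. w \<notin> Z" by (rule AE_not_in)
  have "AE w in M. real l / 2 ^ Suc (e + j) \<noteq> t \<longrightarrow> B w (real l / 2 ^ Suc (e + j)) \<noteq> B w t" for j l
  proof (cases "real l / 2 ^ Suc (e + j) = t")
    case False
    from BM_no_ties[OF BM this] show ?thesis by eventually_elim simp
  qed simp
  then have 2: "AE w in M. \<forall>j l. real l / 2 ^ Suc (e + j) \<noteq> t \<longrightarrow> B w (real l / 2 ^ Suc (e + j)) \<noteq> B w t"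
    unfolding AE_all_countable by blast
  show ?thesis using 1 2 AE_space
  proof eventually_elim
    case (elim w)
    then obtain j where "w \<notin> N j" by (auto simp: Z_def)
    then obtain l where l: "l \<le> 2 ^ Suc (e + j)" "l \<noteq> k * 2 ^ Suc j" "\<not> B w (real l / 2 ^ Suc (e + j)) < B w t"
      using elim(3) unfolding N_def mem_Collect_eq by metis
    have N0: "(2::real) ^ Suc (e + j) \<noteq> 0" by simp
    have "real l / 2 ^ Suc (e + j) \<noteq> t"
    proof
      assume "real l / 2 ^ Suc (e + j) = t"
      then have "real l / 2 ^ Suc (e + j) = real (k * 2 ^ Suc j) / 2 ^ Suc (e + j)" using tj[of j] by metis
      then have "real l = real (k * 2 ^ Suc j)" using N0 by (metis divide_cancel_right)
      then have "l = k * 2 ^ Suc j" unfolding of_nat_eq_iff .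
      then show False using l(2) by blast
    qed
    then have "B w t < B w (real l / 2 ^ Suc (e + j))" using elim(2) l(3) by (metis linorder_neqE)
    moreover have "real l \<le> real (2 ^ Suc (e + j))" using l(1) by (simp only: of_nat_le_iff)
    then have "real l / 2 ^ Suc (e + j) \<in> {0..1}" by (simp add: divide_le_eq)
    ultimately show ?case unfolding t_def by blast
  qed
qed

text \<open>Two distinct maximizers are separated by some dyadic interval, and there are only countably many of
  these.\<close>

definition separated_maxima :: "nat \<Rightarrow> nat \<Rightarrow> (real \<Rightarrow> real) \<Rightarrow> bool" where
  "separated_maxima e0 a v \<longleftrightarrow> (\<exists>t1 t2. 0 \<le> t1 \<and> t1 \<le> real a / 2 ^ e0 \<and> real (a + 1) / 2 ^ e0 \<le> t2 \<and> t2 \<le> 1 \<and>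
     (\<forall>s\<in>{0..1}. v s \<le> v t1) \<and> (\<forall>s\<in>{0..1}. v s \<le> v t2))"

text \<open>By continuity the maxima over the grid points on the two sides of the interval approach the
  same value.\<close>

lemma separated_maxima_tie:
  assumes a: "a + 1 \<le> 2 ^ e0" and cont: "continuous_on UNIV v" and sep: "separated_maxima e0 a v" and \<epsilon>: "0 < \<epsilon>"
  shows "eventually (\<lambda>d. \<bar>Max ((\<lambda>k. v (real k / 2 ^ (e0 + d))) ` {..a * 2 ^ d})
      - Max ((\<lambda>k. v (real k / 2 ^ (e0 + d))) ` {(a + 1) * 2 ^ d..2 ^ (e0 + d)})\<bar> < \<epsilon>) sequentially"
proof -
  obtain t1 t2 where t: "0 \<le> t1" "t1 \<le> real a / 2 ^ e0" "real (a + 1) / 2 ^ e0 \<le> t2" "t2 \<le> 1"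
    and mx: "\<And>s. s \<in> {0..1} \<Longrightarrow> v s \<le> v t1" "\<And>s. s \<in> {0..1} \<Longrightarrow> v s \<le> v t2"
    using sep unfolding separated_maxima_def by blast
  have a1: "real (a + 1) / 2 ^ e0 \<le> 1"
  proof -
    have "real (a + 1) \<le> real (2 ^ e0)" using a by (simp only: of_nat_le_iff)
    then show ?thesis by (simp add: divide_le_eq)
  qed
  have aa: "real a / 2 ^ e0 \<le> real (a + 1) / 2 ^ e0" by (simp add: divide_right_mono)
  have a0: "0 \<le> real a / 2 ^ e0" by simp
  have "t1 \<le> 1" "0 \<le> t2" using t a1 aa a0 by linarith+
  then have t01: "t1 \<in> {0..1}" "t2 \<in> {0..1}" using t by simp_all
  then have eq: "v t1 = v t2" using mx[OF t01(1)] mx[OF t01(2)] mx(1)[OF t01(2)] mx(2)[OF t01(1)] by linarith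
  have near: "\<exists>d>0. \<forall>s. \<bar>s - t\<bar> < d \<longrightarrow> v t - \<epsilon> < v s" for t
  proof -
    have "\<forall>x\<in>UNIV. \<forall>e>0. \<exists>d>0. \<forall>x'\<in>UNIV. dist x' x < d \<longrightarrow> dist (v x') (v x) < e"
      using cont unfolding continuous_on_iff .
    then obtain d where "d > 0" "\<And>x'. dist x' t < d \<Longrightarrow> dist (v x') (v t) < \<epsilon>" using \<epsilon> by blast
    then have "d > 0" "\<And>x'. \<bar>x' - t\<bar> < d \<Longrightarrow> dist (v x') (v t) < \<epsilon>" by (auto simp: dist_real_def)
    moreover have "v t - \<epsilon> < v s" if "dist (v s) (v t) < \<epsilon>" for s
      using that unfolding dist_real_def by linarith
    ultimately show ?thesis by blast
  qed
  obtain d1 where d1: "0 < d1" "\<And>s. \<bar>s - t1\<bar> < d1 \<Longrightarrow> v t1 - \<epsilon> < v s" using near[of t1] by blast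
  obtain d2 where d2: "0 < d2" "\<And>s. \<bar>s - t2\<bar> < d2 \<Longrightarrow> v t2 - \<epsilon> < v s" using near[of t2] by blast
  have "(\<lambda>d. (1 / 2) ^ d :: real) \<longlonglongrightarrow> 0" by (intro LIMSEQ_realpow_zero) auto
  moreover have "0 < min d1 d2" using d1 d2 by simp
  ultimately have "eventually (\<lambda>d. (1 / 2) ^ d < min d1 d2) sequentially" by (rule order_tendstoD(2))
  then show ?thesis
  proof eventually_elim
    case (elim d)
    let ?N = "2 ^ (e0 + d) :: real"
    have "(2::real) ^ d \<le> ?N" by (rule power_increasing) auto
    then have "1 / ?N \<le> (1 / 2) ^ d" unfolding power_divide power_one by (intro divide_left_mono) auto
    then have small: "1 / ?N < d1" "1 / ?N < d2" using elim by auto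
    let ?L = "{..a * 2 ^ d}" and ?R = "{(a + 1) * 2 ^ d..2 ^ (e0 + d)} :: nat set"
    have anat: "(a + 1) * 2 ^ d \<le> 2 ^ (e0 + d)" unfolding power_add using a by (rule mult_le_mono1)
    have grid: "real k / ?N \<in> {0..1}" if "k \<le> 2 ^ (e0 + d)" for k :: nat
    proof -
      have "real k \<le> real (2 ^ (e0 + d))" using that by (simp only: of_nat_le_iff)
      then show ?thesis by (simp add: divide_le_eq)
    qed
    have ad: "real j / 2 ^ e0 * ?N = real (j * 2 ^ d)" for j by (simp add: power_add)
    define k1 where "k1 = nat \<lfloor>t1 * ?N\<rfloor>"
    have k1N: "real k1 \<le> t1 * ?N" "t1 * ?N < real k1 + 1" using t(1) by (auto simp: k1_def)
    then have k1: "real k1 / ?N \<le> t1" "t1 < real k1 / ?N + 1 / ?N"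
      by (simp_all add: divide_le_eq less_divide_eq add_divide_distrib[symmetric])
    have "t1 * ?N \<le> real a / 2 ^ e0 * ?N" using t(2) by (rule mult_right_mono) simp
    with k1N(1) have "real k1 \<le> real (a * 2 ^ d)" unfolding ad by linarith
    then have k1L: "k1 \<in> ?L" by (simp only: of_nat_le_iff atMost_iff)
    have v1: "v t1 - \<epsilon> < v (real k1 / ?N)" by (rule d1(2)) (use k1 small in linarith)
    define k2 where "k2 = nat \<lceil>t2 * ?N\<rceil>"
    have t2p: "0 \<le> t2" using t01 by simp
    have k2N: "t2 * ?N \<le> real k2" "real k2 < t2 * ?N + 1"
    proof -
      have "0 \<le> t2 * ?N" using t2p by simp
      then have "real k2 = of_int \<lceil>t2 * ?N\<rceil>" unfolding k2_def by simp
      then show "t2 * ?N \<le> real k2" "real k2 < t2 * ?N + 1" by linarith+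
    qed
    then have k2: "t2 \<le> real k2 / ?N" "real k2 / ?N < t2 + 1 / ?N"
      by (simp_all add: le_divide_eq divide_less_eq distrib_right)
    have "real (a + 1) / 2 ^ e0 * ?N \<le> t2 * ?N" using t(3) by (rule mult_right_mono) simp
    with k2N(1) have "real ((a + 1) * 2 ^ d) \<le> real k2" unfolding ad by linarith
    moreover have "t2 * ?N \<le> 1 * ?N" using t(4) by (intro mult_right_mono) auto
    then have "k2 \<le> 2 ^ (e0 + d)" unfolding k2_def by (simp add: nat_le_iff ceiling_le_iff)
    ultimately have k2R: "k2 \<in> ?R" by (simp only: of_nat_le_iff atLeastAtMost_iff)
    have v2: "v t2 - \<epsilon> < v (real k2 / ?N)" by (rule d2(2)) (use k2 small in linarith)
    let ?f = "\<lambda>k. v (real k / ?N)"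
    have L: "v t1 - \<epsilon> < Max (?f ` ?L)" "Max (?f ` ?L) \<le> v t1"
    proof -
      have "?f k1 \<le> Max (?f ` ?L)" using k1L by (intro Max_ge) auto
      then show "v t1 - \<epsilon> < Max (?f ` ?L)" using v1 by linarith
      have "?f k \<le> v t1" if "k \<in> ?L" for k
      proof (rule mx(1), rule grid)
        have "a * 2 ^ d \<le> (a + 1) * 2 ^ d" by simp
        then show "k \<le> 2 ^ (e0 + d)" using that anat by (meson atMost_iff order_trans)
      qed
      then show "Max (?f ` ?L) \<le> v t1" by (intro Max.boundedI) auto
    qed
    have R: "v t2 - \<epsilon> < Max (?f ` ?R)" "Max (?f ` ?R) \<le> v t2"
    proof -
      have "?f k2 \<le> Max (?f ` ?R)" using k2R by (intro Max_ge) auto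
      then show "v t2 - \<epsilon> < Max (?f ` ?R)" using v2 by linarith
      have "?f k \<le> v t2" if "k \<in> ?R" for k
        by (rule mx(2), rule grid) (use that in simp)
      then show "Max (?f ` ?R) \<le> v t2" using k2R by (intro Max.boundedI) auto
    qed
    show ?case using L R eq by linarith
  qed
qed

lemma BM_no_separated_maxima:
  assumes BM: "two_sided_BM M B" and a: "a + 1 \<le> 2 ^ e0"
  shows "AE w in M. \<not> separated_maxima e0 a (B w)"
proof -
  define G where "G \<epsilon> d = {w\<in>space M. \<bar>Max ((\<lambda>k. B w (real k / 2 ^ (e0 + d))) ` {..a * 2 ^ d})
      - Max ((\<lambda>k. B w (real k / 2 ^ (e0 + d))) ` {(a + 1) * 2 ^ d..2 ^ (e0 + d)})\<bar> < \<epsilon>}" for \<epsilon> d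
  have GM: "G \<epsilon> d \<in> sets M" for \<epsilon> d
  proof -
    have [measurable]: "(\<lambda>w. Max ((\<lambda>k. B w (real k / 2 ^ (e0 + d))) ` K)) \<in> borel_measurable M" if "finite K" for K
      using that by (rule borel_measurable_Max) (rule two_sided_BM_D(2)[OF BM])
    show ?thesis unfolding G_def by measurable
  qed
  have Gp: "prob (G \<epsilon> d) \<le> \<epsilon> * sqrt (2 ^ e0)" if \<epsilon>: "0 < \<epsilon>" for \<epsilon> d
  proof -
    let ?n = "2 ^ (e0 + d) :: nat" and ?m = "2 ^ d :: nat"
    interpret gw: gaussian_walk M "\<lambda>i w. inc ?n (B w) i" ?n by (rule BM_gaussian_walk[OF BM]) simp
    have S: "gw.S l w = sqrt (real ?n) * B w (real l / real ?n)" if "w \<in> space M" for l w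
      unfolding gw.S_def by (rule sum_inc) (rule two_sided_BM_D(3)[OF BM that])
    have sp: "0 < sqrt (real ?n)" by simp
    have mxs: "Max ((\<lambda>l. gw.S l w) ` K) = sqrt (real ?n) * Max ((\<lambda>k. B w (real k / 2 ^ (e0 + d))) ` K)"
      if "w \<in> space M" "finite K" "K \<noteq> {}" for w K
    proof -
      have "(\<lambda>l. gw.S l w) ` K = (\<lambda>x. sqrt (real ?n) * x) ` (\<lambda>k. B w (real k / 2 ^ (e0 + d))) ` K"
        unfolding image_image S[OF that(1)] by simp
      then show ?thesis using that(2,3) sp by (simp add: mono_Max_commute[symmetric] mono_def)
    qed
    have an: "a * 2 ^ d + ?m \<le> ?n" 
    proof -
      have "(a + 1) * 2 ^ d \<le> 2 ^ e0 * 2 ^ d" using a by (rule mult_le_mono1)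
      then show ?thesis by (simp add: power_add)
    qed
    have R: "{a * 2 ^ d + ?m..?n} \<noteq> {}" using an by simp
    have R': "a * 2 ^ d + ?m = (a + 1) * 2 ^ d" by simp
    have "G \<epsilon> d = {w\<in>space M. \<bar>Max ((\<lambda>k. gw.S k w) ` {..a * 2 ^ d}) - Max ((\<lambda>k. gw.S k w) ` {a * 2 ^ d + ?m..?n})\<bar> < sqrt (real ?n) * \<epsilon>}"
      unfolding G_def
    proof (intro Collect_cong conj_cong refl)
      fix w assume w: "w \<in> space M"
      have "\<bar>sqrt (real ?n) * x - sqrt (real ?n) * y\<bar> < sqrt (real ?n) * \<epsilon> \<longleftrightarrow> \<bar>x - y\<bar> < \<epsilon>" for x y
        unfolding right_diff_distrib[symmetric] abs_mult using sp by simp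
      moreover have "Max ((\<lambda>k. gw.S k w) ` {..a * 2 ^ d}) = sqrt (real ?n) * Max ((\<lambda>k. B w (real k / 2 ^ (e0 + d))) ` {..a * 2 ^ d})"
        by (rule mxs[OF w]) auto
      moreover have "Max ((\<lambda>k. gw.S k w) ` {a * 2 ^ d + ?m..?n}) = sqrt (real ?n) * Max ((\<lambda>k. B w (real k / 2 ^ (e0 + d))) ` {(a + 1) * 2 ^ d..2 ^ (e0 + d)})"
        unfolding R' by (rule mxs[OF w]) (use R in \<open>auto simp: R'\<close>)
      ultimately show "(\<bar>Max ((\<lambda>k. B w (real k / 2 ^ (e0 + d))) ` {..a * 2 ^ d})
        - Max ((\<lambda>k. B w (real k / 2 ^ (e0 + d))) ` {(a + 1) * 2 ^ d..2 ^ (e0 + d)})\<bar> < \<epsilon>)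
        = (\<bar>Max ((\<lambda>k. gw.S k w) ` {..a * 2 ^ d}) - Max ((\<lambda>k. gw.S k w) ` {a * 2 ^ d + ?m..?n})\<bar> < sqrt (real ?n) * \<epsilon>)"
        by (simp only:)
    qed
    also have "prob \<dots> \<le> sqrt (real ?n) * \<epsilon> / sqrt (real ?m)"
      by (rule gw.max_tie_bound[OF an]) (use \<epsilon> in auto)
    also have "\<dots> = \<epsilon> * sqrt (2 ^ e0)" by (simp add: power_add real_sqrt_mult)
    finally show ?thesis .
  qed
  define A where "A \<epsilon> = (\<Union>j. \<Inter>d\<in>{j..}. G \<epsilon> d)" for \<epsilon>
  have AM: "A \<epsilon> \<in> sets M" for \<epsilon> unfolding A_def using GM by (intro sets.countable_UN sets.countable_INT) auto
  have Ap: "prob (A \<epsilon>) \<le> \<epsilon> * sqrt (2 ^ e0)" if "0 < \<epsilon>" for \<epsilon>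
    using Gp[OF that] by (intro prob_le_if_eventually[OF AM GM] AE_I2 always_eventually) (auto simp: A_def eventually_sequentially)
  define Z where "Z = (\<Inter>n. A (1 / real (Suc n)))"
  have Z: "Z \<in> sets M" unfolding Z_def using AM by auto
  have Zb: "prob Z \<le> inverse (real (Suc n)) * sqrt (2 ^ e0)" for n
  proof -
    have "prob Z \<le> prob (A (1 / real (Suc n)))" by (rule finite_measure_mono) (use AM in \<open>auto simp: Z_def\<close>)
    also have "\<dots> \<le> 1 / real (Suc n) * sqrt (2 ^ e0)" by (rule Ap) simp
    finally show ?thesis by (simp add: inverse_eq_divide)
  qed
  have "(\<lambda>n. inverse (real (Suc n)) * sqrt (2 ^ e0)) \<longlonglongrightarrow> 0 * sqrt (2 ^ e0)"
    by (intro tendsto_mult LIMSEQ_inverse_real_of_nat tendsto_const)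
  then have "prob Z \<le> 0 * sqrt (2 ^ e0)" by (rule LIMSEQ_le_const) (use Zb in blast)
  then have "prob Z \<le> 0" by simp
  then have "prob Z = 0" using measure_nonneg[of M Z] by linarith
  then have "Z \<in> null_sets M" using Z by (simp add: null_sets_def emeasure_eq_measure)
  then have "AE w in M. w \<notin> Z" by (rule AE_not_in)
  then show ?thesis using AE_space
  proof eventually_elim
    case (elim w)
    show ?case
    proof
      assume sep: "separated_maxima e0 a (B w)"
      have "w \<in> A \<epsilon>" if "0 < \<epsilon>" for \<epsilon>
        using separated_maxima_tie[OF a two_sided_BM_D(4)[OF BM elim(2)] sep that] elim(2)
        unfolding A_def G_def eventually_sequentially by auto
      then have "w \<in> Z" by (simp add: Z_def)
      then show False using elim(1) by simp
    qed
  qed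
qed

lemma half_gap_step:
  fixes x h t1 t2 :: real
  assumes "x < t1 + h" "h < (t2 - t1) / 2"
  shows "x + h \<le> t2"
proof -
  have "2 * h < t2 - t1" using assms(2) by simp
  then show ?thesis using assms(1) by linarith
qed

theorem BM_unique_max:
  assumes BM: "two_sided_BM M B"
  shows "AE w in M. \<exists>t. unique_max (B w) t \<and> (\<forall>e k. k \<le> 2 ^ e \<longrightarrow> t \<noteq> real k / 2 ^ e)"
proof -
  have "AE w in M. k \<le> 2 ^ e \<longrightarrow> (\<exists>s\<in>{0..1}. B w (real k / 2 ^ e) < B w s)" for e k
    using BM_max_not_dyadic[OF BM, of k e] by (cases "k \<le> 2 ^ e") auto
  then have 1: "AE w in M. \<forall>e k. k \<le> 2 ^ e \<longrightarrow> (\<exists>s\<in>{0..1}. B w (real k / 2 ^ e) < B w s)"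
    unfolding AE_all_countable by blast
  have "AE w in M. a + 1 \<le> 2 ^ e0 \<longrightarrow> \<not> separated_maxima e0 a (B w)" for e0 a
    using BM_no_separated_maxima[OF BM, of a e0] by (cases "a + 1 \<le> 2 ^ e0") auto
  then have 2: "AE w in M. \<forall>e0 a. a + 1 \<le> 2 ^ e0 \<longrightarrow> \<not> separated_maxima e0 a (B w)"
    unfolding AE_all_countable by blast
  show ?thesis using 1 2 AE_space
  proof eventually_elim
    case (elim w)
    let ?v = "B w"
    have "continuous_on {0..1} ?v" by (rule continuous_on_subset[OF two_sided_BM_D(4)[OF BM elim(3)]]) simp
    then have "\<exists>t\<in>{0..1}. \<forall>s\<in>{0..1}. ?v s \<le> ?v t" by (intro continuous_attains_sup) auto
    then obtain t where t: "t \<in> {0..1}" "\<And>s. s \<in> {0..1} \<Longrightarrow> ?v s \<le> ?v t" by blast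
    have nosep: False if "t1 \<in> {0..1}" "t2 \<in> {0..1}" "t1 < t2" "\<And>s. s \<in> {0..1} \<Longrightarrow> ?v s \<le> ?v t1" "\<And>s. s \<in> {0..1} \<Longrightarrow> ?v s \<le> ?v t2" for t1 t2
    proof -
      have "(\<lambda>d. (1 / 2) ^ d :: real) \<longlonglongrightarrow> 0" by (intro LIMSEQ_realpow_zero) auto
      moreover have "0 < (t2 - t1) / 2" using that by simp
      ultimately have "eventually (\<lambda>d. (1 / 2) ^ d < (t2 - t1) / 2) sequentially" by (rule order_tendstoD(2))
      then obtain e0 where "(1 / 2) ^ e0 < (t2 - t1) / 2" by (auto simp: eventually_sequentially)
      then have e0: "1 / 2 ^ e0 < (t2 - t1) / 2" by (simp add: power_divide)
      define a where "a = nat \<lceil>t1 * 2 ^ e0\<rceil>"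
      have t1: "0 \<le> t1" using that by simp
      have "0 \<le> t1 * 2 ^ e0" using t1 by simp
      then have "real a = of_int \<lceil>t1 * 2 ^ e0\<rceil>" unfolding a_def by simp
      then have "t1 * 2 ^ e0 \<le> real a" "real a < t1 * 2 ^ e0 + 1" by linarith+
      then have a: "t1 \<le> real a / 2 ^ e0" "real a / 2 ^ e0 < t1 + 1 / 2 ^ e0"
        by (simp_all add: le_divide_eq divide_less_eq distrib_right)
      have a1: "real (a + 1) / 2 ^ e0 = real a / 2 ^ e0 + 1 / 2 ^ e0" by (simp add: add_divide_distrib)
      have le: "real (a + 1) / 2 ^ e0 \<le> t2"
        unfolding a1 by (rule half_gap_step[OF a(2) e0])
      have t2: "t2 \<le> 1" using that by simp
      have "real (a + 1) / 2 ^ e0 \<le> 1" using le t2 by linarith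
      then have "real (a + 1) \<le> real (2 ^ e0)" by (simp add: divide_le_eq)
      then have "a + 1 \<le> 2 ^ e0" by (simp only: of_nat_le_iff)
      moreover have "separated_maxima e0 a ?v"
        unfolding separated_maxima_def using t1 t2 le a(1) that(4,5) by blast
      ultimately show False using elim(2) by blast
    qed
    have "?v s < ?v t" if s: "s \<in> {0..1}" "s \<noteq> t" for s
    proof (rule ccontr)
      assume "\<not> ?v s < ?v t"
      then have "?v s = ?v t" using t(2)[OF s(1)] by simp
      then have "\<And>r. r \<in> {0..1} \<Longrightarrow> ?v r \<le> ?v s" using t(2) by simp
      then show False using nosep[of s t] nosep[of t s] s t by (metis linorder_neqE)
    qed
    then have u: "unique_max ?v t" using t by (auto simp: unique_max_def)
    have "t \<noteq> real k / 2 ^ e" if "k \<le> 2 ^ e" for e k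
      using elim(1) that t(2) by (metis not_less)
    then show ?case using u by blast
  qed
qed

end

section \<open>Both grid maxima in the same block\<close>

definition walk_values :: "nat \<Rightarrow> (nat \<Rightarrow> real) \<Rightarrow> dyadic_values" where
  "walk_values l x e k = (\<Sum>i<k * 2 ^ (l - e). x i) / sqrt (2 ^ l)"

lemma dyadic_index_le:
  assumes "e \<le> l" "k \<le> (2::nat) ^ e"
  shows "k * 2 ^ (l - e) \<le> 2 ^ l"
proof -
  have "k * 2 ^ (l - e) \<le> 2 ^ e * 2 ^ (l - e)" using assms(2) by (rule mult_le_mono1)
  then show ?thesis using assms(1) by (simp add: power_add[symmetric])
qed

lemma dyadic_point:
  assumes "e \<le> l"
  shows "real (k * 2 ^ (l - e)) / real (2 ^ l) = real k / 2 ^ e"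
proof -
  have "(2::real) ^ l = 2 ^ e * 2 ^ (l - e)" using assms by (simp add: power_add[symmetric])
  then show ?thesis by simp
qed

lemma le_mult_if_power_le:
  fixes P p \<delta> :: real
  assumes "P ^ K \<le> p ^ Suc K" "p \<le> \<delta> ^ K" "0 < K" "0 \<le> p" "0 \<le> \<delta>"
  shows "P \<le> p * \<delta>"
proof (rule ccontr)
  assume "\<not> P \<le> p * \<delta>"
  then have "(p * \<delta>) ^ K < P ^ K" using assms by (intro power_strict_mono) auto
  moreover have "p ^ Suc K \<le> p ^ K * \<delta> ^ K" unfolding power_Suc2 by (intro mult_left_mono assms zero_le_power)
  ultimately show False using assms(1) by (simp add: power_mult_distrib)
qed

context bm_pair
begin

definition patched_values :: "(nat \<Rightarrow> bool) \<Rightarrow> nat \<Rightarrow> 'w \<Rightarrow> dyadic_values" where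
  "patched_values \<kappa> l w e k = patched (2 ^ l) \<kappa> (W w) (W' w) (k * 2 ^ (l - e))"

lemma W_measurable[measurable]: "(\<lambda>w. W w t) \<in> borel_measurable Q" "(\<lambda>w. W' w t) \<in> borel_measurable Q"
  using two_sided_BM_D(2)[OF BM] two_sided_BM_D(2)[OF BM'] by auto

lemma patched_values_measurable[measurable]: "(\<lambda>w. patched_values \<kappa> l w e k) \<in> borel_measurable Q"
  unfolding patched_values_def patched_def by measurable

lemma path_values_measurable[measurable]: "(\<lambda>w. path_values (W w) e k) \<in> borel_measurable Q"
  unfolding path_values_def by measurable

lemma patched_values_walk:
  assumes "e \<le> l" "k \<le> 2 ^ e"
  shows "patched_values \<kappa> l w e k = walk_values l (\<lambda>i\<in>{..<2 ^ l}. cell_inc (2 ^ l) (i, \<not> \<kappa> i) w) e k"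
proof -
  let ?j = "k * 2 ^ (l - e)"
  have "(\<Sum>i<?j. (\<lambda>i\<in>{..<2 ^ l}. cell_inc (2 ^ l) (i, \<not> \<kappa> i) w) i) = (\<Sum>i<?j. cell_inc (2 ^ l) (i, \<not> \<kappa> i) w)"
    using dyadic_index_le[OF assms] by (intro sum.cong) auto
  also have "\<dots> = sqrt (real (2 ^ l)) * patched (2 ^ l) \<kappa> (W w) (W' w) ?j" by (rule sum_cell_inc_patched)
  finally show ?thesis unfolding walk_values_def patched_values_def by simp
qed

lemma patched_values_all_kept:
  assumes "w \<in> space Q" "e \<le> l"
  shows "patched_values (\<lambda>_. True) l w e k = path_values (W w) e k"
proof -
  let ?j = "k * 2 ^ (l - e)"
  have "sqrt (real (2 ^ l)) * patched (2 ^ l) (\<lambda>_. True) (W w) (W' w) ?j = (\<Sum>i<?j. inc (2 ^ l) (W w) i)"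
    unfolding sum_cell_inc_patched[symmetric] by (simp add: cell_inc_def)
  also have "\<dots> = sqrt (real (2 ^ l)) * W w (real ?j / real (2 ^ l))"
    by (rule sum_inc) (rule two_sided_BM_D(3)[OF BM assms(1)])
  finally show ?thesis unfolding patched_values_def path_values_def dyadic_point[OF assms(2)] by simp
qed

text \<open>Replacing increments of one Brownian motion by those of an independent one does not change the
  law of the walk.\<close>

lemma bad_patched_law:
  assumes l: "max e e1 \<le> l"
  shows "prob {w\<in>space Q. bad c e \<epsilon> e1 (patched_values \<kappa> l w)} = prob {w\<in>space Q. bad c e \<epsilon> e1 (path_values (W w))}"
proof -
  define Bs where "Bs = {x\<in>space seqs. bad c e \<epsilon> e1 (walk_values l x)}"
  have Bs: "Bs \<in> sets seqs" unfolding Bs_def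
    by (rule bad_measurable) (unfold walk_values_def, measurable)
  have *: "emeasure Q {w\<in>space Q. bad c e \<epsilon> e1 (patched_values \<kappa> l w)} = (\<integral>\<^sup>+x. indicator Bs x \<partial>gausses (2 ^ l))" for \<kappa>
  proof -
    have "bad c e \<epsilon> e1 (patched_values \<kappa> l w) \<longleftrightarrow> (\<lambda>i\<in>{..<2 ^ l}. cell_inc (2 ^ l) (i, \<not> \<kappa> i) w) \<in> Bs" for w
    proof -
      have "bad c e \<epsilon> e1 (patched_values \<kappa> l w) = bad c e \<epsilon> e1 (walk_values l (\<lambda>i\<in>{..<2 ^ l}. cell_inc (2 ^ l) (i, \<not> \<kappa> i) w))"
        by (rule bad_cong) (rule patched_values_walk, use l in auto)
      then show ?thesis unfolding Bs_def by simp
    qed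
    then have "(\<integral>\<^sup>+w. indicator Bs (\<lambda>i\<in>{..<2 ^ l}. cell_inc (2 ^ l) (i, \<not> \<kappa> i) w) \<partial>Q)
      = (\<integral>\<^sup>+w. indicator {w\<in>space Q. bad c e \<epsilon> e1 (patched_values \<kappa> l w)} w \<partial>Q)"
      by (intro nn_integral_cong) (simp add: indicator_def)
    also have "\<dots> = emeasure Q {w\<in>space Q. bad c e \<epsilon> e1 (patched_values \<kappa> l w)}"
      by (rule nn_integral_indicator) (rule bad_measurable, rule patched_values_measurable)
    finally show ?thesis using patched_inc_law[of "2 ^ l" "indicator Bs" \<kappa>] Bs by simp
  qed
  have "bad c e \<epsilon> e1 (patched_values (\<lambda>_. True) l w) = bad c e \<epsilon> e1 (path_values (W w))" if "w \<in> space Q" for w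
    by (rule bad_cong) (rule patched_values_all_kept[OF that], use l in auto)
  then have "{w\<in>space Q. bad c e \<epsilon> e1 (patched_values (\<lambda>_. True) l w)} = {w\<in>space Q. bad c e \<epsilon> e1 (path_values (W w))}"
    by blast
  then have "emeasure Q {w\<in>space Q. bad c e \<epsilon> e1 (patched_values \<kappa> l w)} = emeasure Q {w\<in>space Q. bad c e \<epsilon> e1 (path_values (W w))}"
    using *[of \<kappa>] *[of "\<lambda>_. True"] by simp
  then show ?thesis by (simp add: measure_def)
qed

lemma top_in_prob_bound:
  assumes c: "2 \<le> c" "c \<le> e"
  shows "prob {w\<in>space Q. top_in c e i (path_values (W w))} \<le> 2 * sqrt 2 / sqrt (2 ^ (c - 2))"
proof (cases "i < 2 ^ c")
  case True
  define b q :: nat where "b = 2 ^ (e - c)" and "q = 2 ^ (c - 2)"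
  have qc: "4 * q = 2 ^ c" 
  proof -
    have "(2::nat) ^ c = 2 ^ (2 + (c - 2))" by (simp only: le_add_diff_inverse[OF c(1)])
    then show ?thesis unfolding power_add q_def by simp
  qed
  have n: "2 ^ e = 4 * q * b" unfolding qc b_def using c by (simp add: power_add[symmetric])
  have b: "0 < b" by (simp add: b_def)
  interpret gw: gaussian_walk Q "\<lambda>i w. inc (2 ^ e) (W w) i" "2 ^ e" by (rule BM_gaussian_walk[OF BM]) simp
  have S: "gw.S k w = sqrt (real (2 ^ e)) * path_values (W w) e k" if "w \<in> space Q" for k w
  proof -
    have "gw.S k w = sqrt (real (2 ^ e)) * W w (real k / real (2 ^ e))"
      unfolding gw.S_def by (rule sum_inc) (rule two_sided_BM_D(3)[OF BM that])
    then show ?thesis unfolding path_values_def by simp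
  qed
  have "top_in c e i (path_values (W w)) \<longleftrightarrow> (\<exists>k\<in>block c e i. \<forall>l\<le>2 ^ e. l \<noteq> k \<longrightarrow> gw.S l w < gw.S k w)" if "w \<in> space Q" for w
    unfolding top_in_def S[OF that] by (simp only: mult_less_cancel_left_pos[OF real_sqrt_gt_zero] of_nat_0_less_iff zero_less_power zero_less_numeral)
  then have e: "{w\<in>space Q. top_in c e i (path_values (W w))} = {w\<in>space Q. \<exists>k\<in>block c e i. \<forall>l\<le>2 ^ e. l \<noteq> k \<longrightarrow> gw.S l w < gw.S k w}"
    by (intro Collect_cong conj_cong refl) 
  have "prob {w\<in>space Q. top_in c e i (path_values (W w))} \<le> 2 * sqrt (real b + 1) / sqrt (real (q * b))"
    unfolding e
  proof (rule gw.argmax_in_block_bound[OF n b])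
    show "i < 4 * q" unfolding qc by (rule True)
    show "i * b \<le> k \<and> k \<le> (i + 1) * b" if "k \<in> block c e i" for k
      using block_bounds(2,3)[OF c(2) that] unfolding b_def by blast
  qed
  also have "\<dots> \<le> 2 * sqrt (2 * real b) / sqrt (real (q * b))"
    using b by (intro divide_right_mono mult_left_mono) auto
  also have "\<dots> = 2 * sqrt 2 / sqrt (real q)" using b by (simp add: real_sqrt_mult)
  finally show ?thesis by (simp add: q_def)
next
  case False
  then have "block c e i = {}" using block_bounds(1)[OF c(2)] by blast
  then show ?thesis by (simp add: top_in_def)
qed

lemma grid_blocks_sum:
  assumes "e \<le> l" "k \<le> 2 ^ e"
  shows "(\<Sum>j<k. (\<lambda>k\<in>{..<2 ^ e}. (\<Sum>i\<in>{k * 2 ^ (l - e)..<k * 2 ^ (l - e) + 2 ^ (l - e)}. cell_inc (2 ^ l) (i, \<not> \<kappa> i) w) / sqrt (real (2 ^ (l - e)))) j)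
    = sqrt (2 ^ e) * patched_values \<kappa> l w e k"
proof -
  let ?m = "2 ^ (l - e) :: nat"
  let ?g = "\<lambda>i. cell_inc (2 ^ l) (i, \<not> \<kappa> i) w"
  have "(\<Sum>j<k. (\<lambda>k\<in>{..<2 ^ e}. (\<Sum>i\<in>{k * ?m..<k * ?m + ?m}. ?g i) / sqrt (real ?m)) j)
    = (\<Sum>j<k. (\<Sum>i\<in>{j * ?m..<j * ?m + ?m}. ?g i) / sqrt (real ?m))"
    using assms(2) by (intro sum.cong) auto
  also have "\<dots> = (\<Sum>i<k * ?m. ?g i) / sqrt (real ?m)"
    unfolding sum_divide_distrib[symmetric] sum.nat_group ..
  also have "\<dots> = sqrt (real (2 ^ l)) / sqrt (real ?m) * patched_values \<kappa> l w e k"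
    unfolding sum_cell_inc_patched patched_values_def by simp
  also have "sqrt (real (2 ^ l)) / sqrt (real ?m) = sqrt (2 ^ e)"
  proof -
    have "(2::real) ^ l = 2 ^ e * 2 ^ (l - e)" using assms(1) by (simp add: power_add[symmetric])
    then show ?thesis by (simp add: real_sqrt_mult)
  qed
  finally show ?thesis .
qed

text \<open>Let \<open>p\<^sub>i\<close> be the probability that the grid maximum of \<open>W\<close> lies in block \<open>i\<close>.  Noise stability bounds the
  probability that both grid maxima lie there by \<open>\<delta> p\<^sub>i\<close>, as soon as \<open>p\<^sub>i \<le> \<delta> ^ K\<close>, which the arcsine
  bound ensures for a large number of blocks.  Since \<open>\<Sum> p\<^sub>i \<le> 1\<close>, the total is at most \<open>\<delta>\<close>.  The
  number of blocks depends only on \<open>\<rho>\<close> and \<open>\<delta>\<close>, not on the grid or on the cells that are refreshed.\<close>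

lemma same_block_probability:
  assumes \<rho>: "0 \<le> \<rho>" "\<rho> < 1" and \<delta>: "0 < \<delta>"
  obtains c where "2 \<le> c" "\<And>e l \<kappa>. c \<le> e \<Longrightarrow> e \<le> l \<Longrightarrow>
      (\<And>k. k < 2 ^ e \<Longrightarrow> \<exists>i\<in>{k * 2 ^ (l - e)..<k * 2 ^ (l - e) + 2 ^ (l - e)}. \<not> \<kappa> i) \<Longrightarrow>
      (\<And>k. k < 2 ^ e \<Longrightarrow> card {i\<in>{k * 2 ^ (l - e)..<k * 2 ^ (l - e) + 2 ^ (l - e)}. \<kappa> i} / real (2 ^ (l - e)) \<le> \<rho>) \<Longrightarrow>
      prob {w\<in>space Q. \<exists>i<2 ^ c. top_in c e i (path_values (W w)) \<and> top_in c e i (patched_values \<kappa> l w)} \<le> \<delta>"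
proof -
  obtain K where K: "K > 0" and stab: "\<And>(n::nat) r A. (\<And>i. i < n \<Longrightarrow> 0 \<le> r i \<and> r i \<le> \<rho>) \<Longrightarrow> A \<in> sets seqs \<Longrightarrow>
      (stability n r (indicator A)) ^ K \<le> (\<integral>\<^sup>+x. indicator A x \<partial>gausses n) ^ Suc K"
    using stability_small_sets[OF \<rho>] by blast
  have "(\<lambda>j. 2 * sqrt 2 * (1 / sqrt 2) ^ j) \<longlonglongrightarrow> 2 * sqrt 2 * 0"
    by (intro tendsto_mult tendsto_const LIMSEQ_realpow_zero) auto
  moreover have "2 * sqrt 2 * 0 < \<delta> ^ K" using \<delta> by simp
  ultimately have "eventually (\<lambda>j. 2 * sqrt 2 * (1 / sqrt 2) ^ j < \<delta> ^ K) sequentially" by (rule order_tendstoD(2))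
  then obtain j where j: "2 * sqrt 2 * (1 / sqrt 2) ^ j < \<delta> ^ K" by (auto simp: eventually_sequentially)
  define c where "c = j + 2"
  have c2: "2 \<le> c" by (simp add: c_def)
  have cd: "2 * sqrt 2 / sqrt (2 ^ (c - 2)) \<le> \<delta> ^ K" using j unfolding c_def by (simp add: real_sqrt_power power_divide)
  show ?thesis
  proof (rule that[OF c2])
    fix e l :: nat and \<kappa> :: "nat \<Rightarrow> bool"
    let ?m = "2 ^ (l - e) :: nat"
    assume e: "c \<le> e" and l: "e \<le> l"
      and removed: "\<And>k. k < 2 ^ e \<Longrightarrow> \<exists>i\<in>{k * ?m..<k * ?m + ?m}. \<not> \<kappa> i"
      and kept: "\<And>k. k < 2 ^ e \<Longrightarrow> card {i\<in>{k * ?m..<k * ?m + ?m}. \<kappa> i} / real ?m \<le> \<rho>"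
    define r where "r k = card {i\<in>{k * ?m..<k * ?m + ?m}. \<kappa> i} / real ?m" for k
    have nm: "2 ^ e * ?m = 2 ^ l" using l by (simp add: power_add[symmetric])
    define p where "p i = prob {w\<in>space Q. top_in c e i (path_values (W w))}" for i
    define D where "D i = {w\<in>space Q. top_in c e i (path_values (W w)) \<and> top_in c e i (patched_values \<kappa> l w)}" for i
    have tm: "{w\<in>space Q. top_in c e i (path_values (W w))} \<in> sets Q" "{w\<in>space Q. top_in c e i (patched_values \<kappa> l w)} \<in> sets Q" for i
      by (rule top_in_measurable, rule path_values_measurable)
        (rule top_in_measurable, rule patched_values_measurable)
    have DM: "D i \<in> sets Q" for i
    proof -
      have "D i = {w\<in>space Q. top_in c e i (path_values (W w))} \<inter> {w\<in>space Q. top_in c e i (patched_values \<kappa> l w)}"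
        unfolding D_def by blast
      then show ?thesis using tm by simp
    qed
    have Dp: "prob (D i) \<le> p i * \<delta>" for i
    proof -
      define A where "A = {x\<in>space seqs. top_in c e i (\<lambda>_ k. \<Sum>j<k. x j)}"
      have A: "A \<in> sets seqs" unfolding A_def by (rule top_in_measurable) measurable
      let ?F = "\<lambda>w. \<lambda>k\<in>{..<2 ^ e}. inc (2 ^ e) (W w) k"
      let ?G = "\<lambda>w. \<lambda>k\<in>{..<2 ^ e}. (\<Sum>i\<in>{k * ?m..<k * ?m + ?m}. cell_inc (2 ^ l) (i, \<not> \<kappa> i) w) / sqrt (real ?m)"
      have F: "?F w \<in> A \<longleftrightarrow> top_in c e i (path_values (W w))" if "w \<in> space Q" for w
      proof -
        have "(\<Sum>j<k. ?F w j) = sqrt (2 ^ e) * path_values (W w) e k" if "k \<le> 2 ^ e" for k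
        proof -
          have "(\<Sum>j<k. ?F w j) = (\<Sum>j<k. inc (2 ^ e) (W w) j)" using that by (intro sum.cong) auto
          also have "\<dots> = sqrt (real (2 ^ e)) * W w (real k / real (2 ^ e))"
            by (rule sum_inc) (rule two_sided_BM_D(3)[OF BM \<open>w \<in> space Q\<close>])
          finally show ?thesis unfolding path_values_def by simp
        qed
        then have "top_in c e i (\<lambda>_ k. \<Sum>j<k. ?F w j) = top_in c e i (path_values (W w))"
          by (rule top_in_cong) simp_all
        then show ?thesis unfolding A_def by simp
      qed
      have G: "?G w \<in> A \<longleftrightarrow> top_in c e i (patched_values \<kappa> l w)" for w
      proof -
        have "top_in c e i (\<lambda>_ k. \<Sum>j<k. ?G w j) = top_in c e i (patched_values \<kappa> l w)"
          by (rule top_in_cong, rule grid_blocks_sum[OF l]) simp_all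
        then show ?thesis unfolding A_def by simp
      qed
      have "(\<integral>\<^sup>+w. indicator A (?F w) * indicator A (?G w) \<partial>Q) = stability (2 ^ e) r (indicator A)"
        using pair_stability[of "2 ^ e" ?m \<kappa> r A] removed r_def A unfolding nm by simp
      also have "(\<integral>\<^sup>+w. indicator A (?F w) * indicator A (?G w) \<partial>Q) = (\<integral>\<^sup>+w. indicator (D i) w \<partial>Q)"
        
          unfolding D_def indicator_def by (intro nn_integral_cong, simp only: F G) simp
      finally have DS: "ennreal (prob (D i)) = stability (2 ^ e) r (indicator A)" using DM by (simp add: emeasure_eq_measure)
      have "(\<integral>\<^sup>+w. indicator A (\<lambda>i\<in>{..<2 ^ e}. cell_inc (2 ^ e) (i, \<not> (\<lambda>_. True) i) w) \<partial>Q) = (\<integral>\<^sup>+x. indicator A x \<partial>gausses (2 ^ e))"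
        by (rule patched_inc_law) (use A in auto)
      also have "(\<integral>\<^sup>+w. indicator A (\<lambda>i\<in>{..<2 ^ e}. cell_inc (2 ^ e) (i, \<not> (\<lambda>_. True) i) w) \<partial>Q)
        = (\<integral>\<^sup>+w. indicator {w\<in>space Q. top_in c e i (path_values (W w))} w \<partial>Q)"
        by (intro nn_integral_cong) (simp add: cell_inc_def F[symmetric] indicator_def)
      finally have pS: "ennreal (p i) = (\<integral>\<^sup>+x. indicator A x \<partial>gausses (2 ^ e))" using tm(1) by (simp add: emeasure_eq_measure p_def)
      have "ennreal (prob (D i)) ^ K \<le> ennreal (p i) ^ Suc K"
        unfolding DS pS by (rule stab[OF _ A]) (use kept r_def in auto)
      then have "ennreal (prob (D i) ^ K) \<le> ennreal (p i ^ Suc K)"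
        by (simp only: ennreal_power measure_nonneg p_def)
      then have "prob (D i) ^ K \<le> p i ^ Suc K" by (subst (asm) ennreal_le_iff) (simp_all add: p_def)
      moreover have "p i \<le> \<delta> ^ K" unfolding p_def using top_in_prob_bound[OF c2 e, of i] cd by linarith
      ultimately show ?thesis by (rule le_mult_if_power_le) (use K \<delta> in \<open>auto simp: p_def\<close>)
    qed
    have "{w\<in>space Q. \<exists>i<2 ^ c. top_in c e i (path_values (W w)) \<and> top_in c e i (patched_values \<kappa> l w)} = (\<Union>i\<in>{..<2 ^ c}. D i)"
      unfolding D_def by blast
    then have "prob {w\<in>space Q. \<exists>i<2 ^ c. top_in c e i (path_values (W w)) \<and> top_in c e i (patched_values \<kappa> l w)} \<le> (\<Sum>i\<in>{..<2 ^ c}. prob (D i))"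
      using finite_measure_subadditive_finite[of "{..<2 ^ c}" D] DM by auto
    also have "\<dots> \<le> (\<Sum>i\<in>{..<2 ^ c}. p i * \<delta>)" by (intro sum_mono Dp)
    also have "\<dots> = (\<Sum>i\<in>{..<2 ^ c}. p i) * \<delta>" by (rule sum_distrib_right[symmetric])
    also have "(\<Sum>i\<in>{..<2 ^ c}. p i) = prob (\<Union>i\<in>{..<2 ^ c}. {w\<in>space Q. top_in c e i (path_values (W w))})"
      unfolding p_def
    proof (rule finite_measure_finite_Union[symmetric])
      show "disjoint_family_on (\<lambda>i. {w\<in>space Q. top_in c e i (path_values (W w))}) {..<2 ^ c}"
        unfolding disjoint_family_on_def using leads_unique[OF top_in_leads top_in_leads] by blast
    qed (use tm in auto)
    also have "\<dots> * \<delta> \<le> 1 * \<delta>" using \<delta> by (intro mult_right_mono prob_le_1) auto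
    finally show "prob {w\<in>space Q. \<exists>i<2 ^ c. top_in c e i (path_values (W w)) \<and> top_in c e i (patched_values \<kappa> l w)} \<le> \<delta>" by simp
  qed
qed

end

section \<open>From grid maxima to maximizers\<close>

lemma (in prob_space) prob_tendsto_0:
  assumes A: "\<And>n. A n \<in> sets M" and AE: "AE w in M. eventually (\<lambda>n. w \<notin> A n) sequentially"
  shows "(\<lambda>n. prob (A n)) \<longlonglongrightarrow> 0"
proof -
  define C where "C j = (\<Union>n\<in>{j..}. A n)" for j :: nat
  have C: "C j \<in> sets M" for j unfolding C_def using A by (intro sets.countable_UN) auto
  have "decseq C" unfolding decseq_def C_def by (intro allI impI UN_mono) auto
  then have "(\<lambda>j. prob (C j)) \<longlonglongrightarrow> prob (\<Inter>j. C j)" using C by (intro finite_Lim_measure_decseq) auto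
  moreover have "prob (\<Inter>j. C j) = 0"
  proof -
    have "AE w in M. w \<notin> (\<Inter>j. C j)"
      using AE by eventually_elim (auto simp: C_def eventually_sequentially)
    moreover have "(\<Inter>j. C j) \<in> sets M" using C by auto
    ultimately show ?thesis by (simp only: prob_eq_0)
  qed
  ultimately have "(\<lambda>j. prob (C j)) \<longlonglongrightarrow> 0" by simp
  then show ?thesis
  proof (rule tendsto_sandwich[OF _ _ tendsto_const, rotated 2])
    show "eventually (\<lambda>n. prob (A n) \<le> prob (C n)) sequentially"
      by (intro always_eventually allI finite_measure_mono C) (auto simp: C_def)
  qed simp
qed

definition blocks_refreshed :: "nat \<Rightarrow> real \<Rightarrow> nat \<Rightarrow> (nat \<Rightarrow> bool) \<Rightarrow> bool" where
  "blocks_refreshed e \<eta> l \<kappa> \<longleftrightarrow> (\<forall>k<2 ^ e.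
     (\<exists>i\<in>{k * 2 ^ (l - e)..<k * 2 ^ (l - e) + 2 ^ (l - e)}. \<not> \<kappa> i) \<and>
     card {i\<in>{k * 2 ^ (l - e)..<k * 2 ^ (l - e) + 2 ^ (l - e)}. \<kappa> i} / real (2 ^ (l - e)) \<le> 1 - \<eta>)"

context bm_pair
begin

lemma near_tie_small:
  "(\<lambda>n. prob {w\<in>space Q. near_tie e (1 / real (Suc n)) (path_values (W w))}) \<longlonglongrightarrow> 0"
proof (rule prob_tendsto_0)
  show "{w\<in>space Q. near_tie e (1 / real (Suc n)) (path_values (W w))} \<in> sets Q" for n
    by (rule near_tie_measurable) (rule path_values_measurable)
  have "AE w in Q. k \<noteq> l \<longrightarrow> path_values (W w) e k \<noteq> path_values (W w) e l" for k l
  proof (cases "k = l")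
    case False
    then have "real k / 2 ^ e \<noteq> real l / 2 ^ e" by simp
    from BM_no_ties[OF BM this] show ?thesis unfolding path_values_def by eventually_elim simp
  qed simp
  then have "AE w in Q. \<forall>k l. k \<noteq> l \<longrightarrow> path_values (W w) e k \<noteq> path_values (W w) e l"
    unfolding AE_all_countable by blast
  then show "AE w in Q. eventually (\<lambda>n. w \<notin> {w\<in>space Q. near_tie e (1 / real (Suc n)) (path_values (W w))}) sequentially"
  proof eventually_elim
    case (elim w)
    let ?y = "path_values (W w) e"
    have "eventually (\<lambda>n. \<forall>p\<in>{..2 ^ e} \<times> {..2 ^ e}. fst p \<noteq> snd p \<longrightarrow> 1 / real (Suc n) < \<bar>?y (fst p) - ?y (snd p)\<bar>) sequentially"
    proof (rule eventually_ball_finite)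
      show "\<forall>p\<in>{..2 ^ e} \<times> {..2 ^ e}. eventually (\<lambda>n. fst p \<noteq> snd p \<longrightarrow> 1 / real (Suc n) < \<bar>?y (fst p) - ?y (snd p)\<bar>) sequentially"
      proof
        fix p :: "nat \<times> nat"
        show "eventually (\<lambda>n. fst p \<noteq> snd p \<longrightarrow> 1 / real (Suc n) < \<bar>?y (fst p) - ?y (snd p)\<bar>) sequentially"
        proof (cases "fst p = snd p")
          case False
          then have "0 < \<bar>?y (fst p) - ?y (snd p)\<bar>" using elim by simp
          then have "eventually (\<lambda>n. inverse (real (Suc n)) < \<bar>?y (fst p) - ?y (snd p)\<bar>) sequentially"
            by (rule order_tendstoD(2)[OF LIMSEQ_inverse_real_of_nat])
          then show ?thesis by eventually_elim (simp add: inverse_eq_divide)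
        qed simp
      qed
    qed simp
    then show ?case
    proof eventually_elim
      case (elim n)
      have "\<not> near_tie e (1 / real (Suc n)) (path_values (W w))"
      proof
        assume "near_tie e (1 / real (Suc n)) (path_values (W w))"
        then obtain k l where k: "k \<le> 2 ^ e" "l \<le> 2 ^ e" "k \<noteq> l" "\<bar>?y k - ?y l\<bar> < 1 / real (Suc n)"
          unfolding near_tie_def by blast
        have "(k, l) \<in> {..2 ^ e} \<times> {..2 ^ e}" using k by simp
        from bspec[OF elim this] k show False by simp
      qed
      then show ?case by blast
    qed
  qed
qed

lemma conflict_small:
  "(\<lambda>e. prob {w\<in>space Q. \<exists>e'\<in>{e..}. conflict c e e' (path_values (W w))}) \<longlonglongrightarrow> 0"
proof (rule prob_tendsto_0)
  show "{w\<in>space Q. \<exists>e'\<in>{e..}. conflict c e e' (path_values (W w))} \<in> sets Q" for e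
    by (intro sets.sets_Collect_countable_Ex' conflict_measurable path_values_measurable) auto
  show "AE w in Q. eventually (\<lambda>e. w \<notin> {w\<in>space Q. \<exists>e'\<in>{e..}. conflict c e e' (path_values (W w))}) sequentially"
    using BM_unique_max[OF BM] AE_space
  proof eventually_elim
    case (elim w)
    then obtain t where t: "unique_max (W w) t" "\<And>e k. k \<le> 2 ^ e \<Longrightarrow> t \<noteq> real k / 2 ^ e" by blast
    have cont: "continuous_on {0..1} (W w)"
      by (rule continuous_on_subset[OF two_sided_BM_D(4)[OF BM elim(2)]]) simp
    obtain N where N: "\<And>e. N \<le> e \<Longrightarrow> leads c e (nat \<lfloor>t * 2 ^ c\<rfloor>) (path_values (W w))"
      using unique_max_leads[OF cont t(1) t(2)[of _ c]] unfolding eventually_sequentially by blast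
    have "\<not> conflict c e e' (path_values (W w))" if "N \<le> e" "e \<le> e'" for e e'
    proof
      assume "conflict c e e' (path_values (W w))"
      then obtain i i' where i: "i \<noteq> i'" "top_in c e i (path_values (W w))" "leads c e' i' (path_values (W w))"
        unfolding conflict_def by blast
      have "i = nat \<lfloor>t * 2 ^ c\<rfloor>" using leads_unique[OF top_in_leads[OF i(2)] N[OF that(1)]] .
      moreover have "i' = nat \<lfloor>t * 2 ^ c\<rfloor>" using leads_unique[OF i(3) N] that by simp
      ultimately show False using i(1) by simp
    qed
    then show ?case unfolding eventually_sequentially by (intro exI[of _ N]) auto
  qed
qed

lemma bad_small:
  assumes "0 < \<eta>"
  obtains e \<epsilon> where "j \<le> e" "0 < \<epsilon>" "prob {w\<in>space Q. \<exists>e1. bad c e \<epsilon> e1 (path_values (W w))} \<le> \<eta>"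
proof -
  have h: "0 < \<eta> / 2" using assms by simp
  have "eventually (\<lambda>e. prob {w\<in>space Q. \<exists>e'\<in>{e..}. conflict c e e' (path_values (W w))} < \<eta> / 2 \<and> j \<le> e) sequentially"
    by (intro eventually_conj order_tendstoD(2)[OF conflict_small h] eventually_ge_at_top)
  then obtain e where e: "prob {w\<in>space Q. \<exists>e'\<in>{e..}. conflict c e e' (path_values (W w))} < \<eta> / 2" "j \<le> e"
    unfolding eventually_sequentially by blast
  obtain n where n: "prob {w\<in>space Q. near_tie e (1 / real (Suc n)) (path_values (W w))} < \<eta> / 2"
    using order_tendstoD(2)[OF near_tie_small h] unfolding eventually_sequentially by blast
  let ?N = "{w\<in>space Q. near_tie e (1 / real (Suc n)) (path_values (W w))}"
  let ?C = "{w\<in>space Q. \<exists>e'\<in>{e..}. conflict c e e' (path_values (W w))}"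
  have sets: "?N \<in> sets Q" "?C \<in> sets Q"
    by (rule near_tie_measurable, rule path_values_measurable)
      (intro sets.sets_Collect_countable_Ex' conflict_measurable path_values_measurable, auto)
  have "prob {w\<in>space Q. \<exists>e1. bad c e (1 / real (Suc n)) e1 (path_values (W w))} \<le> prob (?N \<union> ?C)"
    by (rule finite_measure_mono) (use sets in \<open>auto simp: bad_def\<close>)
  also have "\<dots> \<le> prob ?N + prob ?C" using sets by (rule measure_Un_le)
  finally have "prob {w\<in>space Q. \<exists>e1. bad c e (1 / real (Suc n)) e1 (path_values (W w))} \<le> \<eta>" using e(1) n by linarith
  moreover have "0 < 1 / real (Suc n)" by simp
  ultimately show ?thesis using that e(2) by blast
qed

lemma mixed_process_version:
  assumes "mixed_process Q W W' E V"
  obtains V0 where "\<And>t. (\<lambda>w. V0 w t) \<in> borel_measurable Q" "AE w in Q. V0 w = V w"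
proof -
  obtain Y Y' where Y: "indicator_integral Q W E Y" "indicator_integral Q W' (- E) Y'"
    "AE w in Q. \<forall>t. V w t = Y w t + Y' w t"
    using assms unfolding mixed_process_def by blast
  have [measurable]: "(\<lambda>w. Y w t) \<in> borel_measurable Q" "(\<lambda>w. Y' w t) \<in> borel_measurable Q" for t
    using Y(1,2) unfolding indicator_integral_def has_wiener_integral_def by auto
  show ?thesis
  proof (rule that[of "\<lambda>w t. Y w t + Y' w t"])
    show "AE w in Q. (\<lambda>t. Y w t + Y' w t) = V w" using Y(3) by eventually_elim auto
  qed measurable
qed

lemma patched_values_converge:
  assumes V: "mixed_process Q W W' E V"
    and V0: "\<And>t. (\<lambda>w. V0 w t) \<in> borel_measurable Q" "AE w in Q. V0 w = V w"
    and lm: "filterlim lm at_top sequentially"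
    and E: "\<And>m. cell_error E (2 ^ lm m) (\<kappa> m) \<in> sets lebesgue"
    and small: "\<And>m. emeasure lebesgue (cell_error E (2 ^ lm m) (\<kappa> m)) \<le> ennreal (a m)" "summable a" "\<And>m. 0 \<le> a m"
  shows "AE w in Q. \<forall>e k. k \<le> 2 ^ e \<longrightarrow> (\<lambda>m. patched_values (\<kappa> m) (lm m) w e k) \<longlonglongrightarrow> path_values (V0 w) e k"
proof -
  have "AE w in Q. (\<lambda>m. patched_values (\<kappa> m) (lm m) w e k) \<longlonglongrightarrow> path_values (V0 w) e k" if k: "k \<le> 2 ^ e" for e k
  proof -
    define X where "X m w = (if e \<le> lm m then path_values (V0 w) e k - patched_values (\<kappa> m) (lm m) w e k else 0)" for m w
    have "(\<lambda>w. path_values (V0 w) e k) \<in> borel_measurable Q" unfolding path_values_def by (rule V0(1))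
    then have Xm: "X m \<in> borel_measurable Q" for m
      unfolding X_def by (cases "e \<le> lm m") (simp_all add: borel_measurable_diff patched_values_measurable)
    have "(\<integral>\<^sup>+w. ennreal ((X m w)\<^sup>2) \<partial>Q) \<le> ennreal (16 * a m)" for m
    proof (cases "e \<le> lm m")
      case True
      have "(\<integral>\<^sup>+w. ennreal ((X m w)\<^sup>2) \<partial>Q) = (\<integral>\<^sup>+w. ennreal ((V w (real (k * 2 ^ (lm m - e)) / real (2 ^ lm m))
          - patched (2 ^ lm m) (\<kappa> m) (W w) (W' w) (k * 2 ^ (lm m - e)))\<^sup>2) \<partial>Q)"
      proof (rule nn_integral_cong_AE)
        show "AE w in Q. ennreal ((X m w)\<^sup>2) = ennreal ((V w (real (k * 2 ^ (lm m - e)) / real (2 ^ lm m))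
          - patched (2 ^ lm m) (\<kappa> m) (W w) (W' w) (k * 2 ^ (lm m - e)))\<^sup>2)"
          using V0(2) unfolding dyadic_point[OF True] X_def path_values_def patched_values_def by eventually_elim (simp add: True)
      qed
      also have "\<dots> \<le> 16 * emeasure lebesgue (cell_error E (2 ^ lm m) (\<kappa> m))"
        by (rule mixed_process_error[OF BM BM' V _ dyadic_index_le[OF True k] E]) simp
      also have "\<dots> \<le> 16 * ennreal (a m)" by (intro mult_left_mono small(1)) simp
      also have "\<dots> = ennreal (16 * a m)" using small(3) by (simp add: ennreal_mult)
      finally show ?thesis .
    qed (simp add: X_def)
    then have "AE w in Q. (\<lambda>m. X m w) \<longlonglongrightarrow> 0"
      by (rule AE_tendsto_0_if_summable[OF Xm]) (use small in \<open>auto intro: summable_mult\<close>)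
    then show ?thesis
    proof eventually_elim
      case (elim w)
      have "(\<lambda>m. path_values (V0 w) e k - X m w) \<longlonglongrightarrow> path_values (V0 w) e k - 0"
        by (intro tendsto_diff tendsto_const elim)
      moreover have "eventually (\<lambda>m. path_values (V0 w) e k - X m w = patched_values (\<kappa> m) (lm m) w e k) sequentially"
      proof -
        have "eventually (\<lambda>m. e \<le> lm m) sequentially" using lm unfolding filterlim_at_top by blast
        then show ?thesis by eventually_elim (simp add: X_def)
      qed
      ultimately show ?case by (simp add: tendsto_cong)
    qed
  qed
  then have "AE w in Q. k \<le> 2 ^ e \<longrightarrow> (\<lambda>m. patched_values (\<kappa> m) (lm m) w e k) \<longlonglongrightarrow> path_values (V0 w) e k" for e k
    by (cases "k \<le> 2 ^ e") simp_all
  then show ?thesis unfolding AE_all_countable by blast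
qed

text \<open>A level at which refreshing a fraction \<open>\<eta>\<close> of each cell already makes a common maximizer unlikely,
  uniformly over all sets \<open>E\<close> that do so.  The set \<open>E\<close> enters through approximating unions of
  cells, in which the condition on the fraction is expressed.\<close>

definition decorrelating_level :: "nat \<Rightarrow> real \<Rightarrow> bool" where
  "decorrelating_level e \<eta> \<longleftrightarrow> (\<forall>E V lm \<kappa> a.
      mixed_process Q W W' E V \<longrightarrow> (\<forall>w\<in>space Q. continuous_on UNIV (V w)) \<longrightarrow>
      filterlim lm at_top sequentially \<longrightarrow> (\<forall>m. cell_error E (2 ^ lm m) (\<kappa> m) \<in> sets lebesgue) \<longrightarrow>
      (\<forall>m. emeasure lebesgue (cell_error E (2 ^ lm m) (\<kappa> m)) \<le> ennreal (a m)) \<longrightarrow> summable a \<longrightarrow> (\<forall>m. 0 \<le> a m) \<longrightarrow>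
      eventually (\<lambda>m. blocks_refreshed e \<eta> (lm m) (\<kappa> m)) sequentially \<longrightarrow>
      (\<exists>Z\<in>sets Q. prob Z \<le> 3 * \<eta> \<and> (AE w in Q. (\<exists>t. unique_max (W w) t \<and> unique_max (V w) t) \<longrightarrow> w \<in> Z)))"

text \<open>First the number \<open>2 ^ c\<close> of blocks is chosen, by noise stability, and only then the level \<open>e\<close>, so
  large that for \<open>W\<close> the bad event has probability at most \<open>\<eta>\<close>.  The patched walks have the law of
  \<open>W\<close> on the grid, so their bad events obey the same bound, and by openness so does that of \<open>V\<close>.  Off
  the two bad events a common maximizer puts both grid maxima into one block.\<close>

lemma decorrelating_level_exists:
  assumes \<eta>: "0 < \<eta>" "\<eta> \<le> 1"
  shows "\<exists>e\<ge>j. decorrelating_level e \<eta>"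
proof -
  obtain c where c: "2 \<le> c" and same: "\<And>e l \<kappa>. c \<le> e \<Longrightarrow> e \<le> l \<Longrightarrow>
      (\<And>k. k < 2 ^ e \<Longrightarrow> \<exists>i\<in>{k * 2 ^ (l - e)..<k * 2 ^ (l - e) + 2 ^ (l - e)}. \<not> \<kappa> i) \<Longrightarrow>
      (\<And>k. k < 2 ^ e \<Longrightarrow> card {i\<in>{k * 2 ^ (l - e)..<k * 2 ^ (l - e) + 2 ^ (l - e)}. \<kappa> i} / real (2 ^ (l - e)) \<le> 1 - \<eta>) \<Longrightarrow>
      prob {w\<in>space Q. \<exists>i<2 ^ c. top_in c e i (path_values (W w)) \<and> top_in c e i (patched_values \<kappa> l w)} \<le> \<eta>"
    using same_block_probability[OF _ _ \<eta>(1), of "1 - \<eta>"] \<eta> by (auto simp only: diff_ge_0_iff_ge diff_less_eq less_add_same_cancel1)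
  obtain e \<epsilon> where e: "max j c \<le> e" and \<epsilon>: "0 < \<epsilon>"
    and bW: "prob {w\<in>space Q. \<exists>e1. bad c e \<epsilon> e1 (path_values (W w))} \<le> \<eta>"
    using bad_small[OF \<eta>(1)] by blast
  define Z1 where "Z1 = {w\<in>space Q. \<exists>e1. bad c e \<epsilon> e1 (path_values (W w))}"
  have bm: "{w\<in>space Q. bad c e \<epsilon> e1 (path_values (W w))} \<in> sets Q" for e1
    by (rule bad_measurable) (rule path_values_measurable)
  have Z1: "Z1 \<in> sets Q" unfolding Z1_def by (intro sets.sets_Collect_countable_Ex bm)
  have bW1: "prob {w\<in>space Q. bad c e \<epsilon> e1 (path_values (W w))} \<le> \<eta>" for e1
  proof -
    have "prob {w\<in>space Q. bad c e \<epsilon> e1 (path_values (W w))} \<le> prob Z1"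
      by (rule finite_measure_mono[OF _ Z1]) (auto simp: Z1_def)
    then show ?thesis using bW unfolding Z1_def by linarith
  qed
  show ?thesis
  proof (intro exI[of _ e] conjI)
    show "j \<le> e" using e by simp
    show "decorrelating_level e \<eta>" unfolding decorrelating_level_def
    proof (intro allI impI)
    fix E V lm \<kappa> and a :: "nat \<Rightarrow> real"
    assume V: "mixed_process Q W W' E V" and cont: "\<forall>w\<in>space Q. continuous_on UNIV (V w)"
      and lm: "filterlim lm at_top sequentially" and "\<forall>m. cell_error E (2 ^ lm m) (\<kappa> m) \<in> sets lebesgue"
      and "\<forall>m. emeasure lebesgue (cell_error E (2 ^ lm m) (\<kappa> m)) \<le> ennreal (a m)" and a: "summable a" and "\<forall>m. 0 \<le> a m"
      and blocks: "eventually (\<lambda>m. blocks_refreshed e \<eta> (lm m) (\<kappa> m)) sequentially"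
    then have E: "\<And>m. cell_error E (2 ^ lm m) (\<kappa> m) \<in> sets lebesgue"
      and am: "\<And>m. emeasure lebesgue (cell_error E (2 ^ lm m) (\<kappa> m)) \<le> ennreal (a m)" and a0: "\<And>m. 0 \<le> a m" by blast+
    obtain V0 where V0: "\<And>t. (\<lambda>w. V0 w t) \<in> borel_measurable Q" "AE w in Q. V0 w = V w"
      using mixed_process_version[OF V] by blast
    have pm: "(\<lambda>w. path_values (V0 w) e k) \<in> borel_measurable Q" for e k unfolding path_values_def by (rule V0(1))
    have conv: "AE w in Q. \<forall>e k. k \<le> 2 ^ e \<longrightarrow> (\<lambda>m. patched_values (\<kappa> m) (lm m) w e k) \<longlonglongrightarrow> path_values (V0 w) e k"
      by (rule patched_values_converge[OF V V0 lm E am a a0])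
    have large: "eventually (\<lambda>m. L \<le> lm m) sequentially" for L using lm unfolding filterlim_at_top by blast
    define Z2 where "Z2 e1 = {w\<in>space Q. bad c e \<epsilon> e1 (path_values (V0 w))}" for e1
    have Z2: "Z2 e1 \<in> sets Q" for e1 unfolding Z2_def by (rule bad_measurable) (rule pm)
    have Z2p: "prob (Z2 e1) \<le> \<eta>" for e1
    proof (rule prob_le_if_eventually[OF Z2])
      show "{w\<in>space Q. bad c e \<epsilon> e1 (patched_values (\<kappa> m) (lm m) w)} \<in> sets Q" for m
        by (rule bad_measurable) (rule patched_values_measurable)
      show "AE w in Q. w \<in> Z2 e1 \<longrightarrow> eventually (\<lambda>m. w \<in> {w\<in>space Q. bad c e \<epsilon> e1 (patched_values (\<kappa> m) (lm m) w)}) sequentially"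
        using conv
      proof eventually_elim
        case (elim w)
        show ?case
        proof
          assume "w \<in> Z2 e1"
          then have w: "w \<in> space Q" and b: "bad c e \<epsilon> e1 (path_values (V0 w))" unfolding Z2_def by auto
          have "eventually (\<lambda>m. bad c e \<epsilon> e1 (patched_values (\<kappa> m) (lm m) w)) sequentially"
            by (rule bad_open[OF _ b]) (use elim in blast)
          then show "eventually (\<lambda>m. w \<in> {w\<in>space Q. bad c e \<epsilon> e1 (patched_values (\<kappa> m) (lm m) w)}) sequentially"
            by eventually_elim (simp add: w)
        qed
      qed
      show "eventually (\<lambda>m. prob {w\<in>space Q. bad c e \<epsilon> e1 (patched_values (\<kappa> m) (lm m) w)} \<le> \<eta>) sequentially"
        using large[of "max e e1"] by eventually_elim (simp only: bad_patched_law bW1)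
    qed
    define Z2u where "Z2u = (\<Union>e1. Z2 e1)"
    have Z2u: "Z2u \<in> sets Q" unfolding Z2u_def using Z2 by auto
    have "incseq Z2" unfolding incseq_def Z2_def bad_def by fastforce
    then have "(\<lambda>e1. prob (Z2 e1)) \<longlonglongrightarrow> prob Z2u" unfolding Z2u_def using Z2 by (intro finite_Lim_measure_incseq) auto
    then have Z2up: "prob Z2u \<le> \<eta>" by (rule LIMSEQ_le_const2) (use Z2p in blast)
    define Z3 where "Z3 = {w\<in>space Q. \<exists>i<2 ^ c. top_in c e i (path_values (W w)) \<and> top_in c e i (path_values (V0 w))}"
    have two: "{w\<in>space Q. \<exists>i<2 ^ c. top_in c e i (path_values (W w)) \<and> top_in c e i (y w)} \<in> sets Q"
      if "\<And>k. (\<lambda>w. y w e k) \<in> borel_measurable Q" for y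
    proof -
      have "{w\<in>space Q. \<exists>i<2 ^ c. top_in c e i (path_values (W w)) \<and> top_in c e i (y w)}
        = (\<Union>i<2 ^ c. {w\<in>space Q. top_in c e i (path_values (W w))} \<inter> {w\<in>space Q. top_in c e i (y w)})" by blast
      moreover have "{w\<in>space Q. top_in c e i (path_values (W w))} \<in> sets Q" for i
        by (rule top_in_measurable) (rule path_values_measurable)
      moreover have "{w\<in>space Q. top_in c e i (y w)} \<in> sets Q" for i
        by (rule top_in_measurable) (rule that)
      ultimately show ?thesis by (simp add: sets.finite_UN sets.Int)
    qed
    have Z3: "Z3 \<in> sets Q" unfolding Z3_def by (rule two) (rule pm)
    have Z3p: "prob Z3 \<le> \<eta>"
    proof (rule prob_le_if_eventually[OF Z3])
      show "{w\<in>space Q. \<exists>i<2 ^ c. top_in c e i (path_values (W w)) \<and> top_in c e i (patched_values (\<kappa> m) (lm m) w)} \<in> sets Q" for m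
        by (rule two) (rule patched_values_measurable)
      show "AE w in Q. w \<in> Z3 \<longrightarrow> eventually (\<lambda>m. w \<in> {w\<in>space Q. \<exists>i<2 ^ c. top_in c e i (path_values (W w)) \<and> top_in c e i (patched_values (\<kappa> m) (lm m) w)}) sequentially"
        using conv
      proof eventually_elim
        case (elim w)
        show ?case
        proof
          assume "w \<in> Z3"
          then obtain i where w: "w \<in> space Q" and i: "i < 2 ^ c" "top_in c e i (path_values (W w))" "top_in c e i (path_values (V0 w))"
            unfolding Z3_def by blast
          have "eventually (\<lambda>m. top_in c e i (patched_values (\<kappa> m) (lm m) w)) sequentially"
            by (rule top_in_open[OF _ i(3)]) (use elim in blast)
          then show "eventually (\<lambda>m. w \<in> {w\<in>space Q. \<exists>i<2 ^ c. top_in c e i (path_values (W w)) \<and> top_in c e i (patched_values (\<kappa> m) (lm m) w)}) sequentially"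
            by eventually_elim (use w i in blast)
        qed
      qed
      show "eventually (\<lambda>m. prob {w\<in>space Q. \<exists>i<2 ^ c. top_in c e i (path_values (W w)) \<and> top_in c e i (patched_values (\<kappa> m) (lm m) w)} \<le> \<eta>) sequentially"
        using large[of e] blocks
      proof eventually_elim
        case (elim m)
        show ?case by (rule same) (use e elim in \<open>auto simp only: blocks_refreshed_def max.bounded_iff\<close>)
      qed
    qed
    show "\<exists>Z\<in>sets Q. prob Z \<le> 3 * \<eta> \<and> (AE w in Q. (\<exists>t. unique_max (W w) t \<and> unique_max (V w) t) \<longrightarrow> w \<in> Z)"
    proof (intro bexI conjI)
      show "Z1 \<union> Z2u \<union> Z3 \<in> sets Q" using Z1 Z2u Z3 by simp
      have "prob (Z1 \<union> Z2u \<union> Z3) \<le> prob (Z1 \<union> Z2u) + prob Z3" by (rule measure_Un_le) (use Z1 Z2u Z3 in auto)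
      moreover have "prob (Z1 \<union> Z2u) \<le> prob Z1 + prob Z2u" by (rule measure_Un_le[OF Z1 Z2u])
      ultimately show "prob (Z1 \<union> Z2u \<union> Z3) \<le> 3 * \<eta>" using bW Z2up Z3p unfolding Z1_def[symmetric] by linarith
      show "AE w in Q. (\<exists>t. unique_max (W w) t \<and> unique_max (V w) t) \<longrightarrow> w \<in> Z1 \<union> Z2u \<union> Z3"
        using BM_unique_max[OF BM] V0(2) AE_space
      proof eventually_elim
        case (elim w)
        have cW: "continuous_on {0..1} (W w)"
          by (rule continuous_on_subset[OF two_sided_BM_D(4)[OF BM elim(3)]]) simp
        have cV: "continuous_on {0..1} (V w)"
          by (rule continuous_on_subset[OF bspec[OF cont elim(3)]]) simp
        obtain t where t: "unique_max (W w) t" "\<And>e k. k \<le> 2 ^ e \<Longrightarrow> t \<noteq> real k / 2 ^ e" using elim(1) by blast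
        show ?case
        proof
          assume "\<exists>t. unique_max (W w) t \<and> unique_max (V w) t"
          then obtain t' where t': "unique_max (W w) t'" "unique_max (V w) t'" by blast
          have "t' = t" using t(1) t'(1) unfolding unique_max_def by (metis order_less_asym)
          then have tV: "unique_max (V w) t" using t'(2) by simp
          show "w \<in> Z1 \<union> Z2u \<union> Z3"
          proof (rule ccontr)
            assume n: "w \<notin> Z1 \<union> Z2u \<union> Z3"
            have gW: "\<not> bad c e \<epsilon> e1 (path_values (W w))" for e1 using n elim(3) unfolding Z1_def by blast
            have gV: "\<not> bad c e \<epsilon> e1 (path_values (V w))" for e1

            proof -
              have "w \<notin> Z2 e1" using n unfolding Z2u_def by blast
              then show ?thesis using elim(3) unfolding Z2_def mem_Collect_eq elim(2) by blast
            qed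
            have "top_in c e (nat \<lfloor>t * 2 ^ c\<rfloor>) (path_values (W w))" by (rule top_in_block_of_max[OF cW t(1) t(2) \<epsilon> gW])
            moreover note top_in_block_of_max[OF cV tV t(2) \<epsilon> gV]
            ultimately have "w \<in> Z3" unfolding Z3_def mem_Collect_eq elim(2) using elim(3) by blast
            then show False using n by blast
          qed
        qed
      qed
    qed
    qed
  qed
qed

end

section \<open>Nowhere dense sets exhausting the unit interval\<close>

text \<open>A slit is the first cell of level \<open>e + j\<close> in each cell of level \<open>e\<close>, thus a fraction \<open>2\<^sup>-\<^sup>j\<close> of it.\<close>

definition slits :: "nat \<Rightarrow> nat \<Rightarrow> real set" where
  "slits e j = (\<Union>k<2 ^ e. {real (k * 2 ^ j) / 2 ^ (e + j)<..<real (k * 2 ^ j + 1) / 2 ^ (e + j)})"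

lemma open_slits: "open (slits e j)"
  unfolding slits_def by auto

lemma slits_sets: "(\<Union>j\<in>J. slits (e j) j) \<in> sets lebesgue"
  by (intro sets_completionI_sets) (simp add: borel_open open_UN open_slits)

lemma emeasure_slits: "emeasure lebesgue (slits e j) \<le> ennreal ((1 / 2) ^ j)"
proof -
  have I: "emeasure lebesgue {real (k * 2 ^ j) / 2 ^ (e + j)<..<real (k * 2 ^ j + 1) / 2 ^ (e + j)} = ennreal (1 / 2 ^ (e + j))" for k
    by (subst emeasure_completion) (auto simp: diff_divide_distrib[symmetric] divide_right_mono)
  have "emeasure lebesgue (slits e j) \<le> (\<Sum>k<2 ^ e. emeasure lebesgue {real (k * 2 ^ j) / 2 ^ (e + j)<..<real (k * 2 ^ j + 1) / 2 ^ (e + j)})"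
    unfolding slits_def by (rule emeasure_subadditive_finite) auto
  also have "\<dots> = ennreal (2 ^ e) * ennreal (1 / 2 ^ (e + j))" unfolding I by (simp add: ennreal_of_nat_eq_real_of_nat)
  also have "\<dots> = ennreal ((1 / 2) ^ j)" by (subst ennreal_mult[symmetric]) (auto simp: power_add power_divide)
  finally show ?thesis .
qed

lemma emeasure_slits_tail:
  "emeasure lebesgue (\<Union>j\<in>{n..}. slits (e j) j) \<le> ennreal (2 * (1 / 2) ^ n)"
proof -
  have "(\<Union>j\<in>{n..}. slits (e j) j) = (\<Union>i. slits (e (i + n)) (i + n))"
  proof -
    have "{n..} = range (\<lambda>i. i + n)"
      by (auto simp: image_iff intro: exI[of _ "j - n" for j] le_add_diff_inverse2[symmetric])
    then show ?thesis by simp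
  qed
  moreover have "emeasure lebesgue (\<Union>i. slits (e (i + n)) (i + n)) \<le> (\<Sum>i. emeasure lebesgue (slits (e (i + n)) (i + n)))"
    by (rule emeasure_subadditive_countably) (use open_slits in auto)
  moreover have "\<dots> \<le> (\<Sum>i. ennreal ((1 / 2) ^ (i + n)))" by (intro suminf_le emeasure_slits) auto
  moreover have "(\<Sum>i. ennreal ((1 / 2) ^ (i + n))) = ennreal (2 * (1 / 2) ^ n)"
  proof (rule suminf_ennreal_eq)
    have "(\<lambda>i. (1 / 2) ^ i * (1 / 2) ^ n :: real) sums (1 / (1 - 1 / 2) * (1 / 2) ^ n)"
      by (intro sums_mult2 geometric_sums) simp
    then show "(\<lambda>i. (1 / 2) ^ (i + n) :: real) sums (2 * (1 / 2) ^ n)" by (simp add: power_add)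
  qed simp
  ultimately show ?thesis by (simp only:)
qed

lemma slits_cell:
  assumes s: "e + j \<le> l" and i: "i < 2 ^ l" and x: "real i / 2 ^ l < x" "x < real (Suc i) / 2 ^ l"
  shows "x \<in> slits e j \<longleftrightarrow> (i div 2 ^ (l - (e + j))) mod 2 ^ j = 0"
proof -
  let ?d = "2 ^ (l - (e + j)) :: nat"
  define q where "q = i div ?d"
  have l: "2 ^ l = 2 ^ (e + j) * ?d" using s by (simp add: power_add[symmetric])
  have lr: "(2::real) ^ l = 2 ^ (e + j) * real ?d" using s by (simp add: power_add[symmetric])
  have cell: "real p / 2 ^ (e + j) = real (p * ?d) / 2 ^ l" for p unfolding lr by simp
  have q1: "q * ?d \<le> i" "i < Suc q * ?d"
    unfolding q_def by (auto simp: dividend_less_div_times div_times_less_eq_dividend) 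
  have qx: "real q / 2 ^ (e + j) < x" "x < real (q + 1) / 2 ^ (e + j)"
  proof -
    have "real (q * ?d) / 2 ^ l \<le> real i / 2 ^ l" using q1(1) by (intro divide_right_mono) (simp_all only: of_nat_le_iff, simp)
    then show "real q / 2 ^ (e + j) < x" unfolding cell using x(1) by linarith
    have "Suc i \<le> (q + 1) * ?d" using q1(2) by simp
    then have "real (Suc i) / 2 ^ l \<le> real ((q + 1) * ?d) / 2 ^ l" by (intro divide_right_mono) (simp_all only: of_nat_le_iff, simp)
    then show "x < real (q + 1) / 2 ^ (e + j)" unfolding cell using x(2) by linarith
  qed
  have eq: "p = q" if "real p / 2 ^ (e + j) < x" "x < real (p + 1) / 2 ^ (e + j)" for p
  proof -
    have "real p / 2 ^ (e + j) < real (q + 1) / 2 ^ (e + j)" using that(1) qx(2) by linarith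
    then have "real p < real (q + 1)" by (simp add: divide_less_cancel)
    moreover have "real q / 2 ^ (e + j) < real (p + 1) / 2 ^ (e + j)" using that(2) qx(1) by linarith
    then have "real q < real (p + 1)" by (simp add: divide_less_cancel)
    ultimately show ?thesis by simp
  qed
  have "i < 2 ^ e * 2 ^ j * ?d" using i unfolding l by (simp add: power_add)
  then have ql: "q < 2 ^ e * 2 ^ j" unfolding q_def by (simp add: less_mult_imp_div_less)
  show ?thesis unfolding q_def[symmetric]
  proof
    assume "x \<in> slits e j"
    then obtain k where "real (k * 2 ^ j) / 2 ^ (e + j) < x" "x < real (k * 2 ^ j + 1) / 2 ^ (e + j)"
      unfolding slits_def by auto
    then have "k * 2 ^ j = q" by (rule eq)
    then show "q mod 2 ^ j = 0" by auto
  next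
    assume "q mod 2 ^ j = 0"
    then obtain k where k: "q = k * 2 ^ j" by (auto simp: mod_eq_0_iff_dvd mult.commute elim: dvdE)
    then have "k < 2 ^ e" using ql by simp
    moreover have "x \<in> {real (k * 2 ^ j) / 2 ^ (e + j)<..<real (k * 2 ^ j + 1) / 2 ^ (e + j)}"
      using qx unfolding k greaterThanLessThan_iff by (rule conjI)
    ultimately show "x \<in> slits e j" unfolding slits_def by (intro UN_I[of k]) simp_all
  qed
qed

text \<open>Since the slits have total length \<open>2\<^sup>-\<^sup>j\<close>, removing only those from stage \<open>n\<close> on leaves sets that
  increase to almost the whole interval, by Borel--Cantelli; yet each of them misses a fraction \<open>2\<^sup>-\<^sup>j\<close> of
  every cell of level \<open>e j\<close>, for all \<open>j \<ge> n\<close>.\<close>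

definition cantor_set :: "(nat \<Rightarrow> nat) \<Rightarrow> nat \<Rightarrow> real set" where
  "cantor_set e n = {0..1} - (\<Union>j\<in>{n..}. slits (e j) j)"

lemma closed_cantor_set: "closed (cantor_set e n)"
  unfolding cantor_set_def by (intro closed_Diff closed_atLeastAtMost open_UN ballI open_slits)

lemma cantor_set_mono: "cantor_set e n \<subseteq> cantor_set e (Suc n)"
  unfolding cantor_set_def by (intro Diff_mono UN_mono) auto

lemma cantor_set_exhausts: "emeasure lebesgue ({0..1} - (\<Union>n. cantor_set e n)) = 0"
proof -
  have le: "emeasure lebesgue ({0..1} - (\<Union>n. cantor_set e n)) \<le> ennreal (2 * (1 / 2) ^ n)" for n
  proof -
    have "emeasure lebesgue ({0..1} - (\<Union>n. cantor_set e n)) \<le> emeasure lebesgue (\<Union>j\<in>{n..}. slits (e j) j)"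
      by (intro emeasure_mono slits_sets) (auto simp: cantor_set_def)
    also note emeasure_slits_tail
    finally show ?thesis .
  qed
  have "(\<lambda>n. ennreal (2 * (1 / 2) ^ n)) \<longlonglongrightarrow> ennreal (2 * 0)"
    by (intro tendsto_ennrealI tendsto_mult tendsto_const LIMSEQ_realpow_zero) auto
  then have "emeasure lebesgue ({0..1} - (\<Union>n. cantor_set e n)) \<le> ennreal (2 * 0)"
    by (rule LIMSEQ_le_const) (use le in blast)
  then show ?thesis by simp
qed

lemma slit_midpoint:
  fixes x y h g r :: real
  assumes "x \<le> y" "y < x + h" "0 < g" "g \<le> h" "2 * h < r"
  shows "x < y + g / 2" "y + g / 2 < x + r" "y < y + g / 2" "y + g / 2 < y + g"
  using assms by linarith+

lemma interior_cantor_set: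
  assumes e: "\<And>j. j \<le> e j"
  shows "interior (cantor_set e n) = {}"
proof (rule ccontr)
  assume "interior (cantor_set e n) \<noteq> {}"
  then obtain x where "x \<in> interior (cantor_set e n)" by blast
  then obtain r where r: "0 < r" "ball x r \<subseteq> cantor_set e n" unfolding mem_interior by blast
  have "x \<in> cantor_set e n" using r by auto
  then have x0: "0 \<le> x" by (simp add: cantor_set_def)
  have "(\<lambda>j. (1 / 2) ^ j :: real) \<longlonglongrightarrow> 0" by (intro LIMSEQ_realpow_zero) auto
  moreover have "0 < r / 2" using r(1) by simp
  ultimately have "eventually (\<lambda>j. (1 / 2) ^ j < r / 2) sequentially" by (rule order_tendstoD(2))
  then have "eventually (\<lambda>j. (1 / 2) ^ j < r / 2 \<and> n \<le> j) sequentially"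
    using eventually_ge_at_top by (rule eventually_conj)
  then obtain j where j: "(1 / 2) ^ j < r / 2" "n \<le> j" unfolding eventually_sequentially by blast
  let ?h = "1 / 2 ^ e j :: real" and ?g = "1 / 2 ^ (e j + j) :: real"
  have "(1 / 2) ^ e j \<le> ((1 / 2) ^ j :: real)" by (rule power_decreasing[OF e]) auto
  then have h: "2 * ?h < r" using j(1) by (simp add: power_divide)
  have g: "0 < ?g" "?g \<le> ?h" by (simp_all add: field_simps)
  define k where "k = nat \<lceil>x * 2 ^ e j\<rceil>"
  have "0 \<le> x * 2 ^ e j" using x0 by simp
  then have "real k = of_int \<lceil>x * 2 ^ e j\<rceil>" unfolding k_def by simp
  then have "x * 2 ^ e j \<le> real k" "real k < x * 2 ^ e j + 1" by linarith+
  then have k: "x \<le> real k / 2 ^ e j" "real k / 2 ^ e j < x + ?h"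
    by (simp_all add: le_divide_eq divide_less_eq distrib_right)
  define p where "p = real k / 2 ^ e j + ?g / 2"
  have "x < p" "p < x + r" unfolding p_def by (rule slit_midpoint[OF k g h])+
  have p: "real k / 2 ^ e j < p" "p < real k / 2 ^ e j + ?g" unfolding p_def by (rule slit_midpoint[OF k g h])+
  have "p \<in> ball x r" using \<open>x < p\<close> \<open>p < x + r\<close> by (simp add: dist_real_def)
  then have pC: "p \<in> cantor_set e n" using r(2) by blast
  then have "p \<le> 1" by (simp add: cantor_set_def)
  then have "real k / 2 ^ e j < 1" using p(1) by (rule order_less_le_trans[rotated])
  then have "real k < 2 ^ e j" by simp
  then have ke: "k < 2 ^ e j" using of_nat_less_iff[of k "2 ^ e j", where 'a = real] by simp
  have "real (k * 2 ^ j) / 2 ^ (e j + j) = real k / 2 ^ e j" by (simp add: power_add)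
  moreover have "real (k * 2 ^ j + 1) / 2 ^ (e j + j) = real (k * 2 ^ j) / 2 ^ (e j + j) + ?g" by (simp add: add_divide_distrib)
  ultimately have "real (k * 2 ^ j) / 2 ^ (e j + j) < p" "p < real (k * 2 ^ j + 1) / 2 ^ (e j + j)"
    using p by (simp_all only:)
  then have "p \<in> {real (k * 2 ^ j) / 2 ^ (e j + j)<..<real (k * 2 ^ j + 1) / 2 ^ (e j + j)}"
    unfolding greaterThanLessThan_iff by (rule conjI)
  then have "p \<in> slits (e j) j" unfolding slits_def by (rule UN_I[rotated]) (use ke in simp)
  then show False using pC j(2) unfolding cantor_set_def by auto
qed

text \<open>A sum in place of a maximum: any common refinement of the grids of the slits up to stage \<open>m\<close> will
  do.\<close>

definition fine_level :: "(nat \<Rightarrow> nat) \<Rightarrow> nat \<Rightarrow> nat" where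
  "fine_level e m = (\<Sum>j\<le>m. e j + j)"

lemma fine_level_ge: "j \<le> m \<Longrightarrow> e j + j \<le> fine_level e m"
  unfolding fine_level_def by (rule member_le_sum) auto

definition kept :: "(nat \<Rightarrow> nat) \<Rightarrow> nat \<Rightarrow> nat \<Rightarrow> nat \<Rightarrow> bool" where
  "kept e n m i \<longleftrightarrow> \<not> (\<exists>j\<in>{n..m}. (i div 2 ^ (fine_level e m - (e j + j))) mod 2 ^ j = 0)"

lemma cell_error_measurable:
  assumes "E \<in> sets borel"
  shows "cell_error E L \<kappa> \<in> sets lebesgue"
proof -
  have [measurable]: "cell_index L \<in> measurable borel (count_space UNIV)"
    unfolding cell_index_def[abs_def] by measurable
  have [measurable]: "E \<in> sets borel" by fact
  have "{x\<in>space borel. x \<in> {0<..1} \<and> (x \<in> E) \<noteq> \<kappa> (cell_index L x)} \<in> sets borel" by measurable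
  then show ?thesis unfolding cell_error_def by (simp add: sets_completionI_sets)
qed

text \<open>A cell of the refined grid lies inside a slit of stage at most \<open>m\<close> or is disjoint from it, up to
  endpoints; only the slits of later stages are not resolved.\<close>

lemma cell_error_cantor_set:
  assumes "n \<le> m"
  shows "cell_error (cantor_set e n) (2 ^ fine_level e m) (kept e n m)
    \<subseteq> (\<Union>j\<in>{Suc m..}. slits (e j) j) \<union> (\<lambda>i. real i / 2 ^ fine_level e m) ` {..2 ^ fine_level e m}"
proof
  let ?l = "fine_level e m"
  fix x assume x: "x \<in> cell_error (cantor_set e n) (2 ^ ?l) (kept e n m)"
  define i where "i = cell_index (2 ^ ?l) x"
  have x01: "0 < x" "x \<le> 1" and ne: "(x \<in> cantor_set e n) \<noteq> kept e n m i"
    using x unfolding cell_error_def i_def by auto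
  have ix: "real i / 2 ^ ?l < x" "x \<le> real (Suc i) / 2 ^ ?l"
    using cell_index_iff[of "2 ^ ?l" x i] x01 i_def by auto
  have "real i / 2 ^ ?l < 1" using ix(1) x01(2) by linarith
  then have "real i < 2 ^ ?l" by simp
  then have i: "i < 2 ^ ?l" using of_nat_less_iff[of i "2 ^ ?l", where 'a = real] by simp
  show "x \<in> (\<Union>j\<in>{Suc m..}. slits (e j) j) \<union> (\<lambda>i. real i / 2 ^ ?l) ` {..2 ^ ?l}"
  proof (cases "x = real (Suc i) / 2 ^ ?l")
    case True
    have "Suc i \<in> {..2 ^ ?l}" using i by simp
    then show ?thesis using True by blast
  next
    case False
    then have "x < real (Suc i) / 2 ^ ?l" using ix(2) by simp
    then have mem: "x \<in> slits (e j) j \<longleftrightarrow> (i div 2 ^ (?l - (e j + j))) mod 2 ^ j = 0" if "j \<in> {n..m}" for j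
      using slits_cell[OF fine_level_ge i ix(1)] that by simp
    have "(\<exists>j\<in>{n..m}. (i div 2 ^ (?l - (e j + j))) mod 2 ^ j = 0) \<longleftrightarrow> (\<exists>j\<in>{n..m}. x \<in> slits (e j) j)"
      by (rule bex_cong[OF refl]) (simp only: mem)
    then have "kept e n m i \<longleftrightarrow> x \<notin> (\<Union>j\<in>{n..m}. slits (e j) j)" unfolding kept_def UN_iff by (simp only:)
    then have x: "x \<in> (\<Union>j\<in>{n..}. slits (e j) j)" "x \<notin> (\<Union>j\<in>{n..m}. slits (e j) j)"
      using ne x01 unfolding cantor_set_def by auto
    then obtain j where "n \<le> j" "x \<in> slits (e j) j" by auto
    moreover have "\<not> j \<le> m" using calculation x(2) by auto
    ultimately have "x \<in> (\<Union>j\<in>{Suc m..}. slits (e j) j)" by auto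
    then show ?thesis by blast
  qed
qed

lemma emeasure_cell_error_cantor_set:
  assumes "n \<le> m"
  shows "emeasure lebesgue (cell_error (cantor_set e n) (2 ^ fine_level e m) (kept e n m)) \<le> ennreal ((1 / 2) ^ m)"
proof -
  let ?T = "\<Union>j\<in>{Suc m..}. slits (e j) j" and ?F = "(\<lambda>i. real i / 2 ^ fine_level e m) ` {..2 ^ fine_level e m}"
  have F: "?F \<in> null_sets lebesgue" by (rule null_sets_completionI) (simp add: finite_imp_null_set_lborel)
  have T: "?T \<in> sets lebesgue" by (rule slits_sets)
  have "emeasure lebesgue (cell_error (cantor_set e n) (2 ^ fine_level e m) (kept e n m)) \<le> emeasure lebesgue (?T \<union> ?F)"
    by (rule emeasure_mono[OF cell_error_cantor_set[OF assms]]) (use T F in auto)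
  also have "\<dots> = emeasure lebesgue ?T" by (rule emeasure_Un_null_set[OF T F])
  also have "\<dots> \<le> ennreal (2 * (1 / 2) ^ Suc m)" by (rule emeasure_slits_tail)
  finally show ?thesis by simp
qed

lemma kept_in_blocks:
  fixes M :: nat
  assumes j: "n \<le> j" "j \<le> m" and M0: "M = 2 ^ (fine_level e m - e j)"
  shows "\<exists>i\<in>{k * M..<k * M + M}. \<not> kept e n m i"
    "card {i\<in>{k * M..<k * M + M}. kept e n m i} / real M \<le> 1 - (1 / 2) ^ j"
proof -
  define d where "d = (2::nat) ^ (fine_level e m - (e j + j))"
  have "fine_level e m - e j = j + (fine_level e m - (e j + j))" using fine_level_ge[OF j(2), of e] by simp
  then have M: "M = 2 ^ j * d" unfolding M0 d_def by (simp add: power_add)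
  have d: "0 < d" by (simp add: d_def)
  have r: "\<not> kept e n m i" if "k * M \<le> i" "i < k * M + d" for i
  proof -
    have "i div d = k * 2 ^ j" by (rule div_nat_eqI) (use that in \<open>auto simp: M algebra_simps\<close>)
    then have "(i div d) mod 2 ^ j = 0" by simp
    moreover have "j \<in> {n..m}" using j by simp
    ultimately show ?thesis unfolding kept_def d_def not_not by (rule bexI)
  qed
  show "\<exists>i\<in>{k * M..<k * M + M}. \<not> kept e n m i"
    by (rule bexI[of _ "k * M"]) (use r[of "k * M"] d in \<open>auto simp: M\<close>)
  have "{i\<in>{k * M..<k * M + M}. kept e n m i} \<subseteq> {k * M + d..<k * M + M}" using r by (auto simp: not_less[symmetric])
  then have "card {i\<in>{k * M..<k * M + M}. kept e n m i} \<le> card {k * M + d..<k * M + M}" by (intro card_mono) auto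
  also have "\<dots> = M - d" by simp
  finally have "real (card {i\<in>{k * M..<k * M + M}. kept e n m i}) \<le> real (M - d)" by (simp only: of_nat_le_iff)
  also have "\<dots> = real M - real d" by (simp add: of_nat_diff M)
  also have "\<dots> = (1 - (1 / 2) ^ j) * real M" unfolding M by (simp add: algebra_simps power_divide)
  finally show "card {i\<in>{k * M..<k * M + M}. kept e n m i} / real M \<le> 1 - (1 / 2) ^ j" using d by (simp add: divide_le_eq M)
qed

lemma unique_max_of_maximizer:
  assumes "maximizer v = Some t" shows "unique_max v t"
proof -
  have ex: "\<exists>!t. max_time01 v t" and t: "t = (THE t. max_time01 v t)"
    using assms unfolding maximizer_def by (auto split: if_splits)
  have m: "max_time01 v t" unfolding t using ex by (rule theI')
  have "v s < v t" if s: "s \<in> {0..1}" "s \<noteq> t" for s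
  proof (rule ccontr)
    assume "\<not> v s < v t"
    then have "max_time01 v s" using m s(1) unfolding max_time01_def by force
    then show False using ex m s(2) by blast
  qed
  then show ?thesis using m unfolding unique_max_def max_time01_def by blast
qed

text \<open>A maximizer in the open unit interval is also a local maximum on the line; at an endpoint this can
  fail.\<close>

lemma maximizer_of_unique_max:
  assumes t: "unique_max v t" "0 < t" "t < 1" shows "maximizer v = Some t"
proof -
  have m: "max_time01 v t" using t(1) unfolding unique_max_def max_time01_def by (metis order.refl less_imp_le)
  have u: "s = t" if "max_time01 v s" for s
    using t(1) that m unfolding unique_max_def max_time01_def by (meson not_less)
  have ex: "\<exists>!t. max_time01 v t" using m u by blast
  have the: "(THE t. max_time01 v t) = t" using m u by blast
  have "eventually (\<lambda>s. s \<in> {0<..<1}) (at t)" using t(2,3) by (intro eventually_at_topological[THEN iffD2] exI[of _ "{0<..<1}"]) auto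
  moreover have "eventually (\<lambda>s. s \<noteq> t) (at t)" by (rule eventually_neq_at_within)
  ultimately have "eventually (\<lambda>s. v s < v t) (at t)"
    by eventually_elim (use t(1) in \<open>auto simp: unique_max_def\<close>)
  then show ?thesis unfolding maximizer_def the strict_local_max_def using ex by simp
qed

lemma blocks_refreshed_kept:
  assumes "n \<le> j" "j \<le> m"
  shows "blocks_refreshed (e j) ((1 / 2) ^ j) (fine_level e m) (kept e n m)"
  unfolding blocks_refreshed_def using kept_in_blocks[OF assms refl] by blast

context bm_pair
begin

lemma common_maximum_bound:
  assumes dec: "decorrelating_level (e j) ((1 / 2) ^ j)" and j: "n \<le> j"
    and V: "mixed_process Q W W' (cantor_set e n) V" and cont: "\<forall>w\<in>space Q. continuous_on UNIV (V w)"
  shows "\<exists>Z\<in>sets Q. prob Z \<le> 3 * (1 / 2) ^ j \<and> (AE w in Q. (\<exists>t. unique_max (W w) t \<and> unique_max (V w) t) \<longrightarrow> w \<in> Z)"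
proof -
  let ?lm = "\<lambda>m. fine_level e (n + m)" and ?\<kappa> = "\<lambda>m. kept e n (n + m)" and ?a = "\<lambda>m. (1 / 2 :: real) ^ (n + m)"
  have 1: "filterlim ?lm at_top sequentially"
  proof (rule filterlim_at_top_mono[OF filterlim_ident])
    have "m \<le> ?lm m" for m using fine_level_ge[of "n + m" "n + m" e] by linarith
    then show "eventually (\<lambda>m. m \<le> ?lm m) sequentially" by simp
  qed
  have 2: "\<forall>m. cell_error (cantor_set e n) (2 ^ ?lm m) (?\<kappa> m) \<in> sets lebesgue"
    by (intro allI cell_error_measurable borel_closed closed_cantor_set)
  have 3: "\<forall>m. emeasure lebesgue (cell_error (cantor_set e n) (2 ^ ?lm m) (?\<kappa> m)) \<le> ennreal (?a m)"
    by (intro allI emeasure_cell_error_cantor_set) simp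
  have 4: "summable ?a" unfolding power_add by (intro summable_mult summable_geometric) simp
  have 5: "\<forall>m. 0 \<le> ?a m" by simp
  have 6: "eventually (\<lambda>m. blocks_refreshed (e j) ((1 / 2) ^ j) (?lm m) (?\<kappa> m)) sequentially"
    using eventually_ge_at_top[of j] by eventually_elim (intro blocks_refreshed_kept[OF j], simp)
  show ?thesis
    by (rule dec[unfolded decorrelating_level_def, rule_format, OF V bspec[OF cont] 1 spec[OF 2] spec[OF 3] 4 spec[OF 5] 6])
qed

text \<open>The bounds \<open>3 \<cdot> 2\<^sup>-\<^sup>j\<close> hold for all \<open>j \<ge> n\<close> simultaneously, because all these slits are
  missing from the set.\<close>

theorem maximizers_differ:
  assumes complete: "complete_measure Q"
    and V: "mixed_process Q W W' (cantor_set e n) V" and dec: "\<And>j. decorrelating_level (e j) ((1 / 2) ^ j)"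
  shows "{w\<in>space Q. maximizer (W w) = maximizer (V w)} \<in> null_sets Q"
proof -
  have "\<forall>w\<in>space Q. continuous_on UNIV (V w)"
    using V unfolding mixed_process_def Omega0_def by blast
  note bound = common_maximum_bound[OF dec _ V this]
  have "\<exists>Z. \<forall>j. Z j \<in> sets Q \<and> prob (Z j) \<le> 3 * (1 / 2) ^ (n + j) \<and>
      (AE w in Q. (\<exists>t. unique_max (W w) t \<and> unique_max (V w) t) \<longrightarrow> w \<in> Z j)"
    by (intro choice allI) (use bound[OF le_add1] in \<open>simp only: Bex_def\<close>)
  then obtain Z where Z: "\<And>j. Z j \<in> sets Q" "\<And>j. prob (Z j) \<le> 3 * (1 / 2) ^ (n + j)"
    "\<And>j. AE w in Q. (\<exists>t. unique_max (W w) t \<and> unique_max (V w) t) \<longrightarrow> w \<in> Z j" by blast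
  have I: "(\<Inter>j. Z j) \<in> sets Q" using Z(1) by auto
  have le: "prob (\<Inter>j. Z j) \<le> 3 * (1 / 2) ^ (n + j)" for j
  proof -
    have "prob (\<Inter>j. Z j) \<le> prob (Z j)" by (rule finite_measure_mono[OF _ Z(1)]) auto
    then show ?thesis using Z(2)[of j] by linarith
  qed
  have "(\<lambda>j. 3 * (1 / 2) ^ n * (1 / 2) ^ j :: real) \<longlonglongrightarrow> 3 * (1 / 2) ^ n * 0"
    by (intro tendsto_mult tendsto_const LIMSEQ_realpow_zero) auto
  then have "prob (\<Inter>j. Z j) \<le> 3 * (1 / 2) ^ n * 0"
    by (rule LIMSEQ_le_const) (use le in \<open>auto simp: power_add mult.assoc\<close>)
  then have "prob (\<Inter>j. Z j) = 0" using measure_nonneg[of Q "\<Inter>j. Z j"] by linarith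
  then have nz: "AE w in Q. w \<notin> (\<Inter>j. Z j)" using I by (simp only: prob_eq_0)
  have "AE w in Q. \<forall>j. (\<exists>t. unique_max (W w) t \<and> unique_max (V w) t) \<longrightarrow> w \<in> Z j"
    unfolding AE_all_countable using Z(3) by blast
  with nz have "AE w in Q. maximizer (W w) \<noteq> maximizer (V w)" using BM_unique_max[OF BM]
  proof eventually_elim
    case (elim w)
    obtain t where t: "unique_max (W w) t" "\<And>e k. k \<le> 2 ^ e \<Longrightarrow> t \<noteq> real k / 2 ^ e" using elim(3) by blast
    have "t \<noteq> 0" "t \<noteq> 1" using t(2)[of 0 0] t(2)[of 1 0] by auto
    moreover have "0 \<le> t" "t \<le> 1" using t(1) by (auto simp: unique_max_def)
    ultimately have m: "maximizer (W w) = Some t" by (intro maximizer_of_unique_max t(1)) auto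
    show ?case
    proof
      assume "maximizer (W w) = maximizer (V w)"
      then have "unique_max (V w) t" using m by (intro unique_max_of_maximizer) simp
      then have "\<forall>j. w \<in> Z j" using elim(2) t(1) by blast
      then show False using elim(1) by blast
    qed
  qed
  then have "{w\<in>space Q. \<not> maximizer (W w) \<noteq> maximizer (V w)} \<in> null_sets Q"
    unfolding complete_measure.AE_iff_null_sets[OF complete] .
  then show ?thesis unfolding not_not .
qed

end

theorem mainTheorem7:
  fixes WW :: "(real \<Rightarrow> real) measure"
    and Q :: "'w measure"
    and W W' :: "'w \<Rightarrow> real \<Rightarrow> real"
    and WE :: "real set \<Rightarrow> 'w \<Rightarrow> real \<Rightarrow> real"
  assumes "completed_wiener_measure WW"
    and "wiener_extension WW Q W W'"
    and "\<And>E. E \<in> sets lebesgue \<Longrightarrow> mixed_process Q W W' E (WE E)"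
  shows "\<exists>E :: nat \<Rightarrow> real set.
      (\<forall>n. closed (E n) \<and> E n \<subseteq> {0..1} \<and> interior (closure (E n)) = {}) \<and>
      (\<forall>n. E n \<subseteq> E (Suc n)) \<and>
      emeasure lebesgue ({0..1} - (\<Union>n. E n)) = 0 \<and>
      (\<forall>n. {w \<in> space Q. maximizer (W w) = maximizer (WE (E n) w)} \<in> null_sets Q)"
proof -
  note ext = wiener_extension_BM[OF assms(1,2)]
  have "bm_pair Q W W'"
    unfolding bm_pair_def bm_pair_axioms_def using two_sided_BM_D(1)[OF ext(1)] ext(1,2,4) by (intro conjI)
  then interpret bm_pair Q W W' .
  have "\<forall>j. \<exists>e\<ge>j. decorrelating_level e ((1 / 2) ^ j)"
    by (intro allI decorrelating_level_exists) (simp_all add: power_le_one)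
  then obtain e where e: "\<And>j. j \<le> e j" "\<And>j. decorrelating_level (e j) ((1 / 2) ^ j)"
    using choice[of "\<lambda>j e. j \<le> e \<and> decorrelating_level e ((1 / 2) ^ j)"] by blast
  show ?thesis
  proof (intro exI[of _ "cantor_set e"] conjI allI)
    fix n
    show "closed (cantor_set e n)" by (rule closed_cantor_set)
    show "cantor_set e n \<subseteq> {0..1}" by (auto simp: cantor_set_def)
    show "interior (closure (cantor_set e n)) = {}"
      unfolding closure_closed[OF closed_cantor_set] by (rule interior_cantor_set[OF e(1)])
    show "cantor_set e n \<subseteq> cantor_set e (Suc n)" by (rule cantor_set_mono)
    have "mixed_process Q W W' (cantor_set e n) (WE (cantor_set e n))"
      by (intro assms(3) sets_completionI_sets) (simp add: borel_closed closed_cantor_set)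
    then show "{w \<in> space Q. maximizer (W w) = maximizer (WE (cantor_set e n) w)} \<in> null_sets Q"
      by (rule maximizers_differ[OF ext(5) _ e(2)])
  next
    show "emeasure lebesgue ({0..1} - (\<Union>n. cantor_set e n)) = 0" by (rule cantor_set_exhausts)
  qed
qed

end
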